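(* Let $P\subset\mathbb{R}^n$ be an $n$-dimensional convex body of unit volume. Let $\mu_0$ be a probability measure of the form $\mu_0=\rho_0 1_X\,dx$ such that $X$ is the closure of a bounded domain in $\mathbb{R}^n$ whose boundary $\partial X$ is a null set for Lebesgue measure, and assume that $\rho_0$ is bounded from below and above by positive constants on $X$. Then $$\phi^{(N)}(x):=\frac1k\int_{\mathbb{R}^{n(N-1)}}\log\big(\mathrm{Per}_k(x,x_2,\dots,x_N)\big)\,d\mu_0(x_2)\cdots d\mu_0(x_N)-c_N,$$ where $c_N$ is the constant ensuring $\int_{\mathbb{R}^n}\phi^{(N)}\mu_0=0$, converges, as $N=N_k\to\infty$, locally uniformly to the unique convex function $\phi$ solving the second boundary value problem with target $P$ for the Monge–Ampère equation $MA(\phi)=\mu_0$ with the normalization $\int_{\mathbb{R}^n}\phi\,\mu_0=0$. Moreover, $$T^{(N)}(x):=\nabla\phi^{(N)}(x)=\frac1k\int_{\mathbb{R}^{n(N-1)}}\frac{\sum_{\sigma\in S_N}p_{\sigma(1)}e^{x\cdot p_{\sigma(1)}+x_2\cdot p_{\sigma(2)}+\cdots+x_N\cdot p_{\sigma(N)}}}{\sum_{\sigma\in S_N}e^{x\cdot p_{\sigma(1)}+x_2\cdot p_{\sigma(2)}+\cdots+x_N\cdot p_{\sigma(N)}}}\,d\mu_0(x_2)\cdots d\mu_0(x_N)$$ converges pointwise, in the interior of $X$, to the (Hölder continuous) optimal map $T$ for the Monge problem of transporting the probability measure $\mu_0$ on $X$ to the uniform probability measure $\lambda_P=1_P\,dp$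 on $P$.
   Context: For a positive integer $k$, $p_1,\dots,p_N$ ($N=N_k$) are the points of $kP\cap\mathbb{Z}^n$ and $\mathrm{Per}_k(x_1,\dots,x_N)=\sum_{\sigma\in S_N}\prod_{i=1}^N e^{x_i\cdot p_{\sigma(i)}}$. $MA(\phi)$ is the Alexandrov Monge–Ampère measure: $MA(\phi)(E)$ is the Lebesgue measure of the image of $E$ under the subgradient map of the convex function $\phi$. Solving the second boundary value problem with target $P$ means that all subgradients of $\phi$ on $\mathbb{R}^n$ lie in $P$ (and the subgradient image covers $P$ up to a null set). The Monge problem: minimize $\int c(x,T(x))\,\mu_0$ over maps $T$ with $T_*\mu_0=\lambda_P$, with the cost function $c(x,p)=-x\cdot p$. *)

theory Defs
  imports "HOL-Probability.Probability" "HOL-Combinatorics.Permutations"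
begin

text \<open>The points of \<open>k P \<inter> \<int>\<^sup>n\<close> and their number \<open>N\<^sub>k\<close>.\<close>

definition lattice_points :: "(real ^ 'n) set \<Rightarrow> nat \<Rightarrow> (real ^ 'n) set" where
  "lattice_points P k = (\<lambda>x. real k *\<^sub>R x) ` P \<inter> {p. \<forall>i. p $ i \<in> \<int>}"

definition num_points :: "(real ^ 'n) set \<Rightarrow> nat \<Rightarrow> nat" where
  "num_points P k = card (lattice_points P k)"

text \<open>In the next three definitions \<open>p 1, \<dots>, p N\<close> enumerates the lattice points.
  A configuration \<open>(x\<^sub>1, \<dots>, x\<^sub>N)\<close> is a function on indices, read only on \<open>{1..N}\<close>; in the
  integrals \<open>x\<^sub>2, \<dots>, x\<^sub>N\<close> is the variable \<open>y\<close> of the product measure on \<open>{2..N}\<close>, and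
  \<open>y(1 := x)\<close> is \<open>(x, x\<^sub>2, \<dots>, x\<^sub>N)\<close>.\<close>

definition Per :: "nat \<Rightarrow> (nat \<Rightarrow> real ^ 'n) \<Rightarrow> (nat \<Rightarrow> real ^ 'n) \<Rightarrow> real" where
  "Per N p x = (\<Sum>\<sigma> | \<sigma> permutes {1..N}. \<Prod>i\<in>{1..N}. exp (x i \<bullet> p (\<sigma> i)))"

definition phi_unnormalized ::
    "(real ^ 'n) measure \<Rightarrow> nat \<Rightarrow> nat \<Rightarrow> (nat \<Rightarrow> real ^ 'n) \<Rightarrow> real ^ 'n \<Rightarrow> real" where
  "phi_unnormalized \<mu> k N p x =
     (1 / real k) * (\<integral>y. ln (Per N p (y(1 := x))) \<partial>(\<Pi>\<^sub>M i\<in>{2..N}. \<mu>))"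

definition phi_const ::
    "(real ^ 'n) measure \<Rightarrow> nat \<Rightarrow> nat \<Rightarrow> (nat \<Rightarrow> real ^ 'n) \<Rightarrow> real" where
  "phi_const \<mu> k N p = (THE c. (\<integral>x. phi_unnormalized \<mu> k N p x - c \<partial>\<mu>) = 0)"

definition phiN ::
    "(real ^ 'n) measure \<Rightarrow> nat \<Rightarrow> nat \<Rightarrow> (nat \<Rightarrow> real ^ 'n) \<Rightarrow> real ^ 'n \<Rightarrow> real" where
  "phiN \<mu> k N p x = phi_unnormalized \<mu> k N p x - phi_const \<mu> k N p"

definition TN ::
    "(real ^ 'n) measure \<Rightarrow> nat \<Rightarrow> nat \<Rightarrow> (nat \<Rightarrow> real ^ 'n) \<Rightarrow> real ^ 'n \<Rightarrow> real ^ 'n" where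
  "TN \<mu> k N p x =
     (1 / real k) *\<^sub>R
       (\<integral>y. (\<Sum>\<sigma> | \<sigma> permutes {1..N}.
                exp (\<Sum>i\<in>{1..N}. (y(1 := x)) i \<bullet> p (\<sigma> i)) *\<^sub>R p (\<sigma> 1))
           /\<^sub>R (\<Sum>\<sigma> | \<sigma> permutes {1..N}. exp (\<Sum>i\<in>{1..N}. (y(1 := x)) i \<bullet> p (\<sigma> i)))
        \<partial>(\<Pi>\<^sub>M i\<in>{2..N}. \<mu>))"

definition subdifferential :: "('a::real_inner \<Rightarrow> real) \<Rightarrow> 'a \<Rightarrow> 'a set" where
  "subdifferential f x = {v. \<forall>y. f x + v \<bullet> (y - x) \<le> f y}"

text \<open>For convex \<open>f\<close> the subgradient image of a Borel set is Lebesgue but in general not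
  obviously Borel measurable, hence \<^term>\<open>lebesgue\<close> on the right-hand side.\<close>

definition monge_ampere :: "('a::euclidean_space \<Rightarrow> real) \<Rightarrow> 'a measure" where
  "monge_ampere f = measure_of UNIV (sets borel)
     (\<lambda>E. emeasure lebesgue (\<Union>x\<in>E. subdifferential f x))"

definition solves_second_bvp ::
    "'a::euclidean_space measure \<Rightarrow> 'a set \<Rightarrow> ('a \<Rightarrow> real) \<Rightarrow> bool" where
  "solves_second_bvp \<mu> P f \<longleftrightarrow>
     convex_on UNIV f \<and> monge_ampere f = \<mu> \<and>
     (\<Union>x. subdifferential f x) \<subseteq> P \<and>
     negligible (P - (\<Union>x. subdifferential f x))"

definition transport_map :: "'a::euclidean_space measure \<Rightarrow> 'a measure \<Rightarrow> ('a \<Rightarrow> 'a) \<Rightarrow> bool" where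
  "transport_map \<mu> \<nu> T \<longleftrightarrow> T \<in> measurable \<mu> borel \<and> distr \<mu> borel T = \<nu>"

text \<open>Optimality for the cost \<open>c(x, p) = - x \<bullet> p\<close>. The Bochner integral is \<open>0\<close> for functions
  that are not integrable; this is harmless when \<open>\<mu>\<close> and \<open>\<nu>\<close> are finite and concentrated on
  bounded sets, since the cost of every transport map is then integrable.\<close>

definition optimal_map :: "'a::euclidean_space measure \<Rightarrow> 'a measure \<Rightarrow> ('a \<Rightarrow> 'a) \<Rightarrow> bool" where
  "optimal_map \<mu> \<nu> T \<longleftrightarrow> transport_map \<mu> \<nu> T \<and>
     (\<forall>S. transport_map \<mu> \<nu> S \<longrightarrow> (\<integral>x. - (x \<bullet> T x) \<partial>\<mu>) \<le> (\<integral>x. - (x \<bullet> S x) \<partial>\<mu>))"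

text \<open>The class \<open>C\<^sup>0\<^sup>,\<^sup>\<alpha>\<close> in the local sense: one exponent, constants depending on the
  compact subset.\<close>

definition locally_hoelder_on ::
    "'a::metric_space set \<Rightarrow> ('a \<Rightarrow> 'b::metric_space) \<Rightarrow> bool" where
  "locally_hoelder_on S f \<longleftrightarrow>
     (\<exists>\<alpha>. 0 < \<alpha> \<and> \<alpha> \<le> 1 \<and>
       (\<forall>K. compact K \<and> K \<subseteq> S \<longrightarrow>
         (\<exists>C. \<forall>x\<in>K. \<forall>y\<in>K. dist (f x) (f y) \<le> C * dist x y powr \<alpha>)))"

end

theory Submission
  imports Defs "HOL-Complex_Analysis.Great_Picard"
begin

text \<open>
  Let \<open>\<phi>\<close> minimise the Kantorovich functional and let \<open>\<kappa>\<close> be its Legendre transform over \<open>X\<close>. The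
  first variation shows that \<open>\<nabla>\<kappa>\<close> transports \<open>\<lambda>\<^sub>P\<close> to \<open>\<mu>\<^sub>0\<close>, which is the Monge--Ampere equation for
  \<open>\<phi>\<close>; convex functions with common subgradients almost everywhere differ by a constant, which gives
  uniqueness.

  The gap \<open>\<phi>(x) + \<kappa>(p) - x \<bullet> p\<close> is nonnegative on \<open>X\<close> and convex in \<open>p\<close>. Since \<open>T\<^sup>(\<^sup>N\<^sup>)(x)\<close> is the conditional
  mean of \<open>p\<^bsub>\<sigma>(1)\<^esub>/k\<close> under the Gibbs measure on permutations, Jensen's inequality bounds the mean
  gap at \<open>(x, T\<^sup>(\<^sup>N\<^sup>)(x))\<close> by the gap of the Gibbs coupling. The latter tends to \<open>0\<close>: the entropy costs at
  most \<open>log N! / (k N)\<close>, and an explicit matching of the sample with the lattice points, built from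
  the law of large numbers on a fine partition of \<open>P\<close>, is almost optimal. Hence each limit point of
  \<open>\<phi>\<^sup>(\<^sup>N\<^sup>)\<close> has the gradient of \<open>\<phi>\<close> almost everywhere on \<open>X\<close>.

  For the interior regularity, let \<open>S\<close> be a section of \<open>\<phi>\<close>. Comparing the volumes of the polar bodies
  of \<open>S\<close> at two of its points, which the Monge--Ampere bounds control from both sides, shows that the
  Bregman distance of \<open>\<phi>\<close> is quasi-symmetric. Along a segment this forces first strict
  convexity, then the power decay that is Hoelder continuity of the gradient.
\<close>


section \<open>Subgradients of convex functions\<close>

text \<open>Two obstacles shape the analytic half. \<open>X\<close> need not be convex, so sections
  of \<phi> may leave it, and the Monge-Ampere measure vanishes outside; volumes are therefore
  compared by homotheties whose centre has a ball around it inside \<open>X\<close>, or inside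
  sections small enough to stay in \<open>X\<close>. Moreover, images under a multivalued
  subgradient map are awkward to measure. The inverse map \<open>sgrad \<kappa>\<close>, by
  contrast, is Borel and total, and the image of a set under the subgradients of \<phi> agrees up to
  a null set with its preimage under that map; so both existence and uniqueness are settled on the
  side of \<open>P\<close>. On the probabilistic side only the mean gap is estimated.
  Exchangeability replaces the gap of the first sample point by the average over all points; the
  part of it that depends on the permutation is the energy, for which a lower bound by one good
  matching is enough. The entropy disappears since the number of lattice points grows only
  polynomially in \<open>k\<close>, while the potentials carry the factor
  \<open>1 / k\<close>.\<close>

lemma subdifferentialI:
  "(\<And>y. f x + v \<bullet> (y - x) \<le> f y) \<Longrightarrow> v \<in> subdifferential f x"
  by (simp add: subdifferential_def)

lemma subdifferentialD:
  "v \<in> subdifferential f x \<Longrightarrow> f x + v \<bullet> (y - x) \<le> f y"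
  by (simp add: subdifferential_def)

lemma convex_on_UNIV_continuous:
  fixes f :: "'a::euclidean_space \<Rightarrow> real"
  assumes "convex_on UNIV f"
  shows "continuous_on A f"
  using convex_on_continuous[OF open_UNIV assms] continuous_on_subset by blast

text \<open>A hyperplane separating \<open>(x, f x)\<close> from the strict epigraph is not
  vertical, because \<open>f\<close> is finite on the whole space; dividing its normal by the last
  component gives the subgradient.\<close>

lemma subdifferential_nonempty:
  fixes f :: "'a::euclidean_space \<Rightarrow> real"
  assumes "convex_on UNIV f"
  obtains v where "v \<in> subdifferential f x"
proof -
  let ?T = "{z :: 'a \<times> real. f (fst z) < snd z}"
  have "convex ?T"
  proof (rule convexI)
    fix z w :: "'a \<times> real" and s t :: real
    assume *: "z \<in> ?T" "w \<in> ?T" "0 \<le> s" "0 \<le> t" "s + t = 1"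
    have "f (s *\<^sub>R fst z + t *\<^sub>R fst w) \<le> s * f (fst z) + t * f (fst w)"
      using assms * by (simp add: convex_on_def)
    also have "\<dots> < s * snd z + t * snd w"
    proof (cases "s = 0")
      case False
      then show ?thesis using * by (intro add_less_le_mono) (auto intro!: mult_left_mono)
    qed (use * in auto)
    finally show "s *\<^sub>R z + t *\<^sub>R w \<in> ?T" by simp
  qed
  moreover have "(x, f x + 1) \<in> ?T" by simp
  moreover have "{(x, f x)} \<inter> ?T = {}" by auto
  ultimately obtain a b where a: "a \<noteq> 0" and a1: "\<And>z. z \<in> {(x, f x)} \<Longrightarrow> a \<bullet> z \<le> b"
    and a2: "\<And>z. z \<in> ?T \<Longrightarrow> b \<le> a \<bullet> z"
    using separating_hyperplane_sets[of "{(x, f x)}" ?T] by blast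
  obtain v s where vs: "a = (v, s)" by fastforce
  have le: "v \<bullet> x + s * f x \<le> v \<bullet> y + s * t" if "f y < t" for y t
    using a1[of "(x, f x)"] a2[of "(y, t)"] that vs by auto
  have "s \<ge> 0" using le[of x "f x + 1"] by (simp add: algebra_simps)
  \<comment> \<open>A vertical hyperplane would make \<open>v \<bullet> x\<close> the minimum of
    \<open>v \<bullet> y\<close> over all \<open>y\<close>; the point \<open>x - v\<close> refutes
    this unless \<open>v = 0\<close>.\<close>
  moreover have "s \<noteq> 0"
  proof
    assume "s = 0"
    then have "v \<bullet> x \<le> v \<bullet> (x - v)" using le[of "x - v" "f (x - v) + 1"] by simp
    then have "v \<bullet> v \<le> 0" by (simp add: inner_diff_right)
    then have "v = 0" by (metis inner_ge_zero inner_eq_zero_iff order_antisym)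
    with \<open>s = 0\<close> a vs show False by (simp add: zero_prod_def)
  qed
  ultimately have s: "s > 0" by simp
  have "f x + (- v /\<^sub>R s) \<bullet> (y - x) \<le> f y" for y
  proof (rule dense_ge)
    fix t assume "f y < t"
    then have "v \<bullet> x - v \<bullet> y \<le> (t - f x) * s"
      using le[of y t] by (simp add: algebra_simps)
    then have "(v \<bullet> x - v \<bullet> y) / s \<le> t - f x" using s by (simp add: pos_divide_le_eq)
    then have "f x + (v \<bullet> x - v \<bullet> y) / s \<le> t" by simp
    moreover have "(- v /\<^sub>R s) \<bullet> (y - x) = (v \<bullet> x - v \<bullet> y) / s"
      using s by (simp add: inner_diff_right field_simps)
    ultimately show "f x + (- v /\<^sub>R s) \<bullet> (y - x) \<le> t" by simp
  qed
  then show ?thesis by (intro that subdifferentialI)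
qed

lemma subdifferential_limit:
  fixes f :: "'a::euclidean_space \<Rightarrow> real"
  assumes f: "convex_on UNIV f"
    and x: "x \<longlonglongrightarrow> x0" and v: "v \<longlonglongrightarrow> v0" and xv: "\<And>n. v n \<in> subdifferential f (x n)"
  shows "v0 \<in> subdifferential f x0"
proof (rule subdifferentialI)
  fix y
  have "isCont f x0"
    using convex_on_UNIV_continuous[OF f, of UNIV] by (simp add: continuous_on_eq_continuous_at)
  then have "(\<lambda>n. f (x n) + v n \<bullet> (y - x n)) \<longlonglongrightarrow> f x0 + v0 \<bullet> (y - x0)"
    using x v by (intro tendsto_intros isCont_tendsto_compose[where g = f])
  then show "f x0 + v0 \<bullet> (y - x0) \<le> f y"
    by (rule LIMSEQ_le_const2) (use subdifferentialD[OF xv] in auto)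
qed

lemma subdifferential_norm_le:
  fixes f :: "'a::real_inner \<Rightarrow> real"
  assumes "L-lipschitz_on UNIV f" "v \<in> subdifferential f x"
  shows "norm v \<le> L"
proof (cases "v = 0")
  case True
  then show ?thesis using assms lipschitz_on_nonneg by auto
next
  case False
  have "v \<bullet> v \<le> f (x + v) - f x" using subdifferentialD[OF assms(2), of "x + v"] by simp
  also have "\<dots> \<le> L * norm v"
    using lipschitz_onD[OF assms(1), of "x + v" x] by (simp add: dist_real_def dist_norm)
  finally have "norm v * norm v \<le> L * norm v" by (simp add: dot_square_norm power2_eq_square)
  then show ?thesis using False by simp
qed

lemma lipschitz_of_bounded_subdifferential:
  fixes f :: "'a::euclidean_space \<Rightarrow> real"
  assumes f: "convex_on UNIV f" and L: "\<And>x v. v \<in> subdifferential f x \<Longrightarrow> norm v \<le> L"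
  shows "L-lipschitz_on UNIV f"
proof (rule lipschitz_onI)
  have *: "f x - f y \<le> L * dist x y" for x y
  proof -
    obtain v where v: "v \<in> subdifferential f x" using subdifferential_nonempty[OF f] .
    have "f x - f y \<le> v \<bullet> (x - y)"
      using subdifferentialD[OF v, of y] by (simp add: inner_diff_right)
    also have "\<dots> \<le> norm v * norm (x - y)" by (rule norm_cauchy_schwarz)
    also have "\<dots> \<le> L * dist x y" using L[OF v] by (simp add: dist_norm mult_right_mono)
    finally show ?thesis .
  qed
  then show "dist (f x) (f y) \<le> L * dist x y" for x y
    using *[of x y] *[of y x] by (simp add: dist_real_def abs_le_iff dist_commute)
  show "0 \<le> L"
    using L subdifferential_nonempty[OF f, of undefined] norm_ge_zero order_trans by metis
qed

section \<open>Almost every subdifferential is a singleton\<close>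

text \<open>The one-sided derivative of a convex function. Difference quotients are monotone in the
  step, so the steps \<open>1 / Suc m\<close> capture the limit, and a limit of a sequence keeps
  Borel measurability.\<close>

definition rderiv :: "('a::real_vector \<Rightarrow> real) \<Rightarrow> 'a \<Rightarrow> 'a \<Rightarrow> real" where
  "rderiv f e p = lim (\<lambda>m. (f (p + e /\<^sub>R real (Suc m)) - f p) * real (Suc m))"

lemma convex_on_slope_mono:
  fixes f :: "'a::real_vector \<Rightarrow> real"
  assumes f: "convex_on UNIV f" and "0 < a" "a \<le> b"
  shows "(f (p + a *\<^sub>R e) - f p) / a \<le> (f (p + b *\<^sub>R e) - f p) / b"
proof -
  have "p + a *\<^sub>R e = (1 - a / b) *\<^sub>R p + (a / b) *\<^sub>R (p + b *\<^sub>R e)"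
    using assms by (simp add: algebra_simps)
  also have "f \<dots> \<le> (1 - a / b) * f p + (a / b) * f (p + b *\<^sub>R e)"
    using convex_onD[OF f, of "a / b" p "p + b *\<^sub>R e"] assms by simp
  finally have "f (p + a *\<^sub>R e) - f p \<le> (a / b) * (f (p + b *\<^sub>R e) - f p)"
    by (simp add: algebra_simps)
  then show ?thesis using assms by (simp add: field_simps)
qed

lemma rderiv_LIMSEQ:
  fixes f :: "'a::euclidean_space \<Rightarrow> real"
  assumes f: "convex_on UNIV f"
  shows "(\<lambda>m. (f (p + e /\<^sub>R real (Suc m)) - f p) * real (Suc m)) \<longlonglongrightarrow> rderiv f e p"
proof -
  let ?q = "\<lambda>m. (f (p + e /\<^sub>R real (Suc m)) - f p) * real (Suc m)"
  obtain v where v: "v \<in> subdifferential f p" using subdifferential_nonempty[OF f] .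
  have "decseq ?q"
  proof (rule decseq_SucI)
    fix m
    have "inverse (real (Suc (Suc m))) \<le> inverse (real (Suc m))"
      by (rule le_imp_inverse_le) auto
    from convex_on_slope_mono[OF f _ this, of p e] show "?q (Suc m) \<le> ?q m"
      by (simp add: divide_inverse del: of_nat_Suc)
  qed
  moreover have "v \<bullet> e \<le> ?q m" for m
    using subdifferentialD[OF v, of "p + e /\<^sub>R real (Suc m)"] by (simp add: field_simps)
  ultimately obtain l where "?q \<longlonglongrightarrow> l" using decseq_convergent[of ?q "v \<bullet> e"] by blast
  then have "convergent ?q" by (rule convergentI)
  then show ?thesis unfolding rderiv_def by (simp add: convergent_LIMSEQ_iff)
qed

lemma subdifferential_le_rderiv:
  fixes f :: "'a::euclidean_space \<Rightarrow> real"
  assumes f: "convex_on UNIV f" and v: "v \<in> subdifferential f p"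
  shows "v \<bullet> e \<le> rderiv f e p"
proof (rule LIMSEQ_le_const[OF rderiv_LIMSEQ[OF f]])
  have "v \<bullet> e \<le> (f (p + e /\<^sub>R real (Suc m)) - f p) * real (Suc m)" for m
    using subdifferentialD[OF v, of "p + e /\<^sub>R real (Suc m)"] by (simp add: field_simps)
  then show "\<exists>N. \<forall>m\<ge>N. v \<bullet> e \<le> (f (p + e /\<^sub>R real (Suc m)) - f p) * real (Suc m)" by blast
qed

lemma rderiv_le_slope:
  fixes f :: "'a::euclidean_space \<Rightarrow> real"
  assumes f: "convex_on UNIV f" and h: "h > 0"
  shows "rderiv f e p \<le> (f (p + h *\<^sub>R e) - f p) / h"
proof (rule LIMSEQ_le_const2[OF rderiv_LIMSEQ[OF f]])
  obtain N where N: "inverse (real (Suc N)) < h" using reals_Archimedean[OF h] by blast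
  have "(f (p + e /\<^sub>R real (Suc m)) - f p) * real (Suc m) \<le> (f (p + h *\<^sub>R e) - f p) / h" if "m \<ge> N" for m
  proof -
    have "inverse (real (Suc m)) \<le> inverse (real (Suc N))" using that by (simp add: le_imp_inverse_le)
    then have "inverse (real (Suc m)) \<le> h" using N by linarith
    from convex_on_slope_mono[OF f _ this, of p e] show ?thesis
      by (simp add: divide_inverse del: of_nat_Suc)
  qed
  then show "\<exists>N. \<forall>m\<ge>N. (f (p + e /\<^sub>R real (Suc m)) - f p) * real (Suc m) \<le> (f (p + h *\<^sub>R e) - f p) / h"
    by blast
qed

lemma borel_measurable_rderiv [measurable]:
  fixes f :: "'a::euclidean_space \<Rightarrow> real"
  assumes f: "convex_on UNIV f"
  shows "rderiv f e \<in> borel_measurable borel"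
proof -
  have [measurable]: "f \<in> borel_measurable borel"
    using convex_on_UNIV_continuous[OF f] by (intro borel_measurable_continuous_onI)
  show ?thesis unfolding rderiv_def[abs_def] by (intro borel_measurable_lim_metric) measurable
qed

text \<open>On each line in direction \<open>e\<close> the one-sided derivatives differ at countably many points only;
  by Tonelli, almost every translate of the exceptional set is null, hence so is the set.\<close>

lemma AE_rderiv_symmetric:
  fixes f :: "'a::euclidean_space \<Rightarrow> real"
  assumes f: "convex_on UNIV f"
  shows "AE p in lborel. rderiv f (- e) p = - rderiv f e p"
proof -
  note [measurable] = borel_measurable_rderiv[OF f]
  let ?P = "\<lambda>p. rderiv f (- e) p = - rderiv f e p"
  have "AE t in lborel. ?P (p + t *\<^sub>R e)" for p
  proof -
    define g where "g t = rderiv f e (p + t *\<^sub>R e)" for t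
    have up: "- rderiv f (- e) z \<le> rderiv f e z" for z
    proof -
      obtain v where v: "v \<in> subdifferential f z" using subdifferential_nonempty[OF f] .
      show ?thesis using subdifferential_le_rderiv[OF f v, of e] subdifferential_le_rderiv[OF f v, of "- e"]
        by simp
    qed
    \<comment> \<open>Along the line, the right derivative at \<open>s\<close> is at most the slope
      of the chord from \<open>s\<close> to \<open>t\<close>, which is at most the left derivative
      at \<open>t\<close>.\<close>
    have lo: "g s \<le> - rderiv f (- e) (p + t *\<^sub>R e)" if "s < t" for s t
    proof -
      have e: "p + s *\<^sub>R e + (t - s) *\<^sub>R e = p + t *\<^sub>R e" "p + t *\<^sub>R e + (t - s) *\<^sub>R (- e) = p + s *\<^sub>R e"
        by (simp_all add: algebra_simps)
      have "g s \<le> (f (p + t *\<^sub>R e) - f (p + s *\<^sub>R e)) / (t - s)"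
        "rderiv f (- e) (p + t *\<^sub>R e) \<le> (f (p + s *\<^sub>R e) - f (p + t *\<^sub>R e)) / (t - s)"
        using rderiv_le_slope[OF f, of "t - s" e "p + s *\<^sub>R e", unfolded e]
          rderiv_le_slope[OF f, of "t - s" "- e" "p + t *\<^sub>R e", unfolded e] that by (simp_all add: g_def)
      moreover have "(f (p + s *\<^sub>R e) - f (p + t *\<^sub>R e)) / (t - s) = - ((f (p + t *\<^sub>R e) - f (p + s *\<^sub>R e)) / (t - s))"
        by (simp add: minus_divide_left)
      ultimately show ?thesis by linarith
    qed
    have "mono g"
    proof (rule monoI)
      fix s t :: real assume "s \<le> t"
      then show "g s \<le> g t" using lo[of s t] up[of "p + t *\<^sub>R e"] by (cases "s = t") (auto simp: g_def)
    qed
    then have "countable {t. \<not> isCont g t}" by (rule mono_ctble_discont)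
    then have "AE t in lborel. isCont g t"
      by (intro AE_I'[of "{t. \<not> isCont g t}"]) (auto intro: countable_imp_null_set_lborel)
    \<comment> \<open>At a continuity point the values \<open>g s\<close> with \<open>s < t\<close>
      tend to \<open>g t\<close>, and they stay below the left derivative at
      \<open>t\<close>.\<close>
    moreover have "?P (p + t *\<^sub>R e)" if "isCont g t" for t
    proof -
      have "(g \<longlongrightarrow> g t) (at_left t)" using that by (simp add: continuous_at_imp_continuous_at_within continuous_within[symmetric])
      then have "g t \<le> - rderiv f (- e) (p + t *\<^sub>R e)"
        by (rule tendsto_upperbound) (use lo in \<open>auto simp: eventually_at_filter\<close>)
      with up[of "p + t *\<^sub>R e"] show ?thesis by (simp add: g_def)
    qed
    ultimately show ?thesis by auto
  qed
  then have "AE p in lborel. AE t in lborel. ?P (p + t *\<^sub>R e)" by simp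
  moreover have "{x \<in> space (lborel \<Otimes>\<^sub>M lborel). ?P (fst x + snd x *\<^sub>R e)} \<in> sets (lborel \<Otimes>\<^sub>M (lborel :: real measure))"
    by measurable
  ultimately have "AE t in (lborel :: real measure). AE p in lborel. ?P (p + t *\<^sub>R e)"
    by (subst (asm) lborel_pair.AE_commute) auto
  \<comment> \<open>Lebesgue measure on the line is nonzero, so a single good shift \<open>t\<close>
    exists; translation invariance then removes it.\<close>
  moreover have "\<not> (AE t in (lborel :: real measure). False)"
    by (simp add: AE_iff_measurable[of UNIV])
  ultimately obtain t :: real where t: "AE p in lborel. ?P (p + t *\<^sub>R e)"
    using eventually_mono by blast
  have "AE p in distr lborel borel (\<lambda>p. t *\<^sub>R e + p). ?P p"
    by (subst AE_distr_iff) (use t in \<open>auto simp: add.commute\<close>)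
  then show ?thesis by (simp only: lborel_distr_plus)
qed

text \<open>Total and Borel for convex \<open>f\<close>: the vector of right derivatives in the
  basis directions, which is a gradient almost everywhere.\<close>

definition sgrad :: "('a::euclidean_space \<Rightarrow> real) \<Rightarrow> 'a \<Rightarrow> 'a" where
  "sgrad f p = (\<Sum>b\<in>Basis. rderiv f b p *\<^sub>R b)"

lemma borel_measurable_sgrad [measurable]:
  "convex_on UNIV f \<Longrightarrow> sgrad f \<in> borel_measurable borel"
  unfolding sgrad_def[abs_def] by (intro borel_measurable_sum borel_measurable_scaleR borel_measurable_rderiv) auto

text \<open>\<open>rderiv f b p\<close> and \<open>rderiv f (- b) p\<close> bound the
  \<open>b\<close> coordinate of a subgradient from above and from below. Where they are opposite
  the coordinate is determined, and finitely many directions suffice.\<close>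

lemma AE_subdifferential_singleton:
  fixes f :: "'a::euclidean_space \<Rightarrow> real"
  assumes f: "convex_on UNIV f"
  shows "AE p in lborel. subdifferential f p = {sgrad f p}"
proof -
  have "AE p in lborel. \<forall>b\<in>Basis. rderiv f (- b) p = - rderiv f b p"
    by (intro AE_finite_allI AE_rderiv_symmetric f) simp
  then show ?thesis
  proof eventually_elim
    case (elim p)
    have "v = sgrad f p" if v: "v \<in> subdifferential f p" for v
    proof (rule euclidean_eqI)
      fix b :: 'a assume b: "b \<in> Basis"
      have "v \<bullet> b = rderiv f b p"
        using subdifferential_le_rderiv[OF f v, of b] subdifferential_le_rderiv[OF f v, of "- b"] elim b
        by simp
      then show "v \<bullet> b = sgrad f p \<bullet> b"
        using b by (simp add: sgrad_def inner_sum_left inner_Basis if_distrib cong: if_cong)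
    qed
    then show ?case using subdifferential_nonempty[OF f, of p] by blast
  qed
qed

section \<open>Convex functions with common subgradients\<close>

text \<open>Common subgradients at the points of an equipartition of a segment into \<open>m\<close> parts bound the
  increments of both functions between sums that differ by \<open>O(1/m)\<close>. Translating the segment
  slightly moves the partition points for all \<open>m\<close> off the exceptional null set.\<close>

lemma common_subgradient_imp_const_diff:
  fixes f g :: "'a::euclidean_space \<Rightarrow> real"
  assumes f: "convex_on UNIV f" and g: "convex_on UNIV g"
    and R: "\<And>x v. v \<in> subdifferential f x \<Longrightarrow> norm v \<le> R"
    and B: "open B" "convex B"
    and ae: "AE p in lborel. p \<in> B \<longrightarrow> subdifferential f p \<inter> subdifferential g p \<noteq> {}"
    and pq: "p \<in> B" "q \<in> B"
  shows "f q - g q = f p - g p"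
proof -
  have R0: "0 \<le> R" using R subdifferential_nonempty[OF f, of p] norm_ge_zero order_trans by metis
  obtain \<delta> where \<delta>: "\<delta> > 0" "ball p \<delta> \<subseteq> B" "ball q \<delta> \<subseteq> B"
  proof -
    obtain d1 d2 where "d1 > 0" "ball p d1 \<subseteq> B" "d2 > 0" "ball q d2 \<subseteq> B"
      using B pq open_contains_ball by metis
    then show ?thesis by (intro that[of "min d1 d2"]) (auto simp: subset_iff)
  qed
  have tr: "AE h in lborel. z + h \<in> B \<longrightarrow> subdifferential f (z + h) \<inter> subdifferential g (z + h) \<noteq> {}" for z :: 'a
  proof -
    have "AE x in distr lborel borel ((+) z). x \<in> B \<longrightarrow> subdifferential f x \<inter> subdifferential g x \<noteq> {}"
      using ae by (simp only: lborel_distr_plus)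
    then show ?thesis by (rule AE_distrD[rotated]) simp
  qed
  define z where "z m i = p + (real i / real m) *\<^sub>R (q - p)" for m i :: nat
  \<comment> \<open>There are countably many pairs \<open>(m, i)\<close>, so one null set of shifts
    \<open>h\<close> serves all partitions.\<close>
  have all: "AE h in lborel. \<forall>m i. z m i + h \<in> B \<longrightarrow> subdifferential f (z m i + h) \<inter> subdifferential g (z m i + h) \<noteq> {}"
    by (simp add: AE_all_countable tr)
  have key: "f (q + h) - g (q + h) = f (p + h) - g (p + h)"
    if h: "norm h < \<delta>" and good: "\<forall>m i. z m i + h \<in> B \<longrightarrow> subdifferential f (z m i + h) \<inter> subdifferential g (z m i + h) \<noteq> {}" for h
  proof -
    have inB: "z m i + h \<in> B" if "i \<le> m" for m i
    proof -
      have "p + h \<in> B" "q + h \<in> B" using h \<delta> by (auto simp: subset_iff dist_norm)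
      moreover have "z m i + h = (1 - real i / real m) *\<^sub>R (p + h) + (real i / real m) *\<^sub>R (q + h)"
        by (simp add: z_def algebra_simps)
      moreover have "0 \<le> real i / real m" "real i / real m \<le> 1" using that by (auto simp: divide_le_eq_1)
      ultimately show ?thesis using B(2) by (simp add: convex_alt)
    qed
    have bd: "\<bar>(f (q + h) - g (q + h)) - (f (p + h) - g (p + h))\<bar> \<le> 2 * R * norm (q - p) / real (Suc k)" for k
    proof -
      define m where "m = Suc k"
      have "\<exists>X. \<forall>i\<le>m. X i \<in> subdifferential f (z m i + h) \<and> X i \<in> subdifferential g (z m i + h)"
        using good inB by (intro choice) blast
      then obtain X where Xf: "\<And>i. i \<le> m \<Longrightarrow> X i \<in> subdifferential f (z m i + h)"
        and Xg: "\<And>i. i \<le> m \<Longrightarrow> X i \<in> subdifferential g (z m i + h)" by blast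
      define d where "d = (q - p) /\<^sub>R real m"
      have z0: "z m 0 = p" and zm: "z m m = q" by (simp_all add: z_def m_def del: of_nat_Suc)
      have dz: "z m (Suc i) + h - (z m i + h) = d" for i
        by (simp add: z_def d_def divide_inverse mult.commute algebra_simps)
      have dz': "z m i + h - (z m (Suc i) + h) = - d" for i using dz[of i] by (metis minus_diff_eq)
      have est: "(\<Sum>i<m. X i \<bullet> d) \<le> F (q + h) - F (p + h) \<and> F (q + h) - F (p + h) \<le> (\<Sum>i<m. X (Suc i) \<bullet> d)"
        if F: "\<And>i. i \<le> m \<Longrightarrow> X i \<in> subdifferential F (z m i + h)" for F
      proof -
        have tel: "(\<Sum>i<m. F (z m (Suc i) + h) - F (z m i + h)) = F (q + h) - F (p + h)"
          by (subst sum_lessThan_telescope) (simp add: z0 zm)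
        have lo: "X i \<bullet> d \<le> F (z m (Suc i) + h) - F (z m i + h)" if "i < m" for i
          using subdifferentialD[OF F[of i], of "z m (Suc i) + h", unfolded dz] that by simp
        have up: "F (z m (Suc i) + h) - F (z m i + h) \<le> X (Suc i) \<bullet> d" if "i < m" for i
          using subdifferentialD[OF F[of "Suc i"], of "z m i + h", unfolded dz'] that by simp
        show ?thesis
          unfolding tel[symmetric] using lo up by (intro conjI sum_mono) auto
      qed
      \<comment> \<open>Both increments lie between the same lower and upper sums, whose difference
        telescopes to the two end terms.\<close>
      have "\<bar>(f (q + h) - g (q + h)) - (f (p + h) - g (p + h))\<bar> \<le> (\<Sum>i<m. X (Suc i) \<bullet> d) - (\<Sum>i<m. X i \<bullet> d)"
        using est[of f, OF Xf] est[of g, OF Xg] by linarith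
      also have "\<dots> = (X m - X 0) \<bullet> d"
        using sum_lessThan_telescope[of "\<lambda>i. X i \<bullet> d" m] by (simp add: sum_subtractf inner_diff_left)
      also have "\<dots> \<le> norm (X m - X 0) * norm d" by (rule norm_cauchy_schwarz)
      also have "\<dots> \<le> (R + R) * norm d"
        using R[OF Xf[of m]] R[OF Xf[of 0]] by (intro mult_right_mono order_trans[OF norm_triangle_ineq4]) auto
      also have "\<dots> = 2 * R * norm (q - p) / real (Suc k)" by (simp add: d_def m_def divide_inverse)
      finally show ?thesis .
    qed
    have "(\<lambda>k. 2 * R * norm (q - p) / real (Suc k)) \<longlonglongrightarrow> 0"
      by (intro LIMSEQ_Suc lim_const_over_n)
    then have "\<bar>(f (q + h) - g (q + h)) - (f (p + h) - g (p + h))\<bar> \<le> 0"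
      by (rule LIMSEQ_le_const) (use bd in auto)
    then show ?thesis by simp
  qed
  \<comment> \<open>Balls are not null, so good shifts exist arbitrarily close to 0; continuity then
    removes the shift.\<close>
  have "\<exists>h. norm h < \<delta> / real (Suc n) \<and> f (q + h) - g (q + h) = f (p + h) - g (p + h)" for n
  proof (rule ccontr)
    assume *: "\<not> ?thesis"
    have le: "\<delta> / real (Suc n) \<le> \<delta>" using \<delta>(1) by (simp add: field_simps)
    have "AE h in lborel. h \<notin> ball (0::'a) (\<delta> / real (Suc n))"
    proof (rule AE_mp[OF all], intro AE_I2 impI)
      fix h assume "\<forall>m i. z m i + h \<in> B \<longrightarrow> subdifferential f (z m i + h) \<inter> subdifferential g (z m i + h) \<noteq> {}"
      then show "h \<notin> ball 0 (\<delta> / real (Suc n))" using key[of h] * le by fastforce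
    qed
    then have "ball (0::'a) (\<delta> / real (Suc n)) \<in> null_sets lborel"
      by (subst AE_iff_null_sets) auto
    then have "negligible (ball (0::'a) (\<delta> / real (Suc n)))"
      by (simp add: negligible_iff_null_sets null_sets_completionI)
    moreover have "ball (0::'a) (\<delta> / real (Suc n)) \<noteq> {}"
      using \<delta>(1) by (simp only: ball_eq_empty not_le divide_pos_pos of_nat_0_less_iff zero_less_Suc not_False_eq_True)
    ultimately show False using open_not_negligible by blast
  qed
  then obtain h where h: "\<And>n. norm (h n) < \<delta> / real (Suc n)"
    "\<And>n. f (q + h n) - g (q + h n) = f (p + h n) - g (p + h n)" by metis
  have h0: "h \<longlonglongrightarrow> 0"
  proof (rule Lim_null_comparison)
    show "eventually (\<lambda>n. norm (h n) \<le> \<delta> / real (Suc n)) sequentially"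
      by (intro always_eventually allI less_imp_le h(1))
    show "(\<lambda>n. \<delta> / real (Suc n)) \<longlonglongrightarrow> 0" by (intro LIMSEQ_Suc lim_const_over_n)
  qed
  have cont: "isCont F x" if "convex_on UNIV F" for F :: "'a \<Rightarrow> real" and x
    using convex_on_UNIV_continuous[OF that, of UNIV] by (simp add: continuous_on_eq_continuous_at)
  have lim: "(\<lambda>n. f (x + h n) - g (x + h n)) \<longlonglongrightarrow> f x - g x" for x
    using tendsto_add[OF tendsto_const[of x] h0] cont[OF f, of x] cont[OF g, of x]
    by (intro tendsto_diff) (auto intro: isCont_tendsto_compose[where g = f] isCont_tendsto_compose[where g = g])
  show ?thesis using LIMSEQ_unique[OF lim[of q]] lim[of p] h(2) by simp
qed

section \<open>Legendre transforms over compact sets\<close>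

text \<open>Restricting the supremum to a compact \<open>A\<close> amounts to the value \<infinity>
  of \<open>f\<close> outside \<open>A\<close>, without leaving the reals.\<close>

definition legendre :: "'a::real_inner set \<Rightarrow> ('a \<Rightarrow> real) \<Rightarrow> 'a \<Rightarrow> real" where
  "legendre A f p = (SUP x\<in>A. x \<bullet> p - f x)"

locale compact_legendre =
  fixes A :: "'a::euclidean_space set" and f :: "'a \<Rightarrow> real"
  assumes A: "compact A" "A \<noteq> {}" and cont: "continuous_on A f"
begin

lemma attained: obtains x where "x \<in> A" "legendre A f p = x \<bullet> p - f x"
proof -
  have "continuous_on A (\<lambda>x. x \<bullet> p - f x)" by (intro continuous_intros cont)
  from continuous_attains_sup[OF A this] obtain x where
    x: "x \<in> A" "\<And>y. y \<in> A \<Longrightarrow> y \<bullet> p - f y \<le> x \<bullet> p - f x" by blast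
  then have "legendre A f p = x \<bullet> p - f x"
    unfolding legendre_def by (intro cSup_eq_maximum) auto
  with x that show ?thesis by blast
qed

lemma ge: assumes "x \<in> A" shows "x \<bullet> p - f x \<le> legendre A f p"
proof -
  have "compact ((\<lambda>x. x \<bullet> p - f x) ` A)"
    by (intro compact_continuous_image continuous_intros cont A)
  then have "bdd_above ((\<lambda>x. x \<bullet> p - f x) ` A)"
    by (simp add: bounded_imp_bdd_above compact_imp_bounded)
  then show ?thesis unfolding legendre_def using assms by (intro cSUP_upper)
qed

lemma maximizer_subgradient:
  assumes "x \<in> A" "legendre A f p \<le> x \<bullet> p - f x"
  shows "x \<in> subdifferential (legendre A f) p"
proof (rule subdifferentialI)
  show "legendre A f p + x \<bullet> (y - p) \<le> legendre A f y" for y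
    using ge[OF assms(1), of y] assms(2) by (simp add: inner_diff_right)
qed

lemma le_iff: "legendre A f p \<le> c \<longleftrightarrow> (\<forall>x\<in>A. x \<bullet> p - f x \<le> c)"
  using ge[of _ p] attained[of p] by (metis order_trans)

lemma convex: "convex_on UNIV (legendre A f)"
proof (rule convex_onI)
  fix t :: real and p q :: 'a assume t: "0 < t" "t < 1"
  have "x \<bullet> ((1 - t) *\<^sub>R p + t *\<^sub>R q) - f x \<le> (1 - t) * legendre A f p + t * legendre A f q"
    if "x \<in> A" for x
  proof -
    have "(1 - t) * (x \<bullet> p - f x) + t * (x \<bullet> q - f x) \<le> (1 - t) * legendre A f p + t * legendre A f q"
      using t that by (intro add_mono mult_left_mono ge) auto
    then show ?thesis by (simp add: algebra_simps)
  qed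
  then show "legendre A f ((1 - t) *\<^sub>R p + t *\<^sub>R q) \<le> (1 - t) * legendre A f p + t * legendre A f q"
    by (simp add: le_iff)
qed simp

text \<open>If \<open>v\<close> lay outside, a hyperplane with normal \<open>a\<close> would
  separate it from \<open>A\<close>. From \<open>p\<close> to \<open>p - a\<close> the transform
  drops by at least \<open>a \<bullet> x\<close>, with \<open>x\<close> a maximiser at
  \<open>p - a\<close>, and this is more than a subgradient \<open>v\<close> at \<open>p\<close>
  permits.\<close>

lemma subdifferential_subset:
  assumes cvx: "convex A" and v: "v \<in> subdifferential (legendre A f) p"
  shows "v \<in> A"
proof (rule ccontr)
  assume "v \<notin> A"
  from separating_hyperplane_closed_point[OF cvx compact_imp_closed[OF A(1)] this]
  obtain a b where ab: "a \<bullet> v < b" "\<And>x. x \<in> A \<Longrightarrow> a \<bullet> x > b" by blast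
  obtain x where x: "x \<in> A" "legendre A f (p - a) = x \<bullet> (p - a) - f x" using attained .
  have "legendre A f p - v \<bullet> a \<le> x \<bullet> p - x \<bullet> a - f x"
    using subdifferentialD[OF v, of "p - a"] x by (simp add: inner_diff_right)
  also have "x \<bullet> p - x \<bullet> a - f x \<le> legendre A f p - x \<bullet> a" using ge[OF x(1), of p] by simp
  finally have "x \<bullet> a \<le> v \<bullet> a" by simp
  then show False using ab x by (metis inner_commute less_le_trans not_less order_less_trans)
qed

lemma lipschitz:
  assumes R: "\<And>x. x \<in> A \<Longrightarrow> norm x \<le> R"
  shows "R-lipschitz_on UNIV (legendre A f)"
proof (rule lipschitz_onI)
  have *: "legendre A f p - legendre A f q \<le> R * dist p q" for p q
  proof -
    obtain x where x: "x \<in> A" "legendre A f p = x \<bullet> p - f x" using attained .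
    have "legendre A f p - legendre A f q \<le> x \<bullet> (p - q)"
      using ge[OF x(1), of q] x by (simp add: inner_diff_right)
    also have "\<dots> \<le> norm x * norm (p - q)" by (rule norm_cauchy_schwarz)
    also have "\<dots> \<le> R * dist p q" using R[OF x(1)] by (simp add: dist_norm mult_right_mono)
    finally show ?thesis .
  qed
  then show "dist (legendre A f x) (legendre A f y) \<le> R * dist x y" for x y
    using *[of x y] *[of y x] by (simp add: dist_real_def abs_le_iff dist_commute)
  show "0 \<le> R" using A(2) R norm_ge_zero order_trans by blast
qed

end


section \<open>Engulfing of sections\<close>

definition subdifferential_image :: "('a::real_inner \<Rightarrow> real) \<Rightarrow> 'a set \<Rightarrow> 'a set" where
  "subdifferential_image f E = (\<Union>x\<in>E. subdifferential f x)"

lemma subdifferential_imageI: "x \<in> E \<Longrightarrow> v \<in> subdifferential f x \<Longrightarrow> v \<in> subdifferential_image f E"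
  by (auto simp: subdifferential_image_def)

lemma subdifferential_imageE:
  assumes "v \<in> subdifferential_image f E"
  obtains x where "x \<in> E" "v \<in> subdifferential f x"
  using assms by (auto simp: subdifferential_image_def)

lemma compact_subdifferential_graph:
  fixes f :: "'a::euclidean_space \<Rightarrow> real"
  assumes f: "convex_on UNIV f" and L: "\<And>x v. v \<in> subdifferential f x \<Longrightarrow> norm v \<le> L"
    and K: "compact K"
  shows "compact {(x, v). x \<in> K \<and> v \<in> subdifferential f x}" (is "compact ?G")
  unfolding compact_eq_bounded_closed
proof
  have "?G \<subseteq> K \<times> cball 0 L" using L by auto
  then show "bounded ?G" by (rule bounded_subset[rotated]) (intro bounded_Times bounded_cball compact_imp_bounded K)
  show "closed ?G"
    unfolding closed_sequential_limits
  proof (intro allI impI)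
    fix z :: "nat \<Rightarrow> 'a \<times> 'a" and l
    assume *: "(\<forall>n. z n \<in> ?G) \<and> z \<longlonglongrightarrow> l"
    then have lim: "(\<lambda>n. fst (z n)) \<longlonglongrightarrow> fst l" "(\<lambda>n. snd (z n)) \<longlonglongrightarrow> snd l"
      by (auto intro: tendsto_fst tendsto_snd)
    have in_G: "fst (z n) \<in> K" "snd (z n) \<in> subdifferential f (fst (z n))" for n
      using * by (auto simp: split_beta)
    have "fst l \<in> K" by (rule closed_sequentially[OF compact_imp_closed[OF K] in_G(1) lim(1)])
    moreover have "snd l \<in> subdifferential f (fst l)"
      by (rule subdifferential_limit[OF f lim in_G(2)])
    ultimately show "l \<in> ?G" by (simp add: split_beta)
  qed
qed

lemma compact_subdifferential_image:
  fixes f :: "'a::euclidean_space \<Rightarrow> real"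
  assumes "convex_on UNIV f" "\<And>x v. v \<in> subdifferential f x \<Longrightarrow> norm v \<le> L" "compact K"
  shows "compact (subdifferential_image f K)"
proof -
  have "subdifferential_image f K = snd ` {(x, v). x \<in> K \<and> v \<in> subdifferential f x}"
    by (force simp: subdifferential_image_def)
  then show ?thesis
    by (simp only:) (intro compact_continuous_image compact_subdifferential_graph[OF assms] continuous_intros)
qed

text \<open>An open set is a countable union of compact sets, and the subgradient image of each of
  them is compact.\<close>

lemma borel_subdifferential_image_open:
  fixes f :: "'a::euclidean_space \<Rightarrow> real"
  assumes "convex_on UNIV f" "\<And>x v. v \<in> subdifferential f x \<Longrightarrow> norm v \<le> L" "open U"
  shows "subdifferential_image f U \<in> sets borel"
proof -
  obtain D :: "nat \<Rightarrow> 'a set" where D: "\<And>n. compact (D n)" "\<Union>(range D) = U"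
    using open_Union_compact_subsets[OF assms(3)] by metis
  have "subdifferential_image f U = (\<Union>n. subdifferential_image f (D n))"
    using D(2) by (auto simp: subdifferential_image_def)
  moreover have "subdifferential_image f (D n) \<in> sets borel" for n
    using compact_subdifferential_image[OF assms(1,2) D(1)[of n]] by (simp add: borel_compact)
  ultimately show ?thesis by auto
qed

lemma lmeasurable_subdifferential_image_open:
  fixes f :: "'a::euclidean_space \<Rightarrow> real"
  assumes "convex_on UNIV f" "\<And>x v. v \<in> subdifferential f x \<Longrightarrow> norm v \<le> L" "open U"
  shows "subdifferential_image f U \<in> lmeasurable"
proof (rule fmeasurableI2)
  show "cball 0 L \<in> lmeasurable" by simp
  show "subdifferential_image f U \<subseteq> cball 0 L" using assms(2) by (auto simp: subdifferential_image_def)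
  show "subdifferential_image f U \<in> sets lebesgue"
    using borel_subdifferential_image_open[OF assms] by (simp add: sets_completionI_sets)
qed

section \<open>Polar bodies of sections and their volumes\<close>

definition polar_at :: "'a::real_inner set \<Rightarrow> 'a \<Rightarrow> 'a set" where
  "polar_at S c = {q. \<forall>z\<in>S. q \<bullet> (z - c) \<le> 1}"

lemma compact_polar_at:
  fixes S :: "'a::euclidean_space set"
  assumes "open S" "c \<in> S"
  shows "compact (polar_at S c)"
proof -
  obtain d where d: "d > 0" "ball c d \<subseteq> S" using assms open_contains_ball by blast
  have "polar_at S c = (\<Inter>z\<in>S. {q. (z - c) \<bullet> q \<le> 1})" by (auto simp: polar_at_def inner_commute)
  then have "closed (polar_at S c)" by (auto intro: closed_halfspace_le)
  moreover have "norm q \<le> 2 / d" if q: "q \<in> polar_at S c" for q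
  proof (cases "q = 0")
    case False
    have "c + (d / (2 * norm q)) *\<^sub>R q \<in> S" using d False by (auto simp: subset_iff dist_norm)
    then have "q \<bullet> ((d / (2 * norm q)) *\<^sub>R q) \<le> 1" using q by (force simp: polar_at_def)
    then show ?thesis using d False by (simp add: dot_square_norm power2_eq_square field_simps)
  qed (use d in auto)
  then have "bounded (polar_at S c)" by (auto intro: boundedI)
  ultimately show ?thesis by (simp add: compact_eq_bounded_closed)
qed

lemma measure_polar_at_pos:
  fixes S :: "'a::euclidean_space set"
  assumes S: "open S" "bounded S" "c \<in> S"
  shows "measure lebesgue (polar_at S c) > 0"
proof -
  obtain B where B: "B > 0" "\<And>z. z \<in> S \<Longrightarrow> norm z \<le> B" using S(2) bounded_pos by blast
  have "ball (0::'a) (1 / (2 * B)) \<subseteq> polar_at S c"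
  proof (clarsimp simp: polar_at_def)
    fix q z :: 'a assume q: "norm q < 1 / (2 * B)" "z \<in> S"
    have "norm (z - c) \<le> 2 * B" using B(2)[OF q(2)] B(2)[OF S(3)] norm_triangle_ineq4[of z c] by linarith
    then have "q \<bullet> (z - c) \<le> (1 / (2 * B)) * (2 * B)"
      using q B(1) by (intro order_trans[OF norm_cauchy_schwarz] mult_mono) auto
    then show "q \<bullet> (z - c) \<le> 1" using B(1) by simp
  qed
  then have "measure lebesgue (ball (0::'a) (1 / (2 * B))) \<le> measure lebesgue (polar_at S c)"
    by (intro measure_mono_fmeasurable lmeasurable_compact compact_polar_at S) auto
  moreover have "measure lebesgue (ball (0::'a) (1 / (2 * B))) > 0"
    using B(1) content_ball_pos[of "1 / (2 * B)" "0::'a"] by simp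
  ultimately show ?thesis by linarith
qed

text \<open>The homothetic copy of ratio 1/2 about \<open>c\<close>. When \<open>S\<close> is
  convex, its points can still be moved by half of any vector from \<open>c\<close> to a point of
  \<open>S\<close>; this room bounds the slopes there.\<close>

definition contract_half :: "'a::real_vector \<Rightarrow> 'a set \<Rightarrow> 'a set" where
  "contract_half c S = (\<lambda>z. (1 / 2) *\<^sub>R z + (1 / 2) *\<^sub>R c) ` S"

lemma open_contract_half: "open S \<Longrightarrow> open (contract_half (c::'a::real_normed_vector) S)"
proof -
  assume "open S"
  have "contract_half c S = (+) ((1 / 2) *\<^sub>R c) ` ((\<lambda>z. (1 / 2) *\<^sub>R z) ` S)"
    by (simp add: contract_half_def image_image add.commute)
  then show ?thesis using open_translation open_scaling[OF _ \<open>open S\<close>, of "1 / 2"] by simp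
qed

lemma convex_section:
  fixes u :: "'a::real_inner \<Rightarrow> real"
  assumes "convex_on UNIV u"
  shows "convex {z. u z < \<alpha> + v \<bullet> z}"
proof (rule convexI)
  fix z w and s t :: real
  assume *: "z \<in> {z. u z < \<alpha> + v \<bullet> z}" "w \<in> {z. u z < \<alpha> + v \<bullet> z}" "0 \<le> s" "0 \<le> t" "s + t = 1"
  have "u (s *\<^sub>R z + t *\<^sub>R w) \<le> s * u z + t * u w" using assms * by (simp add: convex_on_def)
  also have "\<dots> < s * (\<alpha> + v \<bullet> z) + t * (\<alpha> + v \<bullet> w)"
  proof (cases "s = 0")
    case False
    then show ?thesis using * by (intro add_less_le_mono) (auto intro!: mult_left_mono)
  qed (use * in auto)
  also have "\<dots> = (s + t) * \<alpha> + v \<bullet> (s *\<^sub>R z + t *\<^sub>R w)"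
    by (simp add: algebra_simps)
  finally show "s *\<^sub>R z + t *\<^sub>R w \<in> {z. u z < \<alpha> + v \<bullet> z}" using * by simp
qed

lemma open_section:
  fixes u :: "'a::euclidean_space \<Rightarrow> real"
  assumes "convex_on UNIV u"
  shows "open {z. u z < \<alpha> + v \<bullet> z}"
  using convex_on_UNIV_continuous[OF assms] by (intro open_Collect_less continuous_intros) auto

text \<open>From the midpoint of \<open>w\<close> and \<open>c\<close> a move by
  \<open>(z - c) / 2\<close> ends in \<open>S\<close> again, for every \<open>z\<close> in
  \<open>S\<close>. Along it a subgradient \<open>q\<close> can gain on the slope \<open>v\<close>
  of the section by no more than the depth \<open>H\<close>, which places
  \<open>(q - v) / (2 * H)\<close> in the polar at \<open>c\<close>.\<close>

lemma subdifferential_image_contract_half: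
  fixes u :: "'a::euclidean_space \<Rightarrow> real"
  assumes u: "convex_on UNIV u" and S: "S = {z. u z < \<alpha> + v \<bullet> z}"
    and H: "\<And>z. z \<in> S \<Longrightarrow> \<alpha> + v \<bullet> z - u z \<le> H" "H > 0" and c: "c \<in> S"
  shows "subdifferential_image u (contract_half c S) \<subseteq> (\<lambda>q. (2 * H) *\<^sub>R q + v) ` polar_at S c"
proof
  fix q assume "q \<in> subdifferential_image u (contract_half c S)"
  then obtain w where w: "w \<in> S" and q: "q \<in> subdifferential u ((1 / 2) *\<^sub>R w + (1 / 2) *\<^sub>R c)"
    by (auto simp: contract_half_def elim: subdifferential_imageE)
  let ?y = "(1 / 2) *\<^sub>R w + (1 / 2) *\<^sub>R c"
  have cS: "convex S" unfolding S by (rule convex_section[OF u])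
  have mid: "(1 / 2) *\<^sub>R a + (1 / 2) *\<^sub>R b \<in> S" if "a \<in> S" "b \<in> S" for a b
    using convexD[OF cS that, of "1 / 2" "1 / 2"] by simp
  have y: "?y \<in> S" using w c by (rule mid)
  have "(q - v) \<bullet> (z - c) \<le> 2 * H" if "z \<in> S" for z
  proof -
    let ?z = "(1 / 2) *\<^sub>R w + (1 / 2) *\<^sub>R z"
    have zS: "?z \<in> S" using w that by (rule mid)
    have d: "?z - ?y = (1 / 2) *\<^sub>R (z - c)" by (simp add: algebra_simps)
    have "u ?y + q \<bullet> (?z - ?y) \<le> u ?z" by (rule subdifferentialD[OF q])
    also have "u ?z < \<alpha> + v \<bullet> ?z" using zS S by simp
    also have "\<dots> = (\<alpha> + v \<bullet> ?y) + v \<bullet> (?z - ?y)" by (simp add: inner_diff_right inner_add_right)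
    finally have "(q - v) \<bullet> (?z - ?y) < \<alpha> + v \<bullet> ?y - u ?y" by (simp add: inner_diff_left)
    then show ?thesis using H(1)[OF y] unfolding d by simp
  qed
  then have "(1 / (2 * H)) *\<^sub>R (q - v) \<in> polar_at S c"
    using H(2) by (auto simp: polar_at_def divide_le_eq)
  moreover have "q = (2 * H) *\<^sub>R ((1 / (2 * H)) *\<^sub>R (q - v)) + v" using H(2) by simp
  ultimately show "q \<in> (\<lambda>q. (2 * H) *\<^sub>R q + v) ` polar_at S c" by blast
qed

text \<open>Tilting by \<open>h\<close> times an element of the polar keeps the minimum of \<open>u\<close> over the section in
  its interior: this is the content of Alexandrov's maximum principle.\<close>

lemma polar_at_subset_subdifferential_image:
  fixes u :: "'a::euclidean_space \<Rightarrow> real"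
  assumes u: "convex_on UNIV u" and S: "S = {z. u z < \<alpha> + v \<bullet> z}" "bounded S"
    and y: "y \<in> S" and h: "h = \<alpha> + v \<bullet> y - u y"
  shows "(\<lambda>q. h *\<^sub>R q + v) ` polar_at S y \<subseteq> subdifferential_image u S"
proof (rule image_subsetI)
  fix q assume q: "q \<in> polar_at S y"
  have hpos: "h > 0" using y S h by simp
  define g where "g z = u z - (h *\<^sub>R q + v) \<bullet> z" for z
  have contu: "continuous_on A u" for A using convex_on_UNIV_continuous[OF u] .
  have contg: "continuous_on A g" for A unfolding g_def by (intro continuous_intros contu)
  have g: "convex_on UNIV g"
    unfolding g_def using u by (auto simp: convex_on_def algebra_simps)
  have "compact (closure S)" "closure S \<noteq> {}" using S y by (auto simp: compact_closure)
  from continuous_attains_inf[OF this contg] obtain z0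
    where z0: "z0 \<in> closure S" "\<And>z. z \<in> closure S \<Longrightarrow> g z0 \<le> g z" by blast
  have "closed {z. u z \<le> \<alpha> + v \<bullet> z}" by (intro closed_Collect_le continuous_intros contu)
  then have cl: "closure S \<subseteq> {z. u z \<le> \<alpha> + v \<bullet> z}" unfolding S by (intro closure_minimal) auto
  have "closed {z. q \<bullet> (z - y) \<le> 1}" by (intro closed_Collect_le continuous_intros)
  then have cl': "closure S \<subseteq> {z. q \<bullet> (z - y) \<le> 1}"
    using q by (intro closure_minimal) (auto simp: polar_at_def)
  obtain z1 where z1: "z1 \<in> S" "\<And>z. z \<in> S \<Longrightarrow> g z1 \<le> g z"
  proof (cases "z0 \<in> S")
    case True
    then show ?thesis using z0(2) closure_subset by (intro that[of z0]) auto
  next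
    case False
    \<comment> \<open>On the boundary \<open>u\<close> equals the affine function; with
      \<open>q \<bullet> (z0 - y) \<le> 1\<close> this gives \<open>g y \<le> g z0\<close>, so the
      minimum is also attained at \<open>y\<close>, inside \<open>S\<close>.\<close>
    then have "u z0 = \<alpha> + v \<bullet> z0" using cl z0(1) S by force
    moreover have "h * (q \<bullet> (z0 - y)) \<le> h * 1" using cl' z0(1) hpos by (intro mult_left_mono) auto
    ultimately have "g y \<le> g z0" unfolding g_def h by (simp add: inner_diff_right inner_add_left algebra_simps)
    then show ?thesis using z0(2) closure_subset y by (intro that[of y]) (auto intro: order_trans)
  qed
  have "open S" unfolding S by (rule open_section[OF u])
  then obtain e where e: "e > 0" "ball z1 e \<subseteq> S" using z1(1) open_contains_ball by blast
  then have "\<forall>z\<in>UNIV. g z1 \<le> g z"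
    using z1(2) by (intro convex_local_global_minimum[OF e(1) g]) auto
  then have "h *\<^sub>R q + v \<in> subdifferential u z1"
    by (intro subdifferentialI) (simp add: g_def inner_diff_right algebra_simps)
  then show "h *\<^sub>R q + v \<in> subdifferential_image u S" using z1(1) by (rule subdifferential_imageI[rotated])
qed

text \<open>The polar at \<open>y\<close> contains about \<open>g / (1 - g)\<close> disjoint translates of a fixed multiple of the
  polar at \<open>c\<close>, where \<open>g\<close> close to \<open>1\<close> means that \<open>y\<close> is close to the boundary of \<open>S\<close> as seen from \<open>c\<close>.\<close>

lemma measure_polar_at_ge:
  fixes S :: "'a::euclidean_space set"
  assumes S: "open S" "c \<in> S" "y \<in> S"
    and x: "x \<in> S" "\<kappa> *\<^sub>R (c - x) = y - c" "\<kappa> \<ge> 0"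
    and q0: "q0 \<in> polar_at S c"
  shows "q0 \<bullet> (y - c) < 1"
    and "q0 \<bullet> (y - c) / (1 - q0 \<bullet> (y - c)) * (1 / (2 * (1 + \<kappa>))) ^ DIM('a) * measure lebesgue (polar_at S c)
      \<le> measure lebesgue (polar_at S y)"
proof -
  define e where "e = y - c"
  define g where "g = q0 \<bullet> e"
  \<comment> \<open>For \<open>q\<close> in the polar at \<open>c\<close> the pairing
    \<open>q \<bullet> e\<close> lies in \<open>[- \<kappa>, 1)\<close>; scaling by \<open>r\<close>
    shrinks this interval to length 1/2.\<close>
  define r where "r = 1 / (2 * (1 + \<kappa>))"
  have r: "r > 0" using x(3) by (simp add: r_def)
  have lt1: "q \<bullet> e < 1" if q: "q \<in> polar_at S c" for q
  proof -
    obtain d where d: "d > 0" "ball y d \<subseteq> S" using S open_contains_ball by blast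
    define t where "t = d / (2 * (norm e + 1))"
    have n: "norm e + 1 > 0" using norm_ge_zero[of e] by linarith
    have t: "t > 0" using d n by (simp add: t_def)
    have "t * norm e < d" using d n by (simp add: t_def divide_less_eq)
    then have "y + t *\<^sub>R e \<in> S" using d t by (auto simp: subset_iff dist_norm)
    then have "q \<bullet> (y + t *\<^sub>R e - c) \<le> 1" using q by (auto simp: polar_at_def)
    moreover have "y + t *\<^sub>R e - c = (1 + t) *\<^sub>R e" by (simp add: e_def algebra_simps)
    ultimately have "(1 + t) * (q \<bullet> e) \<le> 1" by (simp only: inner_scaleR_right)
    show ?thesis
    proof (rule ccontr)
      assume "\<not> q \<bullet> e < 1"
      then have "(1 + t) * 1 \<le> (1 + t) * (q \<bullet> e)" using t by (intro mult_left_mono) auto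
      with \<open>(1 + t) * (q \<bullet> e) \<le> 1\<close> have "(1 + t) * 1 \<le> 1" by (rule order_trans[rotated])
      then show False using t by simp
    qed
  qed
  have ge: "- \<kappa> \<le> q \<bullet> e" if q: "q \<in> polar_at S c" for q
  proof -
    have "q \<bullet> (x - c) \<le> 1" using q x(1) by (auto simp: polar_at_def)
    then have "\<kappa> * (q \<bullet> (x - c)) \<le> \<kappa> * 1" by (rule mult_left_mono) (rule x)
    moreover have "q \<bullet> e = - (\<kappa> * (q \<bullet> (x - c)))" unfolding e_def x(2)[symmetric] by (simp add: inner_diff_right algebra_simps)
    ultimately show ?thesis by simp
  qed
  have g1: "g < 1" using lt1[OF q0] by (simp add: g_def)
  then show "q0 \<bullet> (y - c) < 1" by (simp add: g_def e_def)
  have "g / (1 - g) * r ^ DIM('a) * measure lebesgue (polar_at S c) \<le> measure lebesgue (polar_at S y)"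
  proof (cases "g \<le> 0")
    case True
    then have "g / (1 - g) * r ^ DIM('a) * measure lebesgue (polar_at S c) \<le> 0"
      using g1 r by (intro mult_nonpos_nonneg divide_nonpos_pos) auto
    then show ?thesis using measure_nonneg order_trans by blast
  next
    case False
    define M where "M = 1 / (1 - g)"
    have M: "M > 0" using g1 by (simp add: M_def)
    have Mg: "M * g > 0" using M False by simp
    \<comment> \<open>The shift by \<open>\<tau> j *\<^sub>R q0\<close> moves the pairing with
      \<open>e\<close> by \<open>j / 2\<close>, so the copies \<open>A j\<close> fill disjoint
      slabs. The restriction \<open>j \<le> M * g\<close> gives \<open>\<tau> j \<le> M / 2\<close>:
      the shift then uses at most half of the polar inequality at \<open>y\<close>, the scaled copy
      the other half.\<close>
    define \<tau> where "\<tau> j = real j / (2 * (M * g)) * M" for j :: nat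
    define J where "J = {j :: nat. real j \<le> M * g}"
    have Jeq: "J = {..nat \<lfloor>M * g\<rfloor>}" using Mg by (auto simp: J_def le_nat_iff le_floor_iff)
    define A where "A j = (\<lambda>q. r *\<^sub>R q + \<tau> j *\<^sub>R q0) ` polar_at S c" for j
    have sub: "A j \<subseteq> polar_at S y" if "j \<in> J" for j
    proof
      fix p assume "p \<in> A j"
      then obtain q where q: "q \<in> polar_at S c" and p: "p = r *\<^sub>R q + \<tau> j *\<^sub>R q0" by (auto simp: A_def)
      have "p \<bullet> (z - y) \<le> 1" if z: "z \<in> S" for z
      proof -
        have zy: "z - y = (z - c) - e" by (simp add: e_def)
        have "q \<bullet> (z - y) \<le> 1 + \<kappa>" using q z ge[OF q] by (force simp: zy inner_diff_right polar_at_def)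
        then have "r * (q \<bullet> (z - y)) \<le> r * (1 + \<kappa>)" using r by simp
        also have "\<dots> = 1 / 2" using x(3) by (simp add: r_def)
        finally have 1: "r * (q \<bullet> (z - y)) \<le> 1 / 2" .
        have "q0 \<bullet> (z - y) \<le> 1 - g" using q0 z by (force simp: zy inner_diff_right polar_at_def g_def)
        then have "M * (q0 \<bullet> (z - y)) \<le> M * (1 - g)" using M by simp
        also have "\<dots> = 1" using g1 by (simp add: M_def)
        finally have 2: "M * (q0 \<bullet> (z - y)) \<le> 1" .
        have t0: "0 \<le> real j / (2 * (M * g))" using Mg by simp
        have t1: "real j / (2 * (M * g)) \<le> 1 / 2" using Mg that J_def \<open>j \<in> J\<close> by (simp add: divide_le_eq)
        have "\<tau> j * (q0 \<bullet> (z - y)) = real j / (2 * (M * g)) * (M * (q0 \<bullet> (z - y)))" by (simp add: \<tau>_def)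
        also have "\<dots> \<le> real j / (2 * (M * g)) * 1" by (rule mult_left_mono[OF 2 t0])
        also have "\<dots> \<le> 1 / 2" using t1 by simp
        finally show ?thesis using 1 by (simp add: p inner_add_left)
      qed
      then show "p \<in> polar_at S y" by (auto simp: polar_at_def)
    qed
    have meas: "A j \<in> lmeasurable" for j
      unfolding A_def
      by (intro lmeasurable_compact compact_continuous_image continuous_intros compact_polar_at S)
    have mA: "measure lebesgue (A j) = r ^ DIM('a) * measure lebesgue (polar_at S c)" for j
      unfolding A_def using measure_lebesgue_affine[of r "\<tau> j *\<^sub>R q0" "polar_at S c"] r by simp
    have disj: "A i \<inter> A j = {}" if "i < j" for i j
    proof (rule ccontr)
      assume "A i \<inter> A j \<noteq> {}"
      then obtain q q' where q: "q \<in> polar_at S c" "q' \<in> polar_at S c"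
        and eq: "r *\<^sub>R q + \<tau> i *\<^sub>R q0 = r *\<^sub>R q' + \<tau> j *\<^sub>R q0" by (auto simp: A_def)
      have "\<tau> k * g = real k / 2" for k using Mg M False by (simp add: \<tau>_def)
      moreover have "r * (q \<bullet> e) + \<tau> i * g = r * (q' \<bullet> e) + \<tau> j * g"
        using arg_cong[OF eq, of "\<lambda>z. z \<bullet> e"] by (simp add: inner_add_left g_def[symmetric])
      ultimately have "r * (q \<bullet> e) + real i / 2 = r * (q' \<bullet> e) + real j / 2" by metis
      moreover have "r * (q \<bullet> e) < r * 1" using lt1[OF q(1)] r by (rule mult_strict_left_mono)
      moreover have "r * - \<kappa> \<le> r * (q' \<bullet> e)" using ge[OF q(2)] less_imp_le[OF r] by (rule mult_left_mono)
      moreover have "r * 1 - r * - \<kappa> = 1 / 2" using x(3) by (simp add: r_def field_simps)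
      moreover have "real i + 1 \<le> real j" using that by simp
      ultimately show False by linarith
    qed
    have "pairwise (\<lambda>i j. negligible (A i \<inter> A j)) J"
      by (rule pairwiseI) (metis disj Int_commute nat_neq_iff negligible_empty)
    then have "measure lebesgue (\<Union>(A ` J)) = (\<Sum>j\<in>J. measure lebesgue (A j))"
      by (intro measure_negligible_finite_Union_image meas) (simp add: Jeq)
    also have "\<dots> = real (card J) * (r ^ DIM('a) * measure lebesgue (polar_at S c))" by (simp add: mA)
    finally have "real (card J) * (r ^ DIM('a) * measure lebesgue (polar_at S c)) = measure lebesgue (\<Union>(A ` J))" ..
    also have "\<dots> \<le> measure lebesgue (polar_at S y)"
      using sub meas by (intro measure_mono_fmeasurable lmeasurable_compact compact_polar_at S)
        (auto simp: Jeq intro!: sets.finite_UN)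
    finally have *: "real (card J) * (r ^ DIM('a) * measure lebesgue (polar_at S c)) \<le> measure lebesgue (polar_at S y)" .
    \<comment> \<open>\<open>J\<close> starts at 0, so it has one element more than the integer part
      of \<open>M * g\<close>.\<close>
    have "M * g \<le> real (card J)" using Mg by (simp add: Jeq) linarith
    then have "(M * g) * (r ^ DIM('a) * measure lebesgue (polar_at S c)) \<le> real (card J) * (r ^ DIM('a) * measure lebesgue (polar_at S c))"
      using r by (intro mult_right_mono) auto
    with * show ?thesis by (simp add: M_def mult.assoc)
  qed
  then show "q0 \<bullet> (y - c) / (1 - q0 \<bullet> (y - c)) * (1 / (2 * (1 + \<kappa>))) ^ DIM('a) * measure lebesgue (polar_at S c)
      \<le> measure lebesgue (polar_at S y)"
    by (simp add: g_def e_def r_def)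
qed

text \<open>A slope \<open>w\<close> at \<open>y\<close> much steeper than \<open>v\<close> puts
  \<open>(w - v) / (H + (w - v) \<bullet> (y - c))\<close> into the polar at \<open>c\<close> with a
  pairing against \<open>y - c\<close> close to 1, which makes the polar at \<open>y\<close> large
  compared with the polar at \<open>c\<close>. The image bounds and the doubling hypothesis limit
  that ratio. The 16 is the product of 4 (depth \<open>H / 4\<close> at \<open>y\<close>), 2 (half
  contraction) and 2 (translates inside the polar at \<open>y\<close>).\<close>

lemma engulfing:
  fixes u :: "'a::euclidean_space \<Rightarrow> real"
  assumes u: "convex_on UNIV u" and L: "\<And>x v. v \<in> subdifferential u x \<Longrightarrow> norm v \<le> L"
    and S: "S = {z. u z < \<alpha> + v \<bullet> z}" "bounded S"
    and H: "\<And>z. z \<in> S \<Longrightarrow> \<alpha> + v \<bullet> z - u z \<le> H" "H > 0"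
    and C: "measure lebesgue (subdifferential_image u S) \<le> C * measure lebesgue (subdifferential_image u (contract_half c S))" "C \<ge> 0"
    and cy: "c \<in> S" "y \<in> S" "\<alpha> + v \<bullet> y - u y \<ge> H / 4"
    and x: "x \<in> S" "\<kappa> *\<^sub>R (c - x) = y - c" "\<kappa> \<ge> 0"
    and w: "w \<in> subdifferential u y"
  shows "(w - v) \<bullet> (y - c) \<le> C * (16 * (1 + \<kappa>)) ^ DIM('a) * H"
proof -
  define e where "e = y - c"
  define h where "h = \<alpha> + v \<bullet> y - u y"
  define m where "m z = measure lebesgue (polar_at S z)" for z
  define B where "B = C * (16 * (1 + \<kappa>)) ^ DIM('a)"
  have B0: "B \<ge> 0" using C x by (simp add: B_def)
  have oS: "open S" unfolding S by (rule open_section[OF u])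
  note meas = lmeasurable_subdifferential_image_open[OF u L]
  show ?thesis
  proof (cases "(w - v) \<bullet> e \<le> 0")
    case True
    have "0 \<le> B * H" using B0 H by simp
    then show ?thesis using True unfolding e_def B_def by linarith
  next
    case False
    let ?t = "H + (w - v) \<bullet> e"
    define q0 where "q0 = (1 / ?t) *\<^sub>R (w - v)"
    define g where "g = q0 \<bullet> e"
    have t: "?t > 0" using False H by simp
    have "(w - v) \<bullet> (z - c) \<le> ?t" if z: "z \<in> S" for z
    proof -
      have "u y + w \<bullet> (z - y) \<le> u z" by (rule subdifferentialD[OF w])
      also have "u z < \<alpha> + v \<bullet> z" using z S by simp
      finally have "(w - v) \<bullet> (z - y) < h" by (simp add: h_def inner_diff_left inner_diff_right)
      also have "h \<le> H" using H(1)[OF cy(2)] by (simp add: h_def)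
      finally have "(w - v) \<bullet> (z - y) + (w - v) \<bullet> e \<le> ?t" by simp
      then show ?thesis by (simp add: e_def inner_diff_right)
    qed
    then have q0: "q0 \<in> polar_at S c"
      using t by (auto simp: polar_at_def q0_def divide_le_eq)
    note ge = measure_polar_at_ge[OF oS cy(1,2) x q0]
    have mc: "m c > 0" unfolding m_def by (rule measure_polar_at_pos[OF oS S(2) cy(1)])
    \<comment> \<open>The polar at \<open>y\<close> bounds the image from below, doubling passes to
      the half contraction, and the polar at \<open>c\<close> bounds that image from above.\<close>
    have pow: "h ^ DIM('a) * m y \<le> C * ((2 * H) ^ DIM('a) * m c)"
    proof -
      have "h ^ DIM('a) * m y = measure lebesgue ((\<lambda>q. h *\<^sub>R q + v) ` polar_at S y)"
        using measure_lebesgue_affine[of h v "polar_at S y"] cy H by (simp add: h_def m_def)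
      also have "\<dots> \<le> measure lebesgue (subdifferential_image u S)"
        by (intro measure_mono_fmeasurable polar_at_subset_subdifferential_image[OF u S cy(2) h_def] meas oS
            fmeasurableD lmeasurable_compact compact_continuous_image continuous_intros compact_polar_at cy)
      also have "\<dots> \<le> C * measure lebesgue (subdifferential_image u (contract_half c S))" by (rule C)
      also have "\<dots> \<le> C * measure lebesgue ((\<lambda>q. (2 * H) *\<^sub>R q + v) ` polar_at S c)"
        by (intro mult_left_mono measure_mono_fmeasurable subdifferential_image_contract_half[OF u S(1) H cy(1)] C
            fmeasurableD[OF meas] open_contract_half oS
            lmeasurable_compact compact_continuous_image continuous_intros compact_polar_at cy)
      also have "\<dots> = C * ((2 * H) ^ DIM('a) * m c)"
        using measure_lebesgue_affine[of "2 * H" v "polar_at S c"] H by (simp add: m_def)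
      finally show ?thesis .
    qed
    have "g / (1 - g) * (1 / (2 * (1 + \<kappa>))) ^ DIM('a) * m c \<le> m y"
      using ge(2) by (simp add: g_def e_def m_def)
    then have "(H / 4) ^ DIM('a) * (g / (1 - g) * (1 / (2 * (1 + \<kappa>))) ^ DIM('a) * m c) \<le> (H / 4) ^ DIM('a) * m y"
      using H by (intro mult_left_mono) auto
    also have "\<dots> \<le> h ^ DIM('a) * m y"
      using cy(3) H by (intro mult_right_mono power_mono) (auto simp: h_def m_def)
    also have "\<dots> \<le> C * ((2 * H) ^ DIM('a) * m c)" by (rule pow)
    finally have "((H / 4) ^ DIM('a) * (g / (1 - g) * (1 / (2 * (1 + \<kappa>))) ^ DIM('a))) * m c \<le> (C * (2 * H) ^ DIM('a)) * m c"
      by (simp only: mult.assoc)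
    then have le1: "(H / 4) ^ DIM('a) * (g / (1 - g) * (1 / (2 * (1 + \<kappa>))) ^ DIM('a)) \<le> C * (2 * H) ^ DIM('a)"
      using mc by (rule mult_right_le_imp_le)
    have e1: "(H / 4) ^ DIM('a) * (g / (1 - g) * (1 / (2 * (1 + \<kappa>))) ^ DIM('a))
       = (g / (1 - g)) * (H / (8 * (1 + \<kappa>))) ^ DIM('a)"
    proof -
      have "(H / 4) * (1 / (2 * (1 + \<kappa>))) = H / (8 * (1 + \<kappa>))" by simp
      then show ?thesis by (metis mult.left_commute power_mult_distrib)
    qed
    have e2: "C * (2 * H) ^ DIM('a) = B * (H / (8 * (1 + \<kappa>))) ^ DIM('a)"
    proof -
      have "(16 * (1 + \<kappa>)) * (H / (8 * (1 + \<kappa>))) = 2 * H" using x(3) by (simp add: field_simps)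
      then show ?thesis unfolding B_def by (metis mult.assoc power_mult_distrib)
    qed
    have "(H / (8 * (1 + \<kappa>))) ^ DIM('a) > 0" using H x(3) by simp
    with le1[unfolded e1 e2] have gB: "g / (1 - g) \<le> B" by (rule mult_right_le_imp_le)
    \<comment> \<open>Solving \<open>g * (H + s) = s\<close> for \<open>s\<close> turns the bound on
      \<open>g / (1 - g)\<close> into one on the slope difference.\<close>
    have "g * ?t = (w - v) \<bullet> e" using t by (simp add: g_def q0_def)
    moreover have "g < 1" using ge(1) by (simp add: g_def e_def)
    ultimately have "(w - v) \<bullet> e = (g / (1 - g)) * H" by (simp add: field_simps)
    also have "\<dots> \<le> B * H" using gB H by (intro mult_right_mono) auto
    finally show ?thesis by (simp add: B_def e_def)
  qed
qed


section \<open>Strict convexity and Hoelder continuity of the gradient\<close>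

definition bregman :: "('a::real_inner \<Rightarrow> real) \<Rightarrow> 'a \<Rightarrow> 'a \<Rightarrow> 'a \<Rightarrow> real" where
  "bregman u v x y = u y - u x - v \<bullet> (y - x)"

lemma bregman_nonneg: "v \<in> subdifferential u x \<Longrightarrow> 0 \<le> bregman u v x y"
  using subdifferentialD[of v u x y] by (simp add: bregman_def)

lemma bregman_add:
  "bregman u v x y + bregman u w y x = (w - v) \<bullet> (y - x)"
  by (simp add: bregman_def inner_diff_left inner_diff_right)

text \<open>The Monge-Ampere measure of \<open>u\<close> is compared with Lebesgue measure
  restricted to \<open>X\<close>, on open sets, whose images are known to be measurable.
  \<open>coercive\<close> says that \<open>u\<close> minus a linear function grows at least
  linearly; it is what makes tilted sections bounded.\<close>

locale ma_bounds =
  fixes u :: "'a::euclidean_space \<Rightarrow> real" and X :: "'a set" and a b L :: real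
  assumes convex: "convex_on UNIV u"
    and bounded_subgradient: "\<And>x v. v \<in> subdifferential u x \<Longrightarrow> norm v \<le> L"
    and compact_X: "compact X"
    and a: "a > 0" and b: "b > 0"
    and lower: "\<And>E. open E \<Longrightarrow> a * measure lebesgue (E \<inter> X) \<le> measure lebesgue (subdifferential_image u E)"
    and upper: "\<And>E. open E \<Longrightarrow> measure lebesgue (subdifferential_image u E) \<le> b * measure lebesgue (E \<inter> X)"
    and coercive: "\<exists>p0 \<eta> c0. \<eta> > 0 \<and> (\<forall>z. p0 \<bullet> z + \<eta> * norm z - c0 \<le> u z)"
begin

text \<open>The homothety of ratio \<sigma> about \<open>c\<close> maps \<open>S \<inter> X\<close>
  into \<open>X\<close> as well as into the half contraction, so the part of the latter in
  \<open>X\<close> keeps at least the fraction \<open>\<sigma> ^ DIM('a)\<close> of the volume of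
  \<open>S \<inter> X\<close>.\<close>

lemma doubling_aux:
  assumes S: "open S" and c: "c \<in> S" and \<sigma>: "\<sigma> > 0"
    and sub: "\<And>z. z \<in> S \<inter> X \<Longrightarrow> \<sigma> *\<^sub>R z + (1 - \<sigma>) *\<^sub>R c \<in> contract_half c S \<inter> X"
  shows "measure lebesgue (subdifferential_image u S)
    \<le> b / a * (1 / \<sigma>) ^ DIM('a) * measure lebesgue (subdifferential_image u (contract_half c S))"
proof -
  have SX: "U \<inter> X \<in> lmeasurable" if "open U" for U
    by (rule fmeasurableI2[OF lmeasurable_compact[OF compact_X]]) (use that compact_X in \<open>auto intro!: sets.Int simp: borel_compact\<close>)
  have "\<sigma> ^ DIM('a) * measure lebesgue (S \<inter> X) = measure lebesgue ((\<lambda>z. \<sigma> *\<^sub>R z + (1 - \<sigma>) *\<^sub>R c) ` (S \<inter> X))"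
    using measure_lebesgue_affine[of \<sigma> "(1 - \<sigma>) *\<^sub>R c" "S \<inter> X"] \<sigma> by simp
  also have "\<dots> \<le> measure lebesgue (contract_half c S \<inter> X)"
  proof (rule measure_mono_fmeasurable)
    show "(\<lambda>z. \<sigma> *\<^sub>R z + (1 - \<sigma>) *\<^sub>R c) ` (S \<inter> X) \<subseteq> contract_half c S \<inter> X" using sub by blast
    have "(\<lambda>z. \<sigma> *\<^sub>R z + (1 - \<sigma>) *\<^sub>R c) ` (S \<inter> X) = (\<lambda>z. (1 / \<sigma>) *\<^sub>R (z - (1 - \<sigma>) *\<^sub>R c)) -` (S \<inter> X)"
      using \<sigma> by (force simp: image_iff)
    also have "\<dots> \<in> sets borel"
      using S compact_X by (intro measurable_sets_borel[OF borel_measurable_continuous_onI] continuous_intros)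
        (auto simp: borel_compact)
    finally show "(\<lambda>z. \<sigma> *\<^sub>R z + (1 - \<sigma>) *\<^sub>R c) ` (S \<inter> X) \<in> sets lebesgue"
      by (simp add: sets_completionI_sets)
    show "contract_half c S \<inter> X \<in> lmeasurable" by (intro SX open_contract_half S)
  qed
  finally have 1: "\<sigma> ^ DIM('a) * measure lebesgue (S \<inter> X) \<le> measure lebesgue (contract_half c S \<inter> X)" .
  have "measure lebesgue (subdifferential_image u S) \<le> b * measure lebesgue (S \<inter> X)" by (rule upper[OF S])
  also have "\<dots> = b / a * (1 / \<sigma>) ^ DIM('a) * (a * (\<sigma> ^ DIM('a) * measure lebesgue (S \<inter> X)))"
    using a \<sigma> by (simp add: power_divide)
  also have "\<dots> \<le> b / a * (1 / \<sigma>) ^ DIM('a) * (a * measure lebesgue (contract_half c S \<inter> X))"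
    using 1 a b \<sigma> by (intro mult_left_mono) auto
  also have "\<dots> \<le> b / a * (1 / \<sigma>) ^ DIM('a) * measure lebesgue (subdifferential_image u (contract_half c S))"
    using lower[OF open_contract_half[OF S, of c]] a b \<sigma> by (intro mult_left_mono) auto
  finally show ?thesis .
qed

lemma mem_contract_half:
  assumes "convex S" "c \<in> S" "z \<in> S" "0 < \<sigma>" "\<sigma> \<le> 1 / 2"
  shows "\<sigma> *\<^sub>R z + (1 - \<sigma>) *\<^sub>R c \<in> contract_half c S"
proof -
  have "(2 * \<sigma>) *\<^sub>R z + (1 - 2 * \<sigma>) *\<^sub>R c \<in> S" using assms by (intro convexD) auto
  moreover have "\<sigma> *\<^sub>R z + (1 - \<sigma>) *\<^sub>R c = (1 / 2) *\<^sub>R ((2 * \<sigma>) *\<^sub>R z + (1 - 2 * \<sigma>) *\<^sub>R c) + (1 / 2) *\<^sub>R c"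
    by (simp add: scaleR_add_right scaleR_left_diff_distrib algebra_simps flip: scaleR_left_distrib)
  ultimately show ?thesis by (auto simp: contract_half_def)
qed

text \<open>Any convex set through the centre of a ball inside \<open>X\<close> satisfies the doubling condition,
  no matter how far it sticks out of \<open>X\<close>.\<close>

lemma doubling:
  assumes S: "open S" "convex S" "c \<in> S" and r: "0 < r" "r \<le> R" "cball c r \<subseteq> X" "X \<subseteq> cball c R"
  shows "measure lebesgue (subdifferential_image u S)
    \<le> b / a * (1 / min (1 / 2) (r / R)) ^ DIM('a) * measure lebesgue (subdifferential_image u (contract_half c S))"
proof (rule doubling_aux[OF S(1,3)])
  let ?\<sigma> = "min (1 / 2) (r / R)"
  show \<sigma>: "0 < ?\<sigma>" using r by simp
  fix z assume z: "z \<in> S \<inter> X"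
  have "?\<sigma> * norm (z - c) \<le> (r / R) * R"
    using z r by (intro mult_mono) (auto simp: dist_norm norm_minus_commute)
  then have "?\<sigma> * norm (z - c) \<le> r" using r by simp
  then have "norm (?\<sigma> *\<^sub>R (z - c)) \<le> r" using \<sigma> by simp
  moreover have "c - (?\<sigma> *\<^sub>R z + (1 - ?\<sigma>) *\<^sub>R c) = - (?\<sigma> *\<^sub>R (z - c))"
    by (simp add: scaleR_left_diff_distrib scaleR_right_diff_distrib)
  ultimately have "dist c (?\<sigma> *\<^sub>R z + (1 - ?\<sigma>) *\<^sub>R c) \<le> r" unfolding dist_norm by (simp only: norm_minus_cancel)
  then have "?\<sigma> *\<^sub>R z + (1 - ?\<sigma>) *\<^sub>R c \<in> X" using r(3) by (meson mem_cball subsetD)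
  then show "?\<sigma> *\<^sub>R z + (1 - ?\<sigma>) *\<^sub>R c \<in> contract_half c S \<inter> X"
    using mem_contract_half[OF S(2,3) _ \<sigma> min.cobounded1, of z] z by auto
qed

text \<open>The slope \<open>v\<close> may lie on the boundary of the range of the subdifferential, where sections can
  be unbounded; tilting it slightly towards \<open>p0\<close> makes them bounded.\<close>

lemma bregman_engulfing:
  assumes v: "v \<in> subdifferential u x" and w: "w \<in> subdifferential u y"
    and r: "0 < r" "r \<le> R" "cball c r \<subseteq> X" "X \<subseteq> cball c R"
    and c: "\<kappa> *\<^sub>R (c - x) = y - c" "\<kappa> \<ge> 0" and pos: "bregman u v x y > 0"
  shows "(w - v) \<bullet> (y - c)
    \<le> (3 * (b / a * (1 / min (1 / 2) (r / R)) ^ DIM('a) * (16 * (1 + \<kappa>)) ^ DIM('a)) + 1) * bregman u v x y"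
proof -
  define D where "D = bregman u v x y"
  have D: "D > 0" using pos by (simp add: D_def)
  obtain p0 \<eta> c0 where \<eta>: "\<eta> > 0" and coe: "\<And>z. p0 \<bullet> z + \<eta> * norm z - c0 \<le> u z"
    using coercive by blast
  define A where "A = u x + c0 - p0 \<bullet> x"
  have "0 \<le> \<eta> * norm x" using \<eta> by simp
  then have A: "A \<ge> 0" using coe[of x] by (simp add: A_def)
  define A1 where "A1 = \<bar>(p0 - v) \<bullet> (y - x)\<bar>"
  define A2 where "A2 = \<bar>(p0 - v) \<bullet> (y - c)\<bar>"
  \<comment> \<open>Small enough for the three errors caused by tilting the slope to stay within
    \<open>D\<close>, \<open>D / 4\<close> and \<open>D\<close>.\<close>
  define t where "t = min (1 / 2) (D / (4 * (A + A1 + A2 + 1)))"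
  have A12: "A1 \<ge> 0" "A2 \<ge> 0" by (simp_all add: A1_def A2_def)
  have t: "0 < t" "t < 1" using D A A12 by (auto simp: t_def)
  have "t * (4 * (A + A1 + A2 + 1)) \<le> D"
  proof -
    have "t \<le> D / (4 * (A + A1 + A2 + 1))" by (simp add: t_def)
    then show ?thesis using A A12 by (simp add: pos_le_divide_eq)
  qed
  then have "4 * (t * A) + 4 * (t * A1) + 4 * (t * A2) + 4 * t \<le> D" by (simp add: algebra_simps)
  moreover have "t * A \<ge> 0" "t * A1 \<ge> 0" "t * A2 \<ge> 0" using t A A12 by auto
  ultimately have tA: "t * A \<le> D" "t * A1 \<le> D / 4" "t * A2 \<le> D" using t by linarith+
  define v' where "v' = (1 - t) *\<^sub>R v + t *\<^sub>R p0"
  \<comment> \<open>Raising the tilted plane through \<open>(x, u x)\<close> by \<open>2 * D\<close>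
    leaves depth at least \<open>3 * D / 4\<close> at \<open>y\<close>: a quarter of the overall
    depth bound \<open>3 * D\<close>, as the engulfing estimate demands.\<close>
  define \<alpha> where "\<alpha> = u x - v' \<bullet> x + 2 * D"
  define S where "S = {z. u z < \<alpha> + v' \<bullet> z}"
  have gap: "\<alpha> + v' \<bullet> z - u z \<le> 2 * D + t * A - t * (\<eta> * norm z)" for z
  proof -
    have "(1 - t) * (u x + v \<bullet> (z - x)) \<le> (1 - t) * u z"
      using t subdifferentialD[OF v, of z] by (intro mult_left_mono) auto
    moreover have "t * (p0 \<bullet> z + \<eta> * norm z - c0) \<le> t * u z"
      using t coe[of z] by (intro mult_left_mono) auto
    ultimately have "(1 - t) * (u x + v \<bullet> (z - x)) + t * (p0 \<bullet> z + \<eta> * norm z - c0) \<le> u z"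
      by (simp add: algebra_simps)
    then show ?thesis
      unfolding \<alpha>_def v'_def A_def by (simp add: inner_diff_right inner_add_left algebra_simps)
  qed
  have H: "\<alpha> + v' \<bullet> z - u z \<le> 3 * D" for z
  proof -
    have "0 \<le> t * (\<eta> * norm z)" using t \<eta> by simp
    then show ?thesis using gap[of z] tA(1) by linarith
  qed
  have bS: "bounded S"
  proof (rule boundedI)
    fix z assume "z \<in> S"
    then have "t * \<eta> * norm z \<le> 2 * D + t * A" using gap[of z] by (simp add: S_def)
    then show "norm z \<le> (2 * D + t * A) / (t * \<eta>)" using t \<eta> by (simp add: pos_le_divide_eq mult.commute)
  qed
  have vv: "v' = v + t *\<^sub>R (p0 - v)" by (simp add: v'_def algebra_simps)
  have xS: "x \<in> S" using D by (simp add: S_def \<alpha>_def)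
  have "- A1 \<le> (p0 - v) \<bullet> (y - x)" by (simp add: A1_def)
  then have "t * - A1 \<le> t * ((p0 - v) \<bullet> (y - x))" using t by (intro mult_left_mono) auto
  then have "t * ((p0 - v) \<bullet> (y - x)) \<ge> - (t * A1)" by simp
  moreover have "\<alpha> + v' \<bullet> y - u y = 2 * D - D + t * ((p0 - v) \<bullet> (y - x))"
    unfolding \<alpha>_def vv D_def bregman_def by (simp add: inner_diff_right inner_add_left algebra_simps)
  ultimately have yH: "\<alpha> + v' \<bullet> y - u y \<ge> 3 * D / 4" using tA(2) by linarith
  have yS: "y \<in> S" using yH D by (simp add: S_def)
  have cS: "convex S" "open S" unfolding S_def by (rule convex_section[OF convex] open_section[OF convex])+
  have "c \<in> S"
  proof -
    have "(1 + \<kappa>) *\<^sub>R c = \<kappa> *\<^sub>R x + y" using c(1) by (simp add: algebra_simps)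
    then have "(1 / (1 + \<kappa>)) *\<^sub>R ((1 + \<kappa>) *\<^sub>R c) = (1 / (1 + \<kappa>)) *\<^sub>R (\<kappa> *\<^sub>R x + y)" by simp
    then have "c = (\<kappa> / (1 + \<kappa>)) *\<^sub>R x + (1 / (1 + \<kappa>)) *\<^sub>R y" using c(2) by (simp add: scaleR_add_right)
    moreover have "\<kappa> / (1 + \<kappa>) + 1 / (1 + \<kappa>) = 1" using c(2) by (simp add: add_divide_distrib[symmetric])
    ultimately show ?thesis using convexD[OF cS(1) xS yS] c(2) by simp
  qed
  define B where "B = b / a * (1 / min (1 / 2) (r / R)) ^ DIM('a) * (16 * (1 + \<kappa>)) ^ DIM('a)"
  have "(w - v') \<bullet> (y - c) \<le> B * (3 * D)"
    unfolding B_def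
  proof (rule engulfing[OF convex bounded_subgradient S_def bS H _ _ _ \<open>c \<in> S\<close> yS _ xS c w])
    show "measure lebesgue (subdifferential_image u S)
      \<le> b / a * (1 / min (1 / 2) (r / R)) ^ DIM('a) * measure lebesgue (subdifferential_image u (contract_half c S))"
      by (rule doubling[OF cS(2,1) \<open>c \<in> S\<close> r])
    show "0 \<le> b / a * (1 / min (1 / 2) (r / R)) ^ DIM('a)" using a b r by simp
  qed (use D yH in auto)
  \<comment> \<open>Undoing the tilt costs at most \<open>D\<close>, the source of the summand 1 in
    the constant.\<close>
  moreover have "(w - v) \<bullet> (y - c) = (w - v') \<bullet> (y - c) + t * ((p0 - v) \<bullet> (y - c))"
    unfolding vv by (simp add: inner_diff_left inner_add_left algebra_simps)
  moreover have "t * ((p0 - v) \<bullet> (y - c)) \<le> t * A2" using t by (simp add: A2_def)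
  ultimately have "(w - v) \<bullet> (y - c) \<le> B * (3 * D) + D" using tA(3) by linarith
  then show ?thesis by (simp add: B_def D_def algebra_simps)
qed

text \<open>Suppose contact with the supporting plane ended at parameter \<open>T\<close>. Just
  beyond, at distance \<tau>, convexity bounds the Bregman distance by \<tau> times the excess slope
  \<open>m\<close>, while engulfing bounds \<open>m\<close> by a constant times the Bregman
  distance; for small \<tau> these clash. The ball inside \<open>X\<close> is placed around
  \<open>c\<close>, close to \<open>x\<close>, so the ray itself may leave \<open>X\<close>.\<close>

lemma affine_on_ray:
  assumes x: "x \<in> interior X" and v: "v \<in> subdifferential u x" and e: "e \<noteq> 0" "bregman u v x (x + e) = 0"
    and t: "t \<ge> 0"
  shows "bregman u v x (x + t *\<^sub>R e) = 0"
proof -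
  define f where "f t = bregman u v x (x + t *\<^sub>R e)" for t
  have f: "convex_on UNIV f"
  proof (rule convex_onI)
    fix \<tau> p q :: real assume \<tau>: "0 < \<tau>" "\<tau> < 1"
    have "x + ((1 - \<tau>) *\<^sub>R p + \<tau> *\<^sub>R q) *\<^sub>R e = (1 - \<tau>) *\<^sub>R (x + p *\<^sub>R e) + \<tau> *\<^sub>R (x + q *\<^sub>R e)"
      by (simp add: algebra_simps)
    then have "u (x + ((1 - \<tau>) *\<^sub>R p + \<tau> *\<^sub>R q) *\<^sub>R e) \<le> (1 - \<tau>) * u (x + p *\<^sub>R e) + \<tau> * u (x + q *\<^sub>R e)"
      using convex_onD[OF convex, of \<tau> "x + p *\<^sub>R e" "x + q *\<^sub>R e"] \<tau> by simp
    then show "f ((1 - \<tau>) *\<^sub>R p + \<tau> *\<^sub>R q) \<le> (1 - \<tau>) * f p + \<tau> * f q"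
      by (simp add: f_def bregman_def algebra_simps)
  qed simp
  have f0: "f s \<ge> 0" for s by (simp add: f_def bregman_nonneg[OF v])
  have contf: "continuous_on UNIV f" by (rule convex_on_UNIV_continuous[OF f])
  have f00: "f 0 = 0" by (simp add: f_def bregman_def)
  have between: "f s = 0" if "0 \<le> s" "s \<le> T" "f T = 0" for s T
  proof (cases "T = 0")
    case False
    have "f ((1 - s / T) *\<^sub>R 0 + (s / T) *\<^sub>R T) \<le> (1 - s / T) * f 0 + (s / T) * f T"
      using that False by (intro convex_onD[OF f]) auto
    then show ?thesis using f0[of s] f00 that False by simp
  qed (use that f00 in auto)
  define Z where "Z = {s. 0 \<le> s \<and> f s = 0}"
  have "\<not> bdd_above Z"
  proof
    assume bdd: "bdd_above Z"
    have "1 \<in> Z" using e by (simp add: Z_def f_def)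
    have "closed Z"
    proof -
      have "Z = {0..} \<inter> f -` {0}" by (auto simp: Z_def)
      then show ?thesis using contf by (auto intro: continuous_closed_preimage closed_Int continuous_closed_vimage simp: continuous_on_eq_continuous_at)
    qed
    define T where "T = Sup Z"
    have TZ: "T \<in> Z" unfolding T_def using \<open>1 \<in> Z\<close> \<open>closed Z\<close> bdd by (intro closed_contains_Sup) auto
    have T1: "T \<ge> 1" unfolding T_def using \<open>1 \<in> Z\<close> bdd by (rule cSup_upper)
    have posT: "f s > 0" if "s > T" for s
    proof (rule ccontr)
      assume "\<not> f s > 0"
      then have "s \<in> Z" using f0[of s] that T1 by (simp add: Z_def)
      then have "s \<le> T" unfolding T_def using bdd by (rule cSup_upper)
      then show False using that by simp
    qed
    obtain d where d: "d > 0" "cball x d \<subseteq> X"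
      using x mem_interior_cball by blast
    \<comment> \<open>Keeps \<open>c\<close> within \<open>d / 2\<close> of \<open>x\<close>, and
      the parameters of \<open>c\<close> and \<open>y\<close> at least 1/2 apart.\<close>
    define s where "s = min (1 / 2) (d / (2 * norm e))"
    define c where "c = x + s *\<^sub>R e"
    have s: "0 < s" "s \<le> 1 / 2" using d e by (auto simp: s_def)
    have "s * norm e \<le> d / (2 * norm e) * norm e" by (intro mult_right_mono) (auto simp: s_def)
    then have se: "s * norm e \<le> d / 2" using e by simp
    have cb: "cball c (d / 2) \<subseteq> X"
    proof -
      have "cball c (d / 2) \<subseteq> cball x d"
        using se s by (intro cball_subset_cball_iff[THEN iffD2]) (auto simp: c_def dist_norm)
      then show ?thesis using d by blast
    qed
    obtain R where R: "R \<ge> d / 2" "X \<subseteq> cball c R"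
    proof -
      obtain R0 where "X \<subseteq> cball c R0"
        using compact_imp_bounded[OF compact_X] bounded_any_center[of X c] by (auto simp: subset_iff)
      then have "X \<subseteq> cball c (max R0 (d / 2))" by (auto simp: subset_iff)
      then show ?thesis by (intro that[of "max R0 (d / 2)"]) auto
    qed
    \<comment> \<open>The ratio \<kappa> depends on \<tau>, whose choice depends on the engulfing
      constant and so on \<kappa>; an advance bound for \<kappa> breaks the circle.\<close>
    define \<kappa>max where "\<kappa>max = (T + 1) / s"
    define B where "B \<kappa> = 3 * (b / a * (1 / min (1 / 2) ((d / 2) / R)) ^ DIM('a) * (16 * (1 + \<kappa>)) ^ DIM('a)) + 1" for \<kappa> :: real
    have Bmono: "B \<kappa> \<le> B \<kappa>max" if "0 \<le> \<kappa>" "\<kappa> \<le> \<kappa>max" for \<kappa>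
      unfolding B_def using that a b d R by (intro add_right_mono mult_left_mono power_mono) auto
    have \<kappa>max0: "0 \<le> \<kappa>max" using T1 s by (simp add: \<kappa>max_def)
    have Bpos: "B \<kappa>max \<ge> 1" unfolding B_def using a b d R \<kappa>max0 by simp
    \<comment> \<open>With \<open>q - s \<ge> 1 / 2\<close> the two estimates combine to
      \<open>m / 2 \<le> m / 4\<close>.\<close>
    define \<tau> where "\<tau> = 1 / (4 * B \<kappa>max)"
    have \<tau>: "0 < \<tau>" "\<tau> \<le> 1 / 4" using Bpos by (auto simp: \<tau>_def divide_le_eq)
    define q where "q = T + \<tau>"
    define y where "y = x + q *\<^sub>R e"
    obtain w where w: "w \<in> subdifferential u y" using subdifferential_nonempty[OF convex] .
    define m where "m = (w - v) \<bullet> e"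
    have fq: "f q > 0" using \<tau> by (intro posT) (simp add: q_def)
    have \<kappa>: "((q - s) / s) *\<^sub>R (c - x) = y - c"     proof -
      have "c - x = s *\<^sub>R e" "(q - s) / s * s = q - s" using s by (simp_all add: c_def)
      then have "((q - s) / s) *\<^sub>R (c - x) = (q - s) *\<^sub>R e" by (simp only: scaleR_scaleR)
      then show ?thesis by (simp add: c_def y_def algebra_simps)
    qed
    have \<kappa>0: "0 \<le> (q - s) / s" "(q - s) / s \<le> \<kappa>max"
      using s T1 \<tau> by (auto simp: q_def \<kappa>max_def divide_right_mono)
    have "(w - v) \<bullet> (y - c) \<le> B ((q - s) / s) * bregman u v x y"
      unfolding B_def
      by (rule bregman_engulfing[OF v w _ _ cb R(2) \<kappa> \<kappa>0(1)]) (use d R fq in \<open>auto simp: f_def y_def\<close>)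
    also have "\<dots> \<le> B \<kappa>max * f q"
      using Bmono[OF \<kappa>0] fq by (simp add: f_def y_def mult_right_mono)
    finally have up: "(q - s) * m \<le> B \<kappa>max * f q" by (simp add: c_def y_def m_def flip: scaleR_left_diff_distrib)
    have "u y + w \<bullet> (x + T *\<^sub>R e - y) \<le> u (x + T *\<^sub>R e)" by (rule subdifferentialD[OF w])
    then have "f q \<le> f T + \<tau> * m"
      by (simp add: f_def bregman_def y_def q_def m_def inner_diff_left inner_diff_right algebra_simps)
    then have lo: "f q \<le> \<tau> * m" using TZ by (simp add: Z_def)
    with fq have "0 < \<tau> * m" by linarith
    then have m0: "m > 0" using \<tau> by (simp add: zero_less_mult_iff)
    have "(1 / 2) * m \<le> (q - s) * m" using m0 s T1 \<tau> by (intro mult_right_mono) (auto simp: q_def)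
    also have "\<dots> \<le> B \<kappa>max * (\<tau> * m)" using up lo Bpos by (meson mult_left_mono order_trans zero_le_one)
    also have "\<dots> = (1 / 4) * m" using Bpos by (simp add: \<tau>_def)
    finally show False using m0 by simp
  qed
  then obtain T where "T \<in> Z" "\<not> T \<le> t" by (auto simp: bdd_above_def)
  then show ?thesis using between[of t T] t by (simp add: Z_def f_def)
qed

text \<open>Contact at a second point extends to a ray; restarting at the interior point
  \<open>x1\<close> in the opposite direction makes \<open>u\<close> affine on a whole line. All
  subgradients of \<open>u\<close> then lie in one hyperplane, so their set is null, whereas the
  lower bound on \<open>UNIV\<close> gives it positive volume.\<close>

lemma bregman_pos:
  assumes x: "x \<in> interior X" and v: "v \<in> subdifferential u x" and z: "z \<noteq> x"
  shows "bregman u v x z > 0"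
proof (rule ccontr)
  assume "\<not> bregman u v x z > 0"
  then have z0: "bregman u v x z = 0" using bregman_nonneg[OF v, of z] by simp
  define e where "e = z - x"
  have e: "e \<noteq> 0" "bregman u v x (x + e) = 0" using z z0 by (auto simp: e_def)
  obtain d where d: "d > 0" "ball x d \<subseteq> interior X" using x open_contains_ball[of "interior X"] by auto
  define s where "s = min 1 (d / (2 * norm e))"
  have s: "s > 0" "s \<le> 1" using d e by (auto simp: s_def)
  have "s * norm e \<le> d / (2 * norm e) * norm e" by (intro mult_right_mono) (auto simp: s_def)
  then have se: "s * norm e < d" using e d by simp
  define x1 where "x1 = x + s *\<^sub>R e"
  have x1: "x1 \<in> interior X" using d se s by (auto simp: x1_def subset_iff dist_norm)
  have ux1: "u x1 = u x + v \<bullet> (x1 - x)"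
    using affine_on_ray[OF x v e, of s] s by (simp add: x1_def bregman_def)
  have v1: "v \<in> subdifferential u x1"
  proof (rule subdifferentialI)
    show "u x1 + v \<bullet> (y - x1) \<le> u y" for y
      using subdifferentialD[OF v, of y] ux1 by (simp add: inner_diff_right)
  qed
  have e1: "- (s *\<^sub>R e) \<noteq> 0" "bregman u v x1 (x1 + - (s *\<^sub>R e)) = 0"
    using e s ux1 by (auto simp: bregman_def x1_def)
  have line: "u (x + t *\<^sub>R e) = u x + t * (v \<bullet> e)" for t
  proof (cases "t \<ge> 0")
    case True
    then show ?thesis using affine_on_ray[OF x v e, of t] by (simp add: bregman_def)
  next
    case False
    then have "(s - t) / s \<ge> 0" using s by simp
    from affine_on_ray[OF x1 v1 e1 this]
    have "bregman u v x1 (x1 + ((s - t) / s) *\<^sub>R - (s *\<^sub>R e)) = 0" .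
    moreover have "x1 + ((s - t) / s) *\<^sub>R - (s *\<^sub>R e) = x + t *\<^sub>R e"
    proof -
      have "(s - t) / s * s = s - t" using s by simp
      then show ?thesis by (simp only: x1_def scaleR_minus_right scaleR_scaleR) (simp add: algebra_simps)
    qed
    ultimately show ?thesis using ux1 by (simp add: bregman_def x1_def inner_diff_right inner_add_right algebra_simps)
  qed
  have "subdifferential_image u UNIV \<subseteq> {q. e \<bullet> q = e \<bullet> v}"
  proof
    fix q assume "q \<in> subdifferential_image u UNIV"
    then obtain y where q: "q \<in> subdifferential u y" by (auto elim: subdifferential_imageE)
    define k where "k = u y + q \<bullet> (x - y) - u x"
    \<comment> \<open>A supporting plane of \<open>u\<close> stays below an affine function along
      the entire line, so the two slopes in direction \<open>e\<close> agree.\<close>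
    have *: "k + t * ((q - v) \<bullet> e) \<le> 0" for t
      using subdifferentialD[OF q, of "x + t *\<^sub>R e"] line[of t]
      by (simp add: k_def inner_diff_left inner_diff_right inner_add_right algebra_simps)
    have "(q - v) \<bullet> e = 0"
    proof (rule ccontr)
      assume "(q - v) \<bullet> e \<noteq> 0"
      then show False using *[of "(1 - k) / ((q - v) \<bullet> e)"] by simp
    qed
    then show "q \<in> {q. e \<bullet> q = e \<bullet> v}" by (simp add: inner_diff_right inner_commute)
  qed
  moreover have "negligible {q. e \<bullet> q = e \<bullet> v}" using e by (intro negligible_hyperplane) auto
  ultimately have "negligible (subdifferential_image u UNIV)" by (rule negligible_subset[rotated])
  then have "measure lebesgue (subdifferential_image u UNIV) = 0"
    by (simp add: negligible_imp_measure0)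
  moreover have "measure lebesgue X > 0"
  proof -
    have "measure lebesgue (ball x d) \<le> measure lebesgue X"
      using d interior_subset[of X] compact_X by (intro measure_mono_fmeasurable lmeasurable_compact) auto
    moreover have "measure lebesgue (ball x d) > 0" using content_ball_pos[OF d(1), of x] by simp
    ultimately show ?thesis by linarith
  qed
  ultimately show False using lower[OF open_UNIV] a by (simp add: mult_le_0_iff)
qed

text \<open>The engulfing constant for a section inside \<open>X\<close> (contraction factor 1/2)
  with \<open>c\<close> the midpoint of \<open>x\<close> and \<open>y\<close> (\<kappa> = 1). The 4
  is 2 for the depth \<open>2 * D\<close> times 2 for \<open>y - c = (y - x) / 2\<close>; the
  maximum with 1 keeps \<open>hoelder_exponent\<close> at most 1.\<close>

definition theta :: real where
  "theta = max 1 (4 * (b / a * (1 / (1 / 2)) ^ DIM('a) * (16 * (1 + 1)) ^ DIM('a)))"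

lemma theta_ge_1: "theta \<ge> 1"
  by (simp add: theta_def)

text \<open>Sections of small height around points of \<open>K\<close> stay inside \<open>X\<close>, so the doubling constant
  used here, and with it \<open>theta\<close>, does not depend on \<open>K\<close>.\<close>

lemma bregman_quasi_symmetric:
  assumes K: "compact K" "K \<subseteq> interior X"
  obtains \<rho> where "\<rho> > 0"
    "\<And>x y v w. x \<in> K \<Longrightarrow> y \<in> K \<Longrightarrow> v \<in> subdifferential u x \<Longrightarrow> w \<in> subdifferential u y \<Longrightarrow> dist x y < \<rho>
      \<Longrightarrow> bregman u w y x \<le> theta * bregman u v x y"
proof -
  obtain r where r: "r > 0" "\<And>x. x \<in> K \<Longrightarrow> cball x r \<subseteq> X"
  proof -
    obtain e where e: "e > 0" "(\<Union>x\<in>K. ball x e) \<subseteq> interior X"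
      using compact_subset_open_imp_ball_epsilon_subset[OF K(1) open_interior K(2)] by blast
    have "cball x (e / 2) \<subseteq> X" if "x \<in> K" for x
    proof -
      have "cball x (e / 2) \<subseteq> ball x e" using e by auto
      then show ?thesis using e(2) that interior_subset by blast
    qed
    then show ?thesis using e(1) by (intro that[of "e / 2"]) auto
  qed
  have L0: "L \<ge> 0"
    using bounded_subgradient subdifferential_nonempty[OF convex, of undefined] norm_ge_zero order_trans by metis
  define G where "G = {(x, v). x \<in> K \<and> v \<in> subdifferential u x} \<times> sphere (0::'a) r"
  \<comment> \<open>Strict convexity, with compactness in base point, slope and direction, gives a
    uniform positive Bregman distance at radius \<open>r\<close>.\<close>
  obtain \<delta> where \<delta>: "\<delta> > 0"
    "\<And>x v d. x \<in> K \<Longrightarrow> v \<in> subdifferential u x \<Longrightarrow> norm d = r \<Longrightarrow> \<delta> \<le> bregman u v x (x + d)"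
  proof (cases "G = {}")
    case True
    have False if "x \<in> K" "v \<in> subdifferential u x" "norm d = r" for x v and d :: 'a
    proof -
      have "((x, v), d) \<in> G" using that by (simp add: G_def)
      then show False using True by simp
    qed
    then show ?thesis by (intro that[of 1]) auto
  next
    case False
    have "compact G" unfolding G_def
      by (intro compact_Times compact_subdifferential_graph[OF convex bounded_subgradient K(1)] compact_sphere)
    moreover have "continuous_on G (\<lambda>z. bregman u (snd (fst z)) (fst (fst z)) (fst (fst z) + snd z))"
      unfolding bregman_def
      by (intro continuous_intros continuous_on_compose2[OF convex_on_UNIV_continuous[OF convex, of UNIV]]) auto
    ultimately have "\<exists>z\<in>G. \<forall>z'\<in>G. bregman u (snd (fst z)) (fst (fst z)) (fst (fst z) + snd z)
         \<le> bregman u (snd (fst z')) (fst (fst z')) (fst (fst z') + snd z')"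
      by (intro continuous_attains_inf False)
    then obtain z where z: "z \<in> G"
      "\<And>z'. z' \<in> G \<Longrightarrow> bregman u (snd (fst z)) (fst (fst z)) (fst (fst z) + snd z)
         \<le> bregman u (snd (fst z')) (fst (fst z')) (fst (fst z') + snd z')"
      by blast
    show ?thesis
    proof (rule that)
      show "bregman u (snd (fst z)) (fst (fst z)) (fst (fst z) + snd z) > 0"
        using z(1) K(2) r(1) by (intro bregman_pos) (auto simp: G_def)
      show "bregman u (snd (fst z)) (fst (fst z)) (fst (fst z) + snd z) \<le> bregman u v x (x + d)"
        if "x \<in> K" "v \<in> subdifferential u x" "norm d = r" for x v d
        using z(2)[of "((x, v), d)"] that by (simp add: G_def)
    qed
  qed
  show ?thesis
  proof (rule that)
    \<comment> \<open>The Lipschitz bound gives \<open>D \<le> 2 * L * dist x y\<close>, so this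
      radius forces \<open>2 * D < \<delta>\<close>.\<close>
    show "\<delta> / (4 * L + 4) > 0" using \<delta>(1) L0 by simp
    fix x y v w
    assume x: "x \<in> K" and y: "y \<in> K" and v: "v \<in> subdifferential u x" and w: "w \<in> subdifferential u y"
      and xy: "dist x y < \<delta> / (4 * L + 4)"
    define D where "D = bregman u v x y"
    have "bregman u w y x \<le> (4 * (b / a * (1 / (1 / 2)) ^ DIM('a) * (16 * (1 + 1)) ^ DIM('a))) * bregman u v x y"
    proof (cases "x = y")
      case False
      have D: "D > 0" unfolding D_def using x K(2) False by (intro bregman_pos v) auto
      have "L-lipschitz_on UNIV u" using convex bounded_subgradient by (rule lipschitz_of_bounded_subdifferential)
      then have "\<bar>u y - u x\<bar> \<le> L * dist x y" using lipschitz_onD by (fastforce simp: dist_real_def dist_commute)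
      moreover have "\<bar>v \<bullet> (y - x)\<bar> \<le> L * dist x y"
        using Cauchy_Schwarz_ineq2[of v "y - x"] mult_right_mono[OF bounded_subgradient[OF v], of "dist x y"]
        by (simp add: dist_norm norm_minus_commute)
      ultimately have "D \<le> 2 * L * dist x y" unfolding D_def bregman_def by linarith
      also have "\<dots> \<le> (2 * L + 2) * dist x y" by (simp add: algebra_simps)
      also have "\<dots> < (2 * L + 2) * (\<delta> / (4 * L + 4))" using xy L0 by (intro mult_strict_left_mono) auto
      also have "\<dots> = \<delta> / 2" using L0 by (simp add: field_simps)
      finally have D2: "2 * D < \<delta>" by simp
      define \<alpha> where "\<alpha> = u x - v \<bullet> x + 2 * D"
      define S where "S = {z. u z < \<alpha> + v \<bullet> z}"
      have in_S: "z \<in> S \<longleftrightarrow> bregman u v x z < 2 * D" for z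
        by (simp add: S_def \<alpha>_def bregman_def inner_diff_right algebra_simps)
      have Sr: "S \<subseteq> cball x r"
      proof
        fix z assume z: "z \<in> S"
        show "z \<in> cball x r"
        proof (rule ccontr)
          assume "z \<notin> cball x r"
          then have n: "norm (z - x) > r" by (simp add: dist_norm norm_minus_commute)
          \<comment> \<open>The segment from \<open>x\<close> to \<open>z\<close> crosses the sphere
            of radius \<open>r\<close> at parameter \<tau>, where the Bregman distance is at least
            \<delta>; convexity along the segment carries this bound on to \<open>z\<close>.\<close>
          define \<tau> where "\<tau> = r / norm (z - x)"
          have "0 < norm (z - x)" using n r(1) by linarith
          then have \<tau>: "0 < \<tau>" "\<tau> < 1" using n r(1) unfolding \<tau>_def
            by (simp_all only: divide_pos_pos divide_less_eq_1_pos)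
          have "\<delta> \<le> bregman u v x (x + \<tau> *\<^sub>R (z - x))"
            using \<open>0 < norm (z - x)\<close> r(1) by (intro \<delta>(2)[OF x v]) (simp add: \<tau>_def)
          also have "\<dots> \<le> \<tau> * bregman u v x z"
          proof -
            have "x + \<tau> *\<^sub>R (z - x) = (1 - \<tau>) *\<^sub>R x + \<tau> *\<^sub>R z" by (simp add: algebra_simps)
            then have "u (x + \<tau> *\<^sub>R (z - x)) \<le> (1 - \<tau>) * u x + \<tau> * u z"
              using convex_onD[OF convex, of \<tau> x z] \<tau> by simp
            then show ?thesis by (simp add: bregman_def algebra_simps)
          qed
          also have "\<dots> \<le> 1 * bregman u v x z" using \<tau> bregman_nonneg[OF v] by (intro mult_right_mono) auto
          also have "\<dots> < \<delta>" using z D2 in_S by simp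
          finally show False by simp
        qed
      qed
      have bS: "bounded S" by (rule bounded_subset[OF bounded_cball Sr])
      have SX: "S \<subseteq> X" using Sr r(2)[OF x] by blast
      have xS: "x \<in> S" and yS: "y \<in> S" using D by (auto simp: in_S bregman_def) (simp_all add: D_def bregman_def)
      have cS: "convex S" "open S" unfolding S_def by (rule convex_section[OF convex] open_section[OF convex])+
      define c where "c = (1 / 2) *\<^sub>R x + (1 / 2) *\<^sub>R y"
      have c: "c \<in> S" unfolding c_def using convexD[OF cS(1) xS yS, of "1 / 2" "1 / 2"] by simp
      have yc: "y - c = (1 / 2) *\<^sub>R (y - x)" "c - x = (1 / 2) *\<^sub>R (y - x)"
        by (simp_all add: c_def algebra_simps flip: scaleR_left_distrib)
      have gap: "\<alpha> + v \<bullet> z - u z = 2 * D - bregman u v x z" for z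
        by (simp add: \<alpha>_def bregman_def inner_diff_right)
      have "(w - v) \<bullet> (y - c) \<le> b / a * (1 / (1 / 2)) ^ DIM('a) * (16 * (1 + 1)) ^ DIM('a) * (2 * D)"
      proof (rule engulfing[OF convex bounded_subgradient S_def bS _ _ _ _ c yS _ xS _ _ w])
        show "\<alpha> + v \<bullet> z - u z \<le> 2 * D" for z using gap[of z] bregman_nonneg[OF v, of z] by simp
        show "2 * D / 4 \<le> \<alpha> + v \<bullet> y - u y" using gap[of y] D by (simp add: D_def)
        show "measure lebesgue (subdifferential_image u S)
          \<le> b / a * (1 / (1 / 2)) ^ DIM('a) * measure lebesgue (subdifferential_image u (contract_half c S))"
        proof (rule doubling_aux[OF cS(2) c])
          fix z assume "z \<in> S \<inter> X"
          then have z: "z \<in> S" by simp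
          have "(1 / 2) *\<^sub>R z + (1 - 1 / 2) *\<^sub>R c \<in> S"
            by (rule convexD[OF cS(1) z c]) auto
          then show "(1 / 2) *\<^sub>R z + (1 - 1 / 2) *\<^sub>R c \<in> contract_half c S \<inter> X"
            using SX mem_contract_half[OF cS(1) c z, of "1 / 2"] by auto
        qed simp
        show "0 \<le> b / a * (1 / (1 / 2)) ^ DIM('a)" using a b by simp
        show "1 *\<^sub>R (c - x) = y - c" by (simp add: yc)
      qed (use D in auto)
      then have "(w - v) \<bullet> (y - x) \<le> 4 * (b / a * (1 / (1 / 2)) ^ DIM('a) * (16 * (1 + 1)) ^ DIM('a)) * D"
        by (simp add: yc)
      then show ?thesis using bregman_add[of u v x y w] D by (simp add: D_def)
    qed (simp add: bregman_def)
    also have "\<dots> \<le> theta * bregman u v x y"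
      by (intro mult_right_mono bregman_nonneg[OF v]) (simp add: theta_def)
    finally show "bregman u w y x \<le> theta * bregman u v x y" .
  qed
qed

text \<open>Chosen so that doubling \<open>z\<close> multiplies
  \<open>norm z powr (1 + hoelder_exponent)\<close> by exactly \<open>2 + 1 / theta\<close>.\<close>

definition hoelder_exponent :: real where
  "hoelder_exponent = log 2 (2 + 1 / theta) - 1"

lemma hoelder_exponent: "0 < hoelder_exponent" "hoelder_exponent \<le> 1"
  "2 powr (1 + hoelder_exponent) = 2 + 1 / theta"
proof -
  have t: "0 < 1 / theta" "1 / theta \<le> 1" using theta_ge_1 by auto
  have "log 2 2 < log 2 (2 + 1 / theta)" using t by (intro log_less) auto
  then show "0 < hoelder_exponent" by (simp add: hoelder_exponent_def)
  have "log 2 (2 + 1 / theta) \<le> log 2 4" using t by (intro log_mono; linarith)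
  moreover have "log 2 (4::real) = 2" using log_pow_cancel[of "2::real" 2] by simp
  ultimately show "hoelder_exponent \<le> 1" by (simp add: hoelder_exponent_def)
  have "2 + 1 / theta > 0" using t by linarith
  then show "2 powr (1 + hoelder_exponent) = 2 + 1 / theta"
    by (simp add: hoelder_exponent_def)
qed

text \<open>The Bregman distance from \<open>x\<close> to \<open>x + 2 *\<^sub>R z\<close> is at
  least twice that to \<open>x + z\<close> plus the reverse distance from \<open>x + z\<close> back
  to \<open>x\<close>; by quasi-symmetry the reverse distance contributes another
  \<open>1 / theta\<close> times the distance to \<open>x + z\<close>. Each halving of the
  displacement thus gains the factor \<open>2 + 1 / theta\<close>, and iterating down from the scale
  \<rho> gives the power.\<close>

lemma bregman_le_powr:
  assumes K: "compact K" "K \<subseteq> interior X"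
  obtains \<rho> C where "\<rho> > 0" "C \<ge> 0"
    "\<And>x v z. x \<in> K \<Longrightarrow> v \<in> subdifferential u x \<Longrightarrow> z \<noteq> 0 \<Longrightarrow> norm z < \<rho>
      \<Longrightarrow> bregman u v x (x + z) \<le> C * norm z powr (1 + hoelder_exponent)"
proof -
  obtain e where e: "e > 0" "(\<Union>x\<in>K. ball x e) \<subseteq> interior X"
    using compact_subset_open_imp_ball_epsilon_subset[OF K(1) open_interior K(2)] by blast
  \<comment> \<open>\<open>x + z\<close> can leave \<open>K\<close>, so quasi-symmetry is applied on
    a compact neighbourhood of it.\<close>
  define K' where "K' = (\<Union>x\<in>K. \<Union>z\<in>cball 0 (e / 2). {x + z})"
  have "compact K'" unfolding K'_def using compact_sums'[OF K(1) compact_cball[of 0 "e / 2"]] by simp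
  moreover have "K' \<subseteq> interior X"
  proof
    fix y assume "y \<in> K'"
    then obtain x z where "x \<in> K" "norm z \<le> e / 2" "y = x + z" by (auto simp: K'_def)
    then have "y \<in> ball x e" using e(1) by (simp add: dist_norm)
    then show "y \<in> interior X" using e(2) \<open>x \<in> K\<close> by blast
  qed
  ultimately obtain \<rho>' where \<rho>': "\<rho>' > 0"
    "\<And>x y v w. x \<in> K' \<Longrightarrow> y \<in> K' \<Longrightarrow> v \<in> subdifferential u x \<Longrightarrow> w \<in> subdifferential u y \<Longrightarrow> dist x y < \<rho>'
      \<Longrightarrow> bregman u w y x \<le> theta * bregman u v x y"
    using bregman_quasi_symmetric by metis
  define \<rho> where "\<rho> = min \<rho>' (e / 2)"
  have \<rho>: "\<rho> > 0" using \<rho>' e by (simp add: \<rho>_def)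
  define \<Lambda> where "\<Lambda> = 2 + 1 / theta"
  have \<Lambda>: "\<Lambda> > 0" using theta_ge_1 by (simp add: \<Lambda>_def add_pos_nonneg)
  have half: "bregman u v x (x + z) * \<Lambda> \<le> bregman u v x (x + 2 *\<^sub>R z)"
    if x: "x \<in> K" and v: "v \<in> subdifferential u x" and z: "norm z < \<rho>" for x v z
  proof -
    obtain w where w: "w \<in> subdifferential u (x + z)" using subdifferential_nonempty[OF convex] .
    have "x = x + 0" "(0::'a) \<in> cball 0 (e / 2)" using e by auto
    then have "x \<in> K'" unfolding K'_def using x by blast
    moreover have "x + z \<in> K'" unfolding K'_def using x z by (force simp: \<rho>_def)
    ultimately have "bregman u v x (x + z) \<le> theta * bregman u w (x + z) x"
      using z by (intro \<rho>'(2)[OF _ _ w v]) (auto simp: \<rho>_def dist_norm)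
    then have "bregman u v x (x + z) / theta \<le> bregman u w (x + z) x"
      using theta_ge_1 by (simp add: divide_le_eq mult.commute)
    moreover have "bregman u v x (x + z) + bregman u w (x + z) x = (w - v) \<bullet> z"
      using bregman_add[of u v x "x + z" w] by simp
    moreover have "u (x + z) + w \<bullet> z \<le> u (x + 2 *\<^sub>R z)"
      using subdifferentialD[OF w, of "x + 2 *\<^sub>R z"] by (simp add: scaleR_2)
    moreover have "bregman u v x (x + z) * \<Lambda> = 2 * bregman u v x (x + z) + bregman u v x (x + z) / theta"
      by (simp add: \<Lambda>_def algebra_simps)
    moreover have "bregman u v x (x + 2 *\<^sub>R z) = u (x + 2 *\<^sub>R z) - u x - 2 * (v \<bullet> z)"
      "bregman u v x (x + z) = u (x + z) - u x - v \<bullet> z" "(w - v) \<bullet> z = w \<bullet> z - v \<bullet> z"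
      by (simp_all add: bregman_def inner_diff_left)
    ultimately show ?thesis by linarith
  qed
  have L0: "L \<ge> 0"
    using bounded_subgradient subdifferential_nonempty[OF convex, of undefined] norm_ge_zero order_trans by metis
  define \<gamma> where "\<gamma> = 1 + hoelder_exponent"
  \<comment> \<open>Makes the bound true on the top scale
    \<open>\<rho> / 2 \<le> norm z < \<rho>\<close>, from the Lipschitz estimate
    \<open>2 * L * norm z\<close>.\<close>
  define C where "C = 2 * L * \<rho> * (2 / \<rho>) powr \<gamma>"
  have C0: "C \<ge> 0" using L0 \<rho> by (simp add: C_def)
  have main: "\<forall>z. \<rho> / 2 ^ Suc n \<le> norm z \<longrightarrow> norm z < \<rho> \<longrightarrow> bregman u v x (x + z) \<le> C * norm z powr \<gamma>"
    if x: "x \<in> K" and v: "v \<in> subdifferential u x" for x v n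
  proof (induction n)
    case 0
    show ?case
    proof (intro allI impI)
      fix z :: 'a assume z: "\<rho> / 2 ^ Suc 0 \<le> norm z" "norm z < \<rho>"
      have "L-lipschitz_on UNIV u" using convex bounded_subgradient by (rule lipschitz_of_bounded_subdifferential)
      then have "\<bar>u (x + z) - u x\<bar> \<le> L * norm z"
        using lipschitz_onD[of L UNIV u "x + z" x] by (simp add: dist_real_def dist_norm)
      moreover have "\<bar>v \<bullet> z\<bar> \<le> L * norm z"
        using Cauchy_Schwarz_ineq2[of v z] mult_right_mono[OF bounded_subgradient[OF v], of "norm z"] by simp
      ultimately have "bregman u v x (x + z) \<le> 2 * L * norm z" by (simp add: bregman_def)
      also have "\<dots> \<le> 2 * L * \<rho> * 1" using z L0 by (simp add: mult_left_mono)
      also have "1 \<le> ((2 / \<rho>) * norm z) powr \<gamma>"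
        using z \<rho> hoelder_exponent by (intro ge_one_powr_ge_zero) (auto simp: \<gamma>_def field_simps)
      then have "2 * L * \<rho> * 1 \<le> 2 * L * \<rho> * ((2 / \<rho>) * norm z) powr \<gamma>"
        using L0 \<rho> by (intro mult_left_mono) auto
      also have "\<dots> = C * norm z powr \<gamma>" using \<rho> by (subst powr_mult) (auto simp: C_def)
      finally show "bregman u v x (x + z) \<le> C * norm z powr \<gamma>" .
    qed
  next
    case (Suc n)
    show ?case
    proof (intro allI impI)
      fix z :: 'a assume z: "\<rho> / 2 ^ Suc (Suc n) \<le> norm z" "norm z < \<rho>"
      show "bregman u v x (x + z) \<le> C * norm z powr \<gamma>"
      proof (cases "\<rho> / 2 ^ Suc n \<le> norm z")
        case False
        have "\<rho> / 2 ^ Suc n \<le> \<rho> / 2 ^ 1" using \<rho> by (intro divide_left_mono power_increasing) auto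
        then have z2: "norm (2 *\<^sub>R z) < \<rho>" using False by simp
        have "bregman u v x (x + z) * \<Lambda> \<le> bregman u v x (x + 2 *\<^sub>R z)" by (rule half[OF x v z(2)])
        also have "\<dots> \<le> C * norm (2 *\<^sub>R z) powr \<gamma>"
        proof -
          have "\<rho> / 2 ^ Suc n \<le> norm (2 *\<^sub>R z)" using z(1) by (simp add: field_simps)
          then show ?thesis using Suc.IH z2 by blast
        qed
        also have "\<dots> = C * norm z powr \<gamma> * \<Lambda>"
          using hoelder_exponent(3) by (simp add: powr_mult \<Lambda>_def \<gamma>_def)
        finally show ?thesis using \<Lambda> by simp
      qed (use Suc z in auto)
    qed
  qed
  show ?thesis
  proof (rule that[OF \<rho> C0])
    fix x v z :: 'a assume x: "x \<in> K" and v: "v \<in> subdifferential u x" and z: "z \<noteq> 0" "norm z < \<rho>"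
    have "(\<lambda>n. \<rho> / 2 ^ Suc n) \<longlonglongrightarrow> 0"
      by (intro LIMSEQ_Suc LIMSEQ_divide_realpow_zero) auto
    then have "eventually (\<lambda>n. \<rho> / 2 ^ Suc n < norm z) sequentially"
      using z(1) by (intro order_tendstoD) auto
    then obtain n where "\<rho> / 2 ^ Suc n < norm z" by (auto simp: eventually_sequentially)
    then show "bregman u v x (x + z) \<le> C * norm z powr (1 + hoelder_exponent)"
      using main[OF x v, of n] z by (simp add: \<gamma>_def)
  qed
qed

text \<open>Going from \<open>y\<close> a distance \<open>s = dist x y\<close> in the direction of
  \<open>w - v\<close> lifts \<open>u\<close> above the supporting plane at \<open>x\<close> by at
  least \<open>s * norm (w - v)\<close>, while the power decay allows at most
  \<open>C * (2 * s) powr (1 + \<alpha>)\<close>.\<close>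

lemma hoelder_subgradient:
  assumes K: "compact K" "K \<subseteq> interior X"
  obtains C where
    "\<And>x y v w. x \<in> K \<Longrightarrow> y \<in> K \<Longrightarrow> v \<in> subdifferential u x \<Longrightarrow> w \<in> subdifferential u y
      \<Longrightarrow> dist v w \<le> C * dist x y powr hoelder_exponent"
proof -
  obtain \<rho> C where \<rho>: "\<rho> > 0" and C: "C \<ge> 0"
    and le: "\<And>x v z. x \<in> K \<Longrightarrow> v \<in> subdifferential u x \<Longrightarrow> z \<noteq> 0 \<Longrightarrow> norm z < \<rho>
      \<Longrightarrow> bregman u v x (x + z) \<le> C * norm z powr (1 + hoelder_exponent)"
    using bregman_le_powr[OF K] by metis
  define \<alpha> where "\<alpha> = hoelder_exponent"
  have \<alpha>: "\<alpha> > 0" using hoelder_exponent by (simp add: \<alpha>_def)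
  have L0: "L \<ge> 0"
    using bounded_subgradient subdifferential_nonempty[OF convex, of undefined] norm_ge_zero order_trans by metis
  have step: "(w - v) \<bullet> h \<le> C * norm (y - x + h) powr (1 + \<alpha>)"
    if "x \<in> K" "v \<in> subdifferential u x" "w \<in> subdifferential u y" "norm (y - x + h) < \<rho>" for x y v w h
  proof -
    have "u y + w \<bullet> h \<le> u (y + h)" using subdifferentialD[OF that(3), of "y + h"] by simp
    moreover have "u x + v \<bullet> (y - x) \<le> u y" by (rule subdifferentialD[OF that(2)])
    moreover have "bregman u v x (x + (y - x + h)) \<le> C * norm (y - x + h) powr (1 + \<alpha>)"
    proof (cases "y - x + h = 0")
      case True
      then show ?thesis by (simp add: bregman_def)
    qed (use le[OF that(1,2) _ that(4)] \<alpha>_def in auto)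
    ultimately show ?thesis by (simp add: bregman_def inner_diff_left inner_diff_right inner_add_right)
  qed
  define C' where "C' = max (C * 2 powr (1 + \<alpha>)) (2 * L / (\<rho> / 2) powr \<alpha>)"
  show ?thesis
  proof (rule that)
    fix x y v w
    assume x: "x \<in> K" and y: "y \<in> K" and v: "v \<in> subdifferential u x" and w: "w \<in> subdifferential u y"
    define s where "s = dist x y"
    show "dist v w \<le> C' * dist x y powr hoelder_exponent"
    proof (cases "v = w")
      case True
      have "C' \<ge> 0" using C by (simp add: C'_def le_max_iff_disj)
      then show ?thesis using True by simp
    next
      case False
      define e where "e = (1 / norm (w - v)) *\<^sub>R (w - v)"
      have e: "norm e = 1" using False by (simp add: e_def)
      have we: "(w - v) \<bullet> (t *\<^sub>R e) = t * norm (w - v)" for t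
        using False by (simp add: e_def dot_square_norm power2_eq_square)
      have "s \<ge> 0" by (simp add: s_def)
      then consider "s \<ge> \<rho> / 2" | "0 < s" "s < \<rho> / 2" | "s = 0" by linarith
      then show ?thesis
      proof cases
        case 1
        have "dist v w \<le> 2 * L"
          using bounded_subgradient[OF v] bounded_subgradient[OF w] norm_triangle_ineq4[of v w] by (simp add: dist_norm)
        also have "\<dots> = 2 * L / (\<rho> / 2) powr \<alpha> * (\<rho> / 2) powr \<alpha>" using \<rho> by simp
        also have "\<dots> \<le> 2 * L / (\<rho> / 2) powr \<alpha> * s powr \<alpha>"
          using 1 \<rho> \<alpha> L0 by (intro mult_left_mono powr_mono2) auto
        also have "\<dots> \<le> C' * s powr \<alpha>" by (intro mult_right_mono) (auto simp: C'_def)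
        finally show ?thesis by (simp add: s_def \<alpha>_def)
      next
        case 2
        have n: "norm (y - x + s *\<^sub>R e) \<le> 2 * s"
          using norm_triangle_ineq[of "y - x" "s *\<^sub>R e"] e 2 by (simp add: s_def dist_norm norm_minus_commute)
        then have "s * norm (w - v) \<le> C * norm (y - x + s *\<^sub>R e) powr (1 + \<alpha>)"
          using step[OF x v w, of "s *\<^sub>R e"] 2 we[of s] by simp
        also have "\<dots> \<le> C * (2 * s) powr (1 + \<alpha>)" using n C \<alpha> by (intro mult_left_mono powr_mono2) auto
        also have "\<dots> = s * (C * 2 powr (1 + \<alpha>) * s powr \<alpha>)" using 2 by (simp add: powr_mult powr_add)
        finally have "norm (w - v) \<le> C * 2 powr (1 + \<alpha>) * s powr \<alpha>" using 2 by simp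
        also have "\<dots> \<le> C' * s powr \<alpha>" by (intro mult_right_mono) (auto simp: C'_def)
        finally show ?thesis by (simp add: s_def \<alpha>_def dist_norm norm_minus_commute)
      next
        case 3
        then have "y = x" by (simp add: s_def)
        \<comment> \<open>For two subgradients at one point the same estimate holds with an
          arbitrary small step \<open>t\<close> in place of \<open>s\<close>; let \<open>t\<close>
          tend to 0.\<close>
        have "norm (w - v) \<le> 0"
        proof (rule tendsto_lowerbound)
          show "((\<lambda>t. C * t powr \<alpha>) \<longlongrightarrow> 0) (at_right 0)"
          proof -
            have "((\<lambda>t. C * t powr \<alpha>) \<longlongrightarrow> C * 0 powr \<alpha>) (at_right 0)"
              using \<alpha> by (intro tendsto_intros tendsto_powr') (auto simp: eventually_at_filter)
            then show ?thesis by simp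
          qed
          show "eventually (\<lambda>t. norm (w - v) \<le> C * t powr \<alpha>) (at_right 0)"
            using eventually_at_right_less[of "0::real"] eventually_at_right_real[OF \<rho>]
          proof eventually_elim
            case (elim t)
            then have "t * norm (w - v) \<le> C * t powr (1 + \<alpha>)"
              using step[OF x v w, of "t *\<^sub>R e"] e we[of t] \<open>y = x\<close> by simp
            also have "\<dots> = t * (C * t powr \<alpha>)" using elim by (simp add: powr_add)
            finally show ?case using elim by simp
          qed
        qed simp
        then show ?thesis using False by simp
      qed
    qed
  qed
qed

lemma subdifferential_singleton_interior:
  assumes "x \<in> interior X" "v \<in> subdifferential u x" "w \<in> subdifferential u x"
  shows "v = w"
  using hoelder_subgradient[of "{x}"] assms by (metis compact_sing dist_le_zero_iff dist_self empty_subsetI insert_subset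
      mult_zero_right powr_zero_eq_one powr_0 singletonI)

end


section \<open>Compactness and duality\<close>

text \<open>Arzela-Ascoli: a diagonal subsequence converges on a countable dense set, and the common
  Lipschitz constant upgrades this to pointwise and then locally uniform convergence.\<close>

lemma lipschitz_subsequence:
  fixes f :: "nat \<Rightarrow> 'a::euclidean_space \<Rightarrow> real"
  assumes L: "\<And>n. L-lipschitz_on UNIV (f n)" and B: "\<And>n. \<bar>f n x0\<bar> \<le> B"
  obtains r g where "strict_mono (r :: nat \<Rightarrow> nat)" "L-lipschitz_on UNIV g"
    "\<And>K. compact K \<Longrightarrow> uniform_limit K (\<lambda>n. f (r n)) g sequentially"
proof -
  have L0: "L \<ge> 0" using L lipschitz_on_nonneg by blast
  have B0: "B \<ge> 0" using B[of 0] by linarith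
  have dl: "\<bar>f n x - f n y\<bar> \<le> L * dist x y" for n x y
    using lipschitz_onD[OF L, of x y n] by (simp add: dist_real_def)
  \<comment> \<open>Dividing by this linearly growing weight bounds all functions by 1 everywhere,
    as the diagonal argument asks.\<close>
  define w where "w x = 1 + B + L * dist x x0" for x
  have w: "w x > 0" for x using L0 B0 by (simp add: w_def add_pos_nonneg)
  obtain D :: "'a set" where D: "countable D" "\<And>U. open U \<Longrightarrow> U \<noteq> {} \<Longrightarrow> \<exists>d\<in>D. d \<in> U"
    using countable_dense_exists[where 'a = 'a] by blast
  have nb: "norm (f n x / w x) \<le> 1" for n x
    using dl[of n x x0] B[of n] w[of x] by (simp add: w_def)
  obtain r where r: "strict_mono (r :: nat \<Rightarrow> nat)" and lim: "\<And>x. x \<in> D \<Longrightarrow> \<exists>l. (\<lambda>n. f (r n) x / w x) \<longlonglongrightarrow> l"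
    using function_convergent_subsequence[OF D(1), of "\<lambda>n x. f n x / w x" 1] nb by blast
  have lim': "Cauchy (\<lambda>n. f (r n) x)" if x: "x \<in> D" for x
  proof -
    obtain l where "(\<lambda>n. f (r n) x / w x) \<longlonglongrightarrow> l" using lim[OF x] by blast
    then have "(\<lambda>n. f (r n) x / w x * w x) \<longlonglongrightarrow> l * w x" by (intro tendsto_intros)
    then show ?thesis using w[of x] by (auto intro: LIMSEQ_imp_Cauchy)
  qed
  have near: "\<exists>d\<in>D. dist x d < e" if "e > 0" for x and e :: real
    using D(2)[of "ball x e"] that by auto
  have "Cauchy (\<lambda>n. f (r n) x)" for x
  proof (rule metric_CauchyI)
    fix e :: real assume e: "e > 0"
    obtain d where d: "d \<in> D" "dist x d < e / (3 * (L + 1))" using near[of "e / (3 * (L + 1))" x] e L0 by auto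
    have "(L + 1) * dist x d < e / 3" using d(2) L0 by (simp add: field_simps)
    moreover have "(L + 1) * dist x d = L * dist x d + dist x d" by (simp add: algebra_simps)
    ultimately have s: "L * dist x d < e / 3" using zero_le_dist[of x d] by linarith
    obtain N where N: "\<And>m n. m \<ge> N \<Longrightarrow> n \<ge> N \<Longrightarrow> dist (f (r m) d) (f (r n) d) < e / 3"
      using metric_CauchyD[OF lim'[OF d(1)], of "e / 3"] e by auto
    have "dist (f (r m) x) (f (r n) x) < e" if "m \<ge> N" "n \<ge> N" for m n
      using N[OF that] dl[of "r m" x d] dl[of "r n" x d] s unfolding dist_real_def by linarith
    then show "\<exists>M. \<forall>m\<ge>M. \<forall>n\<ge>M. dist (f (r m) x) (f (r n) x) < e" by blast
  qed
  then have "\<exists>l. (\<lambda>n. f (r n) x) \<longlonglongrightarrow> l" for x by (simp add: Cauchy_convergent convergentD)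
  then obtain g where g: "\<And>x. (\<lambda>n. f (r n) x) \<longlonglongrightarrow> g x" by metis
  have gl: "\<bar>g x - g y\<bar> \<le> L * dist x y" for x y
  proof (rule LIMSEQ_le_const2)
    show "(\<lambda>n. \<bar>f (r n) x - f (r n) y\<bar>) \<longlonglongrightarrow> \<bar>g x - g y\<bar>" by (intro tendsto_intros g)
  qed (use dl in auto)
  have "L-lipschitz_on UNIV g" using gl L0 by (intro lipschitz_onI) (auto simp: dist_real_def)
  moreover have "uniform_limit K (\<lambda>n. f (r n)) g sequentially" if K: "compact K" for K
  proof (rule uniform_limitI)
    fix e :: real assume e: "e > 0"
    define \<delta> where "\<delta> = e / (3 * (L + 1))"
    have \<delta>: "\<delta> > 0" using e L0 by (simp add: \<delta>_def)
    obtain C where C: "finite C" "K \<subseteq> (\<Union>x\<in>C. ball x \<delta>)"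
    proof -
      have "K \<subseteq> \<Union> ((\<lambda>x. ball x \<delta>) ` K)" using \<delta> by auto
      then obtain C where "C \<subseteq> K" "finite C" "K \<subseteq> \<Union> ((\<lambda>x. ball x \<delta>) ` C)"
        using compactE_image[OF K, of K "\<lambda>x. ball x \<delta>"] by auto
      then show ?thesis by (intro that) auto
    qed
    have "\<forall>c\<in>C. eventually (\<lambda>n. dist (f (r n) c) (g c) < e / 3) sequentially"
      using e by (intro ballI tendstoD g) simp
    then have "eventually (\<lambda>n. \<forall>c\<in>C. dist (f (r n) c) (g c) < e / 3) sequentially"
      using C(1) by (simp add: eventually_ball_finite)
    then show "eventually (\<lambda>n. \<forall>x\<in>K. dist (f (r n) x) (g x) < e) sequentially"
    proof eventually_elim
      case (elim n)
      show ?case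
      proof
        fix x assume "x \<in> K"
        then obtain c where c: "c \<in> C" "dist c x < \<delta>" using C(2) by auto
        have "(L + 1) * dist x c < e / 3" using c(2) L0 by (simp add: \<delta>_def field_simps dist_commute)
        moreover have "(L + 1) * dist x c = L * dist x c + dist x c" by (simp add: algebra_simps)
        ultimately have "L * dist x c < e / 3" using zero_le_dist[of x c] by linarith
        moreover have "\<bar>f (r n) c - g c\<bar> < e / 3" using elim c(1) by (simp add: dist_real_def)
        ultimately show "dist (f (r n) x) (g x) < e"
          using dl[of "r n" x c] gl[of x c] unfolding dist_real_def by linarith
      qed
    qed
  qed
  ultimately show ?thesis using r that by blast
qed

text \<open>Closed sets are stable under intersection and generate the Borel sets; the indicator of
  a nonempty one is a limit of cut-off functions of the distance to it.\<close>

lemma finite_borel_measure_eqI: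
  fixes M N :: "'a::euclidean_space measure"
  assumes M: "finite_measure M" "sets M = sets borel" and N: "finite_measure N" "sets N = sets borel"
    and eq: "\<And>g :: 'a \<Rightarrow> real. continuous_on UNIV g \<Longrightarrow> (\<And>x. \<bar>g x\<bar> \<le> 1) \<Longrightarrow> (\<integral>x. g x \<partial>M) = (\<integral>x. g x \<partial>N)"
  shows "M = N"
proof (rule measure_eqI_generator_eq)
  show "Int_stable (Collect closed :: 'a set set)" by (auto simp: Int_stable_def)
  show "(Collect closed :: 'a set set) \<subseteq> Pow UNIV" by auto
  show "sets M = sigma_sets UNIV (Collect closed)" "sets N = sigma_sets UNIV (Collect closed)"
    unfolding M(2) N(2) borel_eq_closed by (simp_all add: sets_measure_of)
  show "range (\<lambda>_::nat. UNIV :: 'a set) \<subseteq> Collect closed" "(\<Union>_::nat. UNIV :: 'a set) = UNIV" by auto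
  show "emeasure M UNIV \<noteq> \<infinity>"
    using finite_measure.emeasure_finite[OF M(1)] by simp
  fix A :: "'a set" assume "A \<in> Collect closed"
  then have A: "closed A" by simp
  show "emeasure M A = emeasure N A"
  proof (cases "A = {}")
    case False
    define g where "g n x = max 0 (1 - real n * infdist x A)" for n :: nat and x
    have cg: "continuous_on UNIV (g n)" for n unfolding g_def by (intro continuous_intros)
    have g1: "\<bar>g n x\<bar> \<le> 1" for n x using infdist_nonneg[of x A] by (simp add: g_def)
    have lim: "(\<lambda>n. g n x) \<longlonglongrightarrow> indicator A x" for x
    proof (cases "x \<in> A")
      case True
      then show ?thesis by (simp add: g_def)
    next
      case nA: False
      have pos: "infdist x A > 0" using A False nA infdist_nonneg[of x A] in_closed_iff_infdist_zero[of A x] by simp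
      obtain N0 where N0: "real N0 * infdist x A > 1" using reals_Archimedean3[OF pos] by blast
      have "g n x = 0" if "n \<ge> N0" for n
      proof -
        have "real N0 * infdist x A \<le> real n * infdist x A" using that pos by (intro mult_right_mono) auto
        then show ?thesis using N0 by (simp add: g_def)
      qed
      then have "eventually (\<lambda>n. g n x = 0) sequentially" by (auto simp: eventually_sequentially)
      then show ?thesis using nA by (simp add: tendsto_eventually)
    qed
    have meas: "(\<lambda>n. \<integral>x. g n x \<partial>Q) \<longlonglongrightarrow> measure Q A" if Q: "finite_measure Q" "sets Q = sets borel" for Q :: "'a measure"
    proof -
      have "(\<lambda>n. \<integral>x. g n x \<partial>Q) \<longlonglongrightarrow> (\<integral>x. indicator A x \<partial>Q)"
      proof (rule integral_dominated_convergence[where w = "\<lambda>_. 1"])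
        show "indicator A \<in> borel_measurable Q" "\<And>n. g n \<in> borel_measurable Q"
          using A borel_measurable_continuous_onI[OF cg] by (auto simp: measurable_cong_sets[OF Q(2) refl])
        show "integrable Q (\<lambda>_. 1::real)" using Q(1) by (simp add: finite_measure.emeasure_finite finite_measure.integrable_const)
      qed (use lim g1 in auto)
      moreover have "(\<integral>x. indicator A x \<partial>Q) = measure Q A"
        using A Q sets_eq_imp_space_eq[OF Q(2)] by simp
      ultimately show ?thesis by simp
    qed
    have "measure M A = measure N A"
      using meas[OF M] meas[OF N] eq[OF cg g1] LIMSEQ_unique by simp
    then show ?thesis
      using M(1) N(1) by (simp add: finite_measure.emeasure_eq_measure)
  qed simp
qed

section \<open>Kantorovich duality between \<mu> and the uniform measure on \<open>P\<close>\<close>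

lemma legendre_cong: "(\<And>x. x \<in> A \<Longrightarrow> f x = g x) \<Longrightarrow> legendre A f p = legendre A g p"
  unfolding legendre_def by (intro arg_cong[where f = Sup] image_cong) auto

text \<open>Absolute continuity of \<mu> enters as transfer of almost everywhere properties; the
  density bounds join in \<open>brenier_density\<close>, where interior regularity is
  derived.\<close>

locale transport_problem =
  fixes P X :: "'a::euclidean_space set" and \<mu> :: "'a measure"
  assumes P: "convex P" "compact P" "interior P \<noteq> {}" and vol: "emeasure lborel P = 1"
    and X: "compact X" and prob: "prob_space \<mu>" and sets_\<mu> [measurable_cong]: "sets \<mu> = sets borel"
    and AE_X: "AE x in \<mu>. x \<in> X" and ac: "\<And>Q. AE x in lborel. Q x \<Longrightarrow> AE x in \<mu>. Q x"
begin

abbreviation lam :: "'a measure" where "lam \<equiv> density lborel (indicator P)"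

lemma P_borel [measurable]: "P \<in> sets borel" using P by (simp add: borel_compact)
lemma X_borel [measurable]: "X \<in> sets borel" using X by (simp add: borel_compact)

sublocale mu: prob_space \<mu> by (rule prob)

lemma space_mu [simp]: "space \<mu> = UNIV" using sets_eq_imp_space_eq[OF sets_\<mu>] by simp

sublocale lam: prob_space lam
proof
  show "emeasure lam (space lam) = 1" by (simp add: emeasure_density vol)
qed

lemma mu_UNIV [simp]: "measure \<mu> UNIV = 1" using mu.prob_space by simp
lemma lam_UNIV [simp]: "measure lam UNIV = 1" using lam.prob_space by simp

lemma AE_lam: "(AE p in lam. Q p) \<longleftrightarrow> (AE p in lborel. p \<in> P \<longrightarrow> Q p)"
  by (subst AE_density) (auto simp: indicator_def)

lemma AE_lam_P: "AE p in lam. p \<in> P" by (simp add: AE_lam)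

lemma AE_lamI: "AE p in lborel. Q p \<Longrightarrow> AE p in lam. Q p"
  unfolding AE_lam by (rule AE_mp) auto

lemma emeasure_lam: "E \<in> sets borel \<Longrightarrow> emeasure lam E = emeasure lborel (E \<inter> P)"
  by (subst emeasure_density) (auto simp: indicator_inter_arith[symmetric] Int_commute)

lemma P_ne: "P \<noteq> {}" using P(3) interior_subset by blast

lemma X_ne: "X \<noteq> {}"
proof
  assume "X = {}"
  then have "AE x in \<mu>. False" using AE_X by simp
  then show False by (simp add: mu.AE_const)
qed

lemma P_dense: "P \<subseteq> closure (interior P)"
  using convex_closure_interior[OF P(1,3)] closure_subset by blast

definition L :: real where "L = (SOME L. L > 0 \<and> (\<forall>p\<in>P. norm p \<le> L))"
definition R :: real where "R = (SOME R. R > 0 \<and> (\<forall>x\<in>X. norm x \<le> R))"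

lemma L: "L > 0" "p \<in> P \<Longrightarrow> norm p \<le> L"
proof -
  have "\<exists>L. L > 0 \<and> (\<forall>p\<in>P. norm p \<le> L)" using compact_imp_bounded[OF P(2)] by (simp add: bounded_pos)
  from someI_ex[OF this] show "L > 0" "p \<in> P \<Longrightarrow> norm p \<le> L" by (auto simp: L_def)
qed

lemma R: "R > 0" "x \<in> X \<Longrightarrow> norm x \<le> R"
proof -
  have "\<exists>R. R > 0 \<and> (\<forall>x\<in>X. norm x \<le> R)" using compact_imp_bounded[OF X] by (simp add: bounded_pos)
  from someI_ex[OF this] show "R > 0" "x \<in> X \<Longrightarrow> norm x \<le> R" by (auto simp: R_def)
qed

lemma inner_bound: "x \<in> X \<Longrightarrow> p \<in> P \<Longrightarrow> \<bar>x \<bullet> p\<bar> \<le> R * L"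
  using Cauchy_Schwarz_ineq2[of x p] mult_mono[OF R(2) L(2), of x p] R(1) by simp

lemma bounded_on_compact:
  fixes f :: "'a \<Rightarrow> real"
  assumes "continuous_on UNIV f" "compact K"
  obtains B where "B \<ge> 0" "\<And>x. x \<in> K \<Longrightarrow> \<bar>f x\<bar> \<le> B"
proof -
  have "compact (f ` K)" using assms by (meson compact_continuous_image continuous_on_subset subset_UNIV)
  then obtain B where "B > 0" "\<And>x. x \<in> K \<Longrightarrow> \<bar>f x\<bar> \<le> B"
    using compact_imp_bounded bounded_pos by (metis image_eqI real_norm_def)
  then show ?thesis using that[of B] by simp
qed

lemma integrable_mu:
  fixes f :: "'a \<Rightarrow> real"
  assumes "continuous_on UNIV f"
  shows "integrable \<mu> f"
proof -
  obtain B where B: "\<And>x. x \<in> X \<Longrightarrow> \<bar>f x\<bar> \<le> B" using bounded_on_compact[OF assms X] by blast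
  show ?thesis
  proof (rule mu.integrable_const_bound)
    show "AE x in \<mu>. norm (f x) \<le> B" using AE_X by eventually_elim (use B in auto)
    show "f \<in> borel_measurable \<mu>" using borel_measurable_continuous_onI[OF assms] by measurable
  qed
qed

lemma integrable_lam:
  fixes f :: "'a \<Rightarrow> real"
  assumes "continuous_on UNIV f"
  shows "integrable lam f"
proof -
  obtain B where B: "\<And>x. x \<in> P \<Longrightarrow> \<bar>f x\<bar> \<le> B" using bounded_on_compact[OF assms P(2)] by blast
  show ?thesis
  proof (rule lam.integrable_const_bound)
    show "AE x in lam. norm (f x) \<le> B" using AE_lam_P by eventually_elim (use B in auto)
    show "f \<in> borel_measurable lam" using borel_measurable_continuous_onI[OF assms] by measurable
  qed
qed

lemma legendre_X: "continuous_on UNIV f \<Longrightarrow> compact_legendre X f"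
  by (intro compact_legendre.intro X X_ne) (auto intro: continuous_on_subset)

lemma legendre_P: "continuous_on UNIV f \<Longrightarrow> compact_legendre P f"
  by (intro compact_legendre.intro P P_ne) (auto intro: continuous_on_subset)

lemma cont_legendre_X: "continuous_on UNIV f \<Longrightarrow> continuous_on UNIV (legendre X f)"
  by (rule convex_on_UNIV_continuous[OF compact_legendre.convex[OF legendre_X]])

lemma cont_legendre_P: "continuous_on UNIV f \<Longrightarrow> continuous_on UNIV (legendre P f)"
  by (rule convex_on_UNIV_continuous[OF compact_legendre.convex[OF legendre_P]])

text \<open>Kantorovich's dual functional, with the second potential replaced by its best choice for
  the first.\<close>

definition J :: "('a \<Rightarrow> real) \<Rightarrow> real" where
  "J f = (\<integral>x. f x \<partial>\<mu>) + (\<integral>p. legendre X f p \<partial>lam)"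

lemma J_mono:
  assumes f: "continuous_on UNIV f" and g: "continuous_on UNIV g"
    and fg: "\<And>x. x \<in> X \<Longrightarrow> f x \<le> g x + c" and l: "\<And>p. p \<in> P \<Longrightarrow> legendre X f p \<le> legendre X g p + d"
  shows "J f \<le> J g + c + d"
proof -
  have "(\<integral>x. f x \<partial>\<mu>) \<le> (\<integral>x. g x + c \<partial>\<mu>)"
    using AE_X by (intro integral_mono_AE integrable_mu f Bochner_Integration.integrable_add g) (auto simp: fg elim: eventually_mono)
  moreover have "(\<integral>p. legendre X f p \<partial>lam) \<le> (\<integral>p. legendre X g p + d \<partial>lam)"
    using AE_lam_P by (intro integral_mono_AE integrable_lam cont_legendre_X f g Bochner_Integration.integrable_add)
      (auto simp: l elim: eventually_mono)
  ultimately show ?thesis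
    using f g by (simp add: J_def integrable_mu integrable_lam cont_legendre_X mu_UNIV lam_UNIV)
qed

lemma legendre_X_le:
  assumes f: "continuous_on UNIV f" and g: "continuous_on UNIV g" and fg: "\<And>x. x \<in> X \<Longrightarrow> g x \<le> f x + c"
  shows "legendre X f p \<le> legendre X g p + c"
proof -
  have "x \<bullet> p - f x \<le> legendre X g p + c" if "x \<in> X" for x
    using compact_legendre.ge[OF legendre_X[OF g] that, of p] fg[OF that] by linarith
  then show ?thesis by (simp add: compact_legendre.le_iff[OF legendre_X[OF f]])
qed

text \<open>Integrate \<open>x \<bullet> p \<le> f x + legendre X f p\<close> over \<mu> and then
  over \<open>lam\<close>, that is, test with the independent coupling.\<close>

lemma J_lower: assumes f: "continuous_on UNIV f" shows "J f \<ge> - (R * L)"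
proof -
  have "- (R * L) \<le> (\<integral>x. f x \<partial>\<mu>) + legendre X f p" if p: "p \<in> P" for p
  proof -
    have "(\<integral>x. - (R * L) \<partial>\<mu>) \<le> (\<integral>x. f x + legendre X f p \<partial>\<mu>)"
    proof (rule integral_mono_AE)
      show "AE x in \<mu>. - (R * L) \<le> f x + legendre X f p"
        using AE_X
      proof eventually_elim
        case (elim x)
        then show ?case using compact_legendre.ge[OF legendre_X[OF f] elim, of p] inner_bound[OF elim p] by linarith
      qed
    qed (use integrable_mu[OF f] in auto)
    then show ?thesis using integrable_mu[OF f] by simp
  qed
  then have "(\<integral>p. - (R * L) \<partial>lam) \<le> (\<integral>p. (\<integral>x. f x \<partial>\<mu>) + legendre X f p \<partial>lam)"
    using AE_lam_P integrable_lam[OF cont_legendre_X[OF f]] by (intro integral_mono_AE) (auto elim: eventually_mono)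
  then show ?thesis
    using integrable_lam[OF cont_legendre_X[OF f]] by (simp add: J_def)
qed

lemma legendre_shift:
  assumes "continuous_on UNIV f"
  shows "legendre X (\<lambda>x. f x + c) p = legendre X f p - c" "legendre P (\<lambda>x. f x + c) p = legendre P f p - c"
proof -
  have c: "continuous_on UNIV (\<lambda>x. f x + c)" by (intro continuous_intros assms)
  have *: "legendre A (\<lambda>x. f x + c) p = legendre A f p - c"
    if "compact_legendre A f" "compact_legendre A (\<lambda>x. f x + c)" for A
  proof (rule antisym)
    show "legendre A (\<lambda>x. f x + c) p \<le> legendre A f p - c"
      using compact_legendre.ge[OF that(1), of _ p] by (force simp: compact_legendre.le_iff[OF that(2)])
    have "legendre A f p \<le> legendre A (\<lambda>x. f x + c) p + c"
      using compact_legendre.ge[OF that(2), of _ p] by (force simp: compact_legendre.le_iff[OF that(1)])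
    then show "legendre A f p - c \<le> legendre A (\<lambda>x. f x + c) p" by simp
  qed
  show "legendre X (\<lambda>x. f x + c) p = legendre X f p - c" by (intro * legendre_X assms c)
  show "legendre P (\<lambda>x. f x + c) p = legendre P f p - c" by (intro * legendre_P assms c)
qed

lemma J_shift: "continuous_on UNIV f \<Longrightarrow> J (\<lambda>x. f x + c) = J f"
  by (simp add: J_def legendre_shift integrable_mu integrable_lam cont_legendre_X mu_UNIV lam_UNIV)

text \<open>The biconjugate, with the outer transform over \<open>P\<close>. Whatever continuous
  \<open>f\<close> is, the result is convex and \<open>L\<close>-Lipschitz, and it does not increase
  \<open>J\<close>; compactness of minimising sequences comes from here.\<close>

definition bi :: "('a \<Rightarrow> real) \<Rightarrow> 'a \<Rightarrow> real" where "bi f = legendre P (legendre X f)"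

lemma cont_bi: "continuous_on UNIV f \<Longrightarrow> continuous_on UNIV (bi f)"
  unfolding bi_def by (intro cont_legendre_P cont_legendre_X)

lemma bi_le: assumes f: "continuous_on UNIV f" and x: "x \<in> X" shows "bi f x \<le> f x"
  unfolding bi_def compact_legendre.le_iff[OF legendre_P[OF cont_legendre_X[OF f]]]
  using compact_legendre.ge[OF legendre_X[OF f] x] by (auto simp: inner_commute algebra_simps)

lemma legendre_bi: assumes f: "continuous_on UNIV f" and p: "p \<in> P" shows "legendre X (bi f) p = legendre X f p"
proof (rule antisym)
  show "legendre X (bi f) p \<le> legendre X f p"
    unfolding compact_legendre.le_iff[OF legendre_X[OF cont_bi[OF f]]]
    using compact_legendre.ge[OF legendre_P[OF cont_legendre_X[OF f]] p] by (auto simp: bi_def inner_commute algebra_simps)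
  show "legendre X f p \<le> legendre X (bi f) p"
    using legendre_X_le[OF f cont_bi[OF f], of 0] bi_le[OF f] by simp
qed

lemma J_bi: assumes f: "continuous_on UNIV f" shows "J (bi f) \<le> J f"
  using J_mono[OF cont_bi[OF f] f, of 0 0] bi_le[OF f] legendre_bi[OF f] by simp

lemma lipschitz_bi: assumes f: "continuous_on UNIV f" shows "L-lipschitz_on UNIV (bi f)"
  unfolding bi_def by (intro compact_legendre.lipschitz legendre_P cont_legendre_X f L)

lemma lipschitz_cont: "C-lipschitz_on UNIV f \<Longrightarrow> continuous_on UNIV f"
  by (rule lipschitz_on_continuous_on)

text \<open>Both measures have mass 1, so \<open>J\<close> ignores additive constants. Biconjugates
  of a minimising sequence, normalised at 0, are equi-Lipschitz; uniform closeness on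
  \<open>X\<close> passes to the transforms, hence \<open>J\<close> passes to the limit. One more
  biconjugation makes the limit invariant under \<open>bi\<close>, and a shift gives it mean
  0.\<close>

lemma minimizer_exists:
  obtains \<phi> where "continuous_on UNIV \<phi>" "bi \<phi> = \<phi>" "(\<integral>x. \<phi> x \<partial>\<mu>) = 0"
    "\<And>f. continuous_on UNIV f \<Longrightarrow> J \<phi> \<le> J f"
proof -
  define m where "m = (INF f\<in>{f. continuous_on UNIV f}. J f)"
  have bdd: "bdd_below (J ` {f. continuous_on UNIV f})" using J_lower by (intro bdd_belowI2) auto
  have ne: "J ` {f. continuous_on UNIV f} \<noteq> {}" using continuous_on_const by blast
  have m_le: "m \<le> J f" if "continuous_on UNIV f" for f
    unfolding m_def using that by (intro cINF_lower bdd) auto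
  have "\<exists>f. continuous_on UNIV f \<and> J f < m + 1 / real (Suc k)" for k
  proof -
    have "m < m + 1 / real (Suc k)" by simp
    from cInf_lessD[OF ne this[unfolded m_def]] show ?thesis by (auto simp: m_def)
  qed
  then obtain f where f: "\<And>k. continuous_on UNIV (f k)" "\<And>k. J (f k) < m + 1 / real (Suc k)" by metis
  define h where "h k x = bi (f k) x + (- bi (f k) 0)" for k x
  have hJ: "J (h k) < m + 1 / real (Suc k)" for k
    unfolding h_def J_shift[OF cont_bi[OF f(1)]] using J_bi[OF f(1)] f(2) by (meson order_le_less_trans)
  have hL: "L-lipschitz_on UNIV (h k)" for k
    using lipschitz_bi[OF f(1)[of k]] unfolding h_def lipschitz_on_def by (simp add: dist_real_def)
  have h0: "\<bar>h k 0\<bar> \<le> 0" for k by (simp add: h_def)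
  obtain r g where r: "strict_mono (r :: nat \<Rightarrow> nat)" and g: "L-lipschitz_on UNIV g"
    and ul: "\<And>K. compact K \<Longrightarrow> uniform_limit K (\<lambda>n. h (r n)) g sequentially"
    by (rule lipschitz_subsequence[of L h 0 0, OF hL h0]) blast
  have Jg: "J g \<le> m"
  proof (rule field_le_epsilon)
    fix e :: real assume e: "e > 0"
    have "eventually (\<lambda>n. \<forall>x\<in>X. dist (h (r n) x) (g x) < e / 4) sequentially"
      using uniform_limitD[OF ul[OF X], of "e / 4"] e by simp
    moreover have "eventually (\<lambda>n. 1 / real (Suc (r n)) < e / 4) sequentially"
    proof -
      have "(\<lambda>n. 1 / real (Suc n)) \<longlonglongrightarrow> 0" by (intro LIMSEQ_Suc lim_const_over_n)
      then have "(\<lambda>n. 1 / real (Suc (r n))) \<longlonglongrightarrow> 0" using LIMSEQ_subseq_LIMSEQ[OF _ r] by (force simp: o_def)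
      then show ?thesis using e by (intro order_tendstoD) auto
    qed
    ultimately have "eventually (\<lambda>n. (\<forall>x\<in>X. dist (h (r n) x) (g x) < e / 4) \<and> 1 / real (Suc (r n)) < e / 4) sequentially"
      by (rule eventually_conj)
    then obtain n where "(\<forall>x\<in>X. dist (h (r n) x) (g x) < e / 4) \<and> 1 / real (Suc (r n)) < e / 4"
      using eventually_happens'[OF sequentially_bot] by blast
    then have n: "\<And>x. x \<in> X \<Longrightarrow> \<bar>h (r n) x - g x\<bar> < e / 4" "1 / real (Suc (r n)) < e / 4"
      by (auto simp: dist_real_def)
    have "J g \<le> J (h (r n)) + e / 4 + e / 4"
    proof (rule J_mono)
      show "g x \<le> h (r n) x + e / 4" if "x \<in> X" for x using n(1)[OF that] by linarith
      show "legendre X g p \<le> legendre X (h (r n)) p + e / 4" for p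
      proof (rule legendre_X_le)
        show "h (r n) x \<le> g x + e / 4" if "x \<in> X" for x using n(1)[OF that] by linarith
      qed (use hL g lipschitz_cont in auto)
    qed (use hL g lipschitz_cont in auto)
    then show "J g \<le> m + e" using hJ[of "r n"] n(2) e by linarith
  qed
  define c where "c = - (\<integral>x. bi g x \<partial>\<mu>)"
  define \<phi> where "\<phi> x = bi g x + c" for x
  have cg: "continuous_on UNIV g" using g by (rule lipschitz_cont)
  have cb: "continuous_on UNIV (bi g)" using cg by (rule cont_bi)
  have "bi (bi g) = bi g"
  proof
    fix x
    have "legendre P (legendre X (bi g)) x = legendre P (legendre X g) x"
      by (rule legendre_cong) (rule legendre_bi[OF cg])
    then show "bi (bi g) x = bi g x" by (simp only: bi_def)
  qed
  then have bb: "legendre P (legendre X (bi g)) x = bi g x" for x by (simp add: bi_def[of "bi g", symmetric])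
  have "legendre X \<phi> = (\<lambda>p. legendre X (bi g) p + - c)"
    unfolding \<phi>_def by (rule ext) (simp add: legendre_shift(1)[OF cb])
  then have "bi \<phi> x = legendre P (\<lambda>p. legendre X (bi g) p + - c) x" for x
    by (simp only: bi_def[of \<phi>])
  then have "bi \<phi> x = \<phi> x" for x
    by (simp only: legendre_shift(2)[OF cont_legendre_X[OF cb]] bb) (simp add: \<phi>_def)
  then have "bi \<phi> = \<phi>" by blast
  moreover have "continuous_on UNIV \<phi>" unfolding \<phi>_def by (intro continuous_intros cb)
  moreover have "(\<integral>x. \<phi> x \<partial>\<mu>) = 0" using integrable_mu[OF cb] by (simp add: \<phi>_def c_def)
  moreover have "J \<phi> \<le> J f" if "continuous_on UNIV f" for f
    using J_shift[OF cb, of c] J_bi[OF cg] Jg m_le[OF that] by (simp add: \<phi>_def[abs_def])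
  ultimately show ?thesis using that by blast
qed

end


section \<open>The second boundary value problem\<close>

lemma open_AE_empty:
  fixes U :: "'a::euclidean_space set"
  assumes "open U" "AE p in lborel. p \<notin> U"
  shows "U = {}"
proof (rule ccontr)
  assume "U \<noteq> {}"
  have "U \<in> null_sets lborel" using assms by (subst AE_iff_null_sets) auto
  then have "negligible U" by (simp add: negligible_iff_null_sets null_sets_completionI)
  with assms(1) \<open>U \<noteq> {}\<close> show False using open_not_negligible by blast
qed

text \<open>\<open>measure_of\<close> defaults to the zero measure when its set function is not a
  measure on the Borel sets; the nonzero mass of \<mu> rules this default out.\<close>

lemma monge_ampere_eq_imp:
  fixes f :: "'a::euclidean_space \<Rightarrow> real"
  assumes "monge_ampere f = \<mu>" "sets \<mu> = sets borel" "emeasure \<mu> UNIV \<noteq> 0" "E \<in> sets borel"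
  shows "emeasure lebesgue (subdifferential_image f E) = emeasure \<mu> E"
proof -
  have \<tau>: "sigma_sets UNIV (sets borel) = sets (borel :: 'a measure)"
    using sets.sigma_sets_eq[of "borel :: 'a measure"] by simp
  have *: "emeasure \<mu> A = (if A \<in> sets borel \<and> measure_space UNIV (sets borel) (\<lambda>E. emeasure lebesgue (\<Union>x\<in>E. subdifferential f x))
      then emeasure lebesgue (\<Union>x\<in>A. subdifferential f x) else 0)" for A
    unfolding assms(1)[symmetric] monge_ampere_def by (subst emeasure_measure_of_conv) (simp add: \<tau>)
  have "measure_space UNIV (sets borel) (\<lambda>E. emeasure lebesgue (\<Union>x\<in>E. subdifferential f x))"
    using *[of UNIV] assms(3) by (auto split: if_splits)
  then show ?thesis using *[of E] assms(4) by (simp add: subdifferential_image_def)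
qed

lemma monge_ampere_eqI:
  fixes f :: "'a::euclidean_space \<Rightarrow> real"
  assumes "sets \<mu> = sets borel"
    and "\<And>E. E \<in> sets borel \<Longrightarrow> emeasure lebesgue (subdifferential_image f E) = emeasure \<mu> E"
  shows "monge_ampere f = \<mu>"
proof -
  have \<tau>: "sigma_sets UNIV (sets borel) = sets (borel :: 'a measure)"
    using sets.sigma_sets_eq[of "borel :: 'a measure"] by simp
  have "monge_ampere f = measure_of UNIV (sets borel) (emeasure \<mu>)"
    unfolding monge_ampere_def
    by (rule measure_of_eq) (use assms(2) in \<open>auto simp: \<tau> subdifferential_image_def\<close>)
  also have "\<dots> = \<mu>"
    using measure_of_of_measure[of \<mu>] sets_eq_imp_space_eq[OF assms(1)] assms(1) by simp
  finally show ?thesis .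
qed

context transport_problem
begin

lemma subgradient_maximizes:
  assumes \<psi>: "continuous_on UNIV \<psi>" and "p \<in> subdifferential \<psi> x" "x \<in> X"
  shows "legendre X \<psi> p = x \<bullet> p - \<psi> x" "x \<in> subdifferential (legendre X \<psi>) p"
proof -
  interpret compact_legendre X \<psi> by (rule legendre_X[OF \<psi>])
  have "z \<bullet> p - \<psi> z \<le> x \<bullet> p - \<psi> x" for z
    using subdifferentialD[OF assms(2), of z] by (simp add: inner_diff_right inner_commute)
  then have "legendre X \<psi> p \<le> x \<bullet> p - \<psi> x" by (simp add: le_iff)
  then show "legendre X \<psi> p = x \<bullet> p - \<psi> x" "x \<in> subdifferential (legendre X \<psi>) p"
    using ge[OF assms(3), of p] maximizer_subgradient[OF assms(3)] by auto
qed

text \<open>Up to a null set of slopes, the image of \<open>E\<close> is the part of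
  \<open>P\<close> that the Borel map \<open>y\<close> sends into \<open>E\<close>. Completeness of
  \<open>lebesgue\<close> yields measurability for every Borel \<open>E\<close>, and the volume
  becomes a pushforward.\<close>

lemma subdifferential_image_measure:
  fixes \<psi> :: "'a \<Rightarrow> real"
  assumes y: "y \<in> borel_measurable borel" and sub: "\<And>x. subdifferential \<psi> x \<subseteq> P"
    and ae: "AE p in lam. \<forall>x. p \<in> subdifferential \<psi> x \<longleftrightarrow> x = y p" and E: "E \<in> sets borel"
  shows "emeasure lebesgue (subdifferential_image \<psi> E) = emeasure (distr lam borel y) E"
proof -
  note [measurable] = y E
  have "AE p in lborel. p \<in> y -` E \<inter> P \<longleftrightarrow> p \<in> subdifferential_image \<psi> E"
    using ae unfolding AE_lam
  proof eventually_elim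
    case (elim p)
    then show ?case using sub by (auto simp: subdifferential_image_def)
  qed
  then have ae': "AE p in lebesgue. p \<in> y -` E \<inter> P \<longleftrightarrow> p \<in> subdifferential_image \<psi> E"
    by (rule AE_completion)
  have b: "y -` E \<in> sets borel" using measurable_sets_borel[OF y E] .
  have bb: "y -` E \<inter> P \<in> sets lebesgue" using b by (simp add: sets_completionI_sets)
  have "subdifferential_image \<psi> E \<in> sets lebesgue"
    by (rule completion.in_sets_AE[OF ae' bb]) simp
  then have "emeasure lebesgue (subdifferential_image \<psi> E) = emeasure lebesgue (y -` E \<inter> P)"
    using ae' bb by (intro emeasure_eq_AE) (auto elim: eventually_mono)
  also have "\<dots> = emeasure lborel (y -` E \<inter> P)" using b by simp
  also have "\<dots> = emeasure (distr lam borel y) E" using b by (subst emeasure_distr) (auto simp: emeasure_lam)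
  finally show ?thesis .
qed

end

locale brenier = transport_problem +
  fixes \<phi> :: "'a \<Rightarrow> real"
  assumes cont_\<phi>: "continuous_on UNIV \<phi>" and bi_\<phi>: "bi \<phi> = \<phi>" and normalized: "(\<integral>x. \<phi> x \<partial>\<mu>) = 0"
    and minimal: "\<And>f. continuous_on UNIV f \<Longrightarrow> J \<phi> \<le> J f"
begin

definition \<kappa> :: "'a \<Rightarrow> real" where "\<kappa> = legendre X \<phi>"
definition \<tau> :: "'a \<Rightarrow> 'a" where "\<tau> = sgrad \<kappa>"

sublocale chi: compact_legendre X \<phi> rewrites "legendre X \<phi> = \<kappa>"
  by (simp_all add: legendre_X[OF cont_\<phi>] \<kappa>_def)

lemma cont_\<kappa>: "continuous_on UNIV \<kappa>" unfolding \<kappa>_def by (rule cont_legendre_X[OF cont_\<phi>])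

sublocale phi: compact_legendre P \<kappa> rewrites "legendre P \<kappa> = \<phi>"
  using bi_\<phi> legendre_P[OF cont_\<kappa>] by (simp_all add: \<kappa>_def bi_def)

lemma lipschitz_\<kappa>: "R-lipschitz_on UNIV \<kappa>" by (rule chi.lipschitz[OF R(2)])

lemma \<tau>_measurable [measurable]: "\<tau> \<in> borel_measurable borel"
  unfolding \<tau>_def by (rule borel_measurable_sgrad[OF chi.convex])

lemma AE_\<tau>: "AE p in lborel. subdifferential \<kappa> p = {\<tau> p}"
  unfolding \<tau>_def by (rule AE_subdifferential_singleton[OF chi.convex])

lemma \<tau>_maximizer:
  assumes "subdifferential \<kappa> p = {\<tau> p}"
  shows "\<tau> p \<in> X" "\<kappa> p = \<tau> p \<bullet> p - \<phi> (\<tau> p)"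
proof -
  obtain x where x: "x \<in> X" "\<kappa> p = x \<bullet> p - \<phi> x" using chi.attained[of p] .
  then have "x = \<tau> p" using chi.maximizer_subgradient[of x p] assms by simp
  then show "\<tau> p \<in> X" "\<kappa> p = \<tau> p \<bullet> p - \<phi> (\<tau> p)" using x by simp_all
qed

text \<open>Envelope theorem: where the maximiser \<open>\<tau> p\<close> is unique, the transform
  of \<open>\<phi> + t * g\<close> has right derivative \<open>- g (\<tau> p)\<close> at
  \<open>t = 0\<close>. Minimality of \<phi> makes the right derivative of \<open>J\<close>
  nonnegative; the reverse inequality comes from applying this to \<open>- g\<close>.\<close>

lemma first_variation_le:
  fixes g :: "'a \<Rightarrow> real"
  assumes g: "continuous_on UNIV g"
  shows "(\<integral>p. g (\<tau> p) \<partial>lam) \<le> (\<integral>x. g x \<partial>\<mu>)"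
proof -
  obtain B where B: "B \<ge> 0" "\<And>x. x \<in> X \<Longrightarrow> \<bar>g x\<bar> \<le> B" using bounded_on_compact[OF g X] by blast
  define t where "t n = 1 / real (Suc n)" for n
  have t: "t n > 0" for n by (simp add: t_def)
  have t0: "t \<longlonglongrightarrow> 0" unfolding t_def by (intro LIMSEQ_Suc lim_const_over_n)
  define \<phi>' where "\<phi>' n x = \<phi> x + t n * g x" for n x
  have c': "continuous_on UNIV (\<phi>' n)" for n unfolding \<phi>'_def by (intro continuous_intros cont_\<phi> g)
  define \<kappa>' where "\<kappa>' n = legendre X (\<phi>' n)" for n
  define q where "q n p = (\<kappa>' n p - \<kappa> p) / t n" for n p
  have cq: "continuous_on UNIV (q n)" for n
    unfolding q_def \<kappa>'_def by (intro continuous_intros cont_\<kappa> cont_legendre_X c') (use t[of n] in auto)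
  have le1: "\<kappa>' n p \<le> \<kappa> p + t n * B" for n p
    unfolding \<kappa>'_def \<kappa>_def
  proof (rule legendre_X_le[OF c' cont_\<phi>])
    fix x assume "x \<in> X"
    then have "- B \<le> g x" using B(2) by force
    then have "t n * - B \<le> t n * g x" using t[of n] by (intro mult_left_mono) auto
    then show "\<phi> x \<le> \<phi>' n x + t n * B" by (simp add: \<phi>'_def)
  qed
  have le2: "\<kappa> p \<le> \<kappa>' n p + t n * B" for n p
    unfolding \<kappa>'_def \<kappa>_def
  proof (rule legendre_X_le[OF cont_\<phi> c'])
    fix x assume "x \<in> X"
    then have "t n * g x \<le> t n * B" using t[of n] B(2) by (intro mult_left_mono) force+
    then show "\<phi>' n x \<le> \<phi> x + t n * B" by (simp add: \<phi>'_def)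
  qed
  have qB: "\<bar>q n p\<bar> \<le> B" for n p
    using le1[of n p] le2[of p n] t[of n] by (simp add: q_def abs_le_iff divide_le_eq le_divide_eq) (simp add: algebra_simps)
  have lim: "(\<lambda>n. q n p) \<longlonglongrightarrow> - g (\<tau> p)" if p: "subdifferential \<kappa> p = {\<tau> p}" for p
  proof (rule tendstoI)
    fix e :: real assume e: "e > 0"
    note sp = \<tau>_maximizer[OF p]
    have lower: "- g (\<tau> p) \<le> q n p" for n
    proof -
      have "\<tau> p \<bullet> p - \<phi>' n (\<tau> p) \<le> \<kappa>' n p"
        unfolding \<kappa>'_def by (rule compact_legendre.ge[OF legendre_X[OF c'] sp(1)])
      then have "t n * - g (\<tau> p) \<le> \<kappa>' n p - \<kappa> p" by (simp add: \<phi>'_def sp(2))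
      then show ?thesis using t[of n] by (simp add: q_def le_divide_eq mult.commute)
    qed
    have upper: "q n p \<le> - g x" if "x \<in> X" "\<kappa>' n p = x \<bullet> p - \<phi>' n x" for n x
    proof -
      have "\<kappa>' n p - \<kappa> p \<le> t n * - g x" using chi.ge[OF that(1), of p] that(2) by (simp add: \<phi>'_def)
      then show ?thesis using t[of n] by (simp add: q_def divide_le_eq mult.commute)
    qed
    define K where "K = X \<inter> {x. g x \<le> g (\<tau> p) - e / 2}"
    have "closed {x. g x \<le> g (\<tau> p) - e / 2}" by (intro closed_Collect_le g continuous_intros)
    then have K: "compact K" unfolding K_def by (intro compact_Int_closed X)
    \<comment> \<open>By compactness the points where \<open>g\<close> is too small miss the maximum
      by a fixed \<delta>. As soon as \<open>2 * t n * B < \<delta>\<close>, no maximiser of the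
      perturbed problem is among them.\<close>
    obtain \<delta> where \<delta>: "\<delta> > 0" "\<And>x. x \<in> K \<Longrightarrow> x \<bullet> p - \<phi> x \<le> \<kappa> p - \<delta>"
    proof (cases "K = {}")
      case False
      have "continuous_on K (\<lambda>x. x \<bullet> p - \<phi> x)"
        by (intro continuous_intros continuous_on_subset[OF cont_\<phi>]) auto
      from continuous_attains_sup[OF K False this] obtain x where
        x: "x \<in> K" "\<And>z. z \<in> K \<Longrightarrow> z \<bullet> p - \<phi> z \<le> x \<bullet> p - \<phi> x" by blast
      have xX: "x \<in> X" using x(1) by (simp add: K_def)
      have "x \<noteq> \<tau> p" using x(1) e by (auto simp: K_def)
      then have "\<not> \<kappa> p \<le> x \<bullet> p - \<phi> x" using chi.maximizer_subgradient[OF xX] p by auto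
      then show ?thesis using x(2) by (intro that[of "\<kappa> p - (x \<bullet> p - \<phi> x)"]) auto
    qed (use that[of 1] in auto)
    have "(\<lambda>n. 2 * t n * B) \<longlonglongrightarrow> 2 * 0 * B" by (intro tendsto_intros t0)
    then have "eventually (\<lambda>n. 2 * t n * B < \<delta>) sequentially" using \<delta>(1) by (intro order_tendstoD(2)[of _ 0]) auto
    then show "eventually (\<lambda>n. dist (q n p) (- g (\<tau> p)) < e) sequentially"
    proof eventually_elim
      case (elim n)
      obtain x where x: "x \<in> X" "\<kappa>' n p = x \<bullet> p - \<phi>' n x"
        using compact_legendre.attained[OF legendre_X[OF c'], of n p] unfolding \<kappa>'_def by metis
      have "x \<notin> K"
      proof
        assume "x \<in> K"
        have "- B \<le> g x" using B(2)[OF x(1)] by simp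
        then have "t n * - B \<le> t n * g x" using t[of n] by (intro mult_left_mono) auto
        moreover have "x \<bullet> p - \<phi> x \<le> \<kappa> p - \<delta>" by (rule \<delta>(2)[OF \<open>x \<in> K\<close>])
        ultimately have "\<kappa>' n p \<le> \<kappa> p - \<delta> + t n * B" using x(2) by (simp add: \<phi>'_def)
        then show False using le2[of p n] elim by simp
      qed
      then have "g x > g (\<tau> p) - e / 2" using x(1) by (simp add: K_def)
      then show ?case using lower[of n] upper[OF x] e by (simp add: dist_real_def)
    qed
  qed
  have "(\<lambda>n. \<integral>p. q n p \<partial>lam) \<longlonglongrightarrow> (\<integral>p. - g (\<tau> p) \<partial>lam)"
  proof (rule integral_dominated_convergence[where w = "\<lambda>_. B"])
    show "(\<lambda>p. - g (\<tau> p)) \<in> borel_measurable lam"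
      using borel_measurable_continuous_onI[OF g] by measurable
    show "q n \<in> borel_measurable lam" for n using borel_measurable_continuous_onI[OF cq] by measurable
    show "AE p in lam. (\<lambda>n. q n p) \<longlonglongrightarrow> - g (\<tau> p)"
      using AE_lamI[OF AE_\<tau>] by eventually_elim (rule lim)
  qed (use qB in auto)
  then have "(\<lambda>n. (\<integral>x. g x \<partial>\<mu>) + (\<integral>p. q n p \<partial>lam)) \<longlonglongrightarrow> (\<integral>x. g x \<partial>\<mu>) + (\<integral>p. - g (\<tau> p) \<partial>lam)"
    by (intro tendsto_intros)
  moreover have "0 \<le> (\<integral>x. g x \<partial>\<mu>) + (\<integral>p. q n p \<partial>lam)" for n
  proof -
    have "J \<phi> \<le> J (\<phi>' n)" by (rule minimal[OF c'])
    also have "J (\<phi>' n) = (\<integral>x. \<phi> x \<partial>\<mu>) + t n * (\<integral>x. g x \<partial>\<mu>) + (\<integral>p. \<kappa>' n p \<partial>lam)"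
      using integrable_mu[OF cont_\<phi>] integrable_mu[OF g] by (simp add: J_def \<phi>'_def[abs_def] \<kappa>'_def)
    finally have "0 \<le> t n * (\<integral>x. g x \<partial>\<mu>) + ((\<integral>p. \<kappa>' n p \<partial>lam) - (\<integral>p. \<kappa> p \<partial>lam))"
      by (simp add: J_def \<kappa>_def)
    also have "(\<integral>p. \<kappa>' n p \<partial>lam) - (\<integral>p. \<kappa> p \<partial>lam) = (\<integral>p. \<kappa>' n p - \<kappa> p \<partial>lam)"
      unfolding \<kappa>'_def \<kappa>_def
      by (intro Bochner_Integration.integral_diff[symmetric] integrable_lam cont_legendre_X c' cont_\<phi>)
    also have "(\<integral>p. \<kappa>' n p - \<kappa> p \<partial>lam) = t n * (\<integral>p. q n p \<partial>lam)"
      using t[of n] by (subst Bochner_Integration.integral_mult_right_zero[symmetric]) (simp add: q_def)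
    finally have "0 \<le> t n * ((\<integral>x. g x \<partial>\<mu>) + (\<integral>p. q n p \<partial>lam))" by (simp add: algebra_simps)
    then show ?thesis using t[of n] by (simp add: zero_le_mult_iff)
  qed
  ultimately have "0 \<le> (\<integral>x. g x \<partial>\<mu>) + (\<integral>p. - g (\<tau> p) \<partial>lam)"
    by (intro LIMSEQ_le_const) auto
  then show ?thesis by simp
qed

lemma push_\<tau>: "distr lam borel \<tau> = \<mu>"
proof (rule finite_borel_measure_eqI)
  have "prob_space (distr lam borel \<tau>)" by (rule lam.prob_space_distr) measurable
  then show "finite_measure (distr lam borel \<tau>)" by (rule prob_space.finite_measure)
  show "finite_measure \<mu>" by (rule mu.finite_measure_axioms)
  fix g :: "'a \<Rightarrow> real" assume g: "continuous_on UNIV g"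
  have gm [measurable]: "g \<in> borel_measurable borel" by (rule borel_measurable_continuous_onI[OF g])
  have "continuous_on UNIV (\<lambda>x. - g x)" by (intro continuous_intros g)
  from first_variation_le[OF this] first_variation_le[OF g]
  have "(\<integral>p. g (\<tau> p) \<partial>lam) = (\<integral>x. g x \<partial>\<mu>)" by simp
  moreover have "(\<integral>x. g x \<partial>distr lam borel \<tau>) = (\<integral>p. g (\<tau> p) \<partial>lam)" by (rule integral_distr) measurable
  ultimately show "(\<integral>x. g x \<partial>distr lam borel \<tau>) = (\<integral>x. g x \<partial>\<mu>)" by simp
qed (simp_all add: sets_\<mu>)

lemma AE_interior: "AE p in lam. p \<in> interior P"
proof -
  have "negligible (frontier P)" by (rule negligible_convex_frontier[OF P(1)])
  moreover have "frontier P \<in> sets borel" by simp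
  ultimately have "frontier P \<in> null_sets lborel"
    by (simp add: negligible_iff_null_sets null_sets_completion_iff)
  then have "AE p in lborel. p \<notin> frontier P" by (rule AE_not_in)
  then show ?thesis
    unfolding AE_lam by eventually_elim (use closure_subset[of P] in \<open>auto simp: frontier_def\<close>)
qed

lemma subgradient_of_\<tau>:
  assumes "subdifferential \<kappa> p = {\<tau> p}" "p \<in> P"
  shows "p \<in> subdifferential \<phi> (\<tau> p)"
proof (rule subdifferentialI)
  show "\<phi> (\<tau> p) + p \<bullet> (y - \<tau> p) \<le> \<phi> y" for y
    using \<tau>_maximizer[OF assms(1)] phi.ge[OF assms(2), of y] by (simp add: inner_diff_right inner_commute)
qed

text \<open>\<open>x\<close> need not belong to \<open>X\<close>, so it may be no candidate in the
  maximum defining \<open>\<kappa> p\<close>. But \<open>\<kappa> q - x \<bullet> q\<close> has a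
  minimum at \<open>p\<close> over a ball inside \<open>P\<close>, hence by convexity a global one;
  so \<open>x\<close> is a subgradient of \<kappa> at \<open>p\<close>, and the only one is
  \<open>\<tau> p\<close>.\<close>

lemma AE_subdifferential_iff: "AE p in lam. \<forall>x. p \<in> subdifferential \<phi> x \<longleftrightarrow> x = \<tau> p"
  using AE_interior AE_lamI[OF AE_\<tau>]
proof eventually_elim
  case (elim p)
  have pP: "p \<in> P" using elim(1) interior_subset by blast
  show ?case
  proof (intro allI iffI)
    fix x assume x: "p \<in> subdifferential \<phi> x"
    have "z \<bullet> p - \<phi> z \<le> x \<bullet> p - \<phi> x" for z
      using subdifferentialD[OF x, of z] by (simp add: inner_diff_right inner_commute)
    then have le: "\<kappa> p \<le> x \<bullet> p - \<phi> x" by (simp add: chi.le_iff)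
    obtain e where e: "e > 0" "ball p e \<subseteq> P" using elim(1) mem_interior by blast
    define g where "g q = \<kappa> q - x \<bullet> q" for q
    have cvx: "convex_on UNIV g"
      using chi.convex unfolding g_def convex_on_def by (auto simp: algebra_simps)
    have mn: "\<forall>q\<in>ball p e. g p \<le> g q"
    proof
      fix q assume "q \<in> ball p e"
      then have "q \<in> P" using e(2) by blast
      then show "g p \<le> g q" using phi.ge[of q x] le by (simp add: g_def inner_commute)
    qed
    have gl: "\<forall>q\<in>UNIV. g p \<le> g q" by (rule convex_local_global_minimum[OF e(1) cvx _ mn]) simp
    then have "x \<in> subdifferential \<kappa> p"
      by (intro subdifferentialI) (simp add: g_def inner_diff_right algebra_simps)
    then show "x = \<tau> p" using elim(2) by simp
  qed (use subgradient_of_\<tau>[OF elim(2) pP] in simp)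
qed

lemma \<phi>_solves: "solves_second_bvp \<mu> P \<phi>"
  unfolding solves_second_bvp_def
proof (intro conjI)
  show sub: "(\<Union>x. subdifferential \<phi> x) \<subseteq> P" using phi.subdifferential_subset[OF P(1)] by blast
  show "monge_ampere \<phi> = \<mu>"
    using subdifferential_image_measure[OF \<tau>_measurable _ AE_subdifferential_iff] sub push_\<tau>
    by (intro monge_ampere_eqI sets_\<mu>) auto
  have "AE p in lborel. p \<notin> P - (\<Union>x. subdifferential \<phi> x)"
    using AE_subdifferential_iff unfolding AE_lam by eventually_elim auto
  then have "AE p in lebesgue. p \<notin> P - (\<Union>x. subdifferential \<phi> x)" by (rule AE_completion)
  from AE_E3[OF this] obtain N
    where N: "\<And>p. p \<in> space lebesgue - N \<Longrightarrow> p \<notin> P - (\<Union>x. subdifferential \<phi> x)" "N \<in> null_sets lebesgue"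
    by blast
  show "negligible (P - (\<Union>x. subdifferential \<phi> x))"
  proof (rule negligible_subset)
    show "negligible N" using N(2) by (simp add: negligible_iff_null_sets)
    show "P - (\<Union>x. subdifferential \<phi> x) \<subseteq> N"
    proof
      fix p assume "p \<in> P - (\<Union>x. subdifferential \<phi> x)"
      then show "p \<in> N" using N(1)[of p] by (cases "p \<in> N") simp_all
    qed
  qed
qed (rule phi.convex)

text \<open>The transforms of \<phi> and \<psi> over \<open>X\<close> share the subgradient
  \<open>\<tau> p\<close> at almost every \<open>p\<close> in \<open>P\<close>, so they differ by a
  constant on \<open>P\<close>. Transforming back over \<open>P\<close> recovers \<phi> and \<psi>,
  and the normalisation removes the constant.\<close>

lemma eq_\<phi>I:
  assumes \<psi>: "convex_on UNIV \<psi>" and sub: "\<And>x. subdifferential \<psi> x \<subseteq> P"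
    and ae: "AE p in lam. p \<in> subdifferential \<psi> (\<tau> p)" and int: "(\<integral>x. \<psi> x \<partial>\<mu>) = 0"
  shows "\<psi> = \<phi>"
proof -
  have c\<psi>: "continuous_on UNIV \<psi>" by (rule convex_on_UNIV_continuous[OF \<psi>])
  define \<kappa>' where "\<kappa>' = legendre X \<psi>"
  interpret chi': compact_legendre X \<psi> rewrites "legendre X \<psi> = \<kappa>'"
    by (simp_all add: legendre_X[OF c\<psi>] \<kappa>'_def)
  have c\<kappa>': "continuous_on UNIV \<kappa>'" by (rule convex_on_UNIV_continuous[OF chi'.convex])
  interpret psi: compact_legendre P \<kappa>' by (rule legendre_P[OF c\<kappa>'])
  have good: "AE p in lam. \<kappa>' p = \<tau> p \<bullet> p - \<psi> (\<tau> p) \<and> \<tau> p \<in> subdifferential \<kappa>' p \<and> \<tau> p \<in> subdifferential \<kappa> p \<and> p \<in> subdifferential \<psi> (\<tau> p)"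
    using ae AE_lamI[OF AE_\<tau>]
  proof eventually_elim
    case (elim p)
    then show ?case using subgradient_maximizes[OF c\<psi> elim(1) \<tau>_maximizer(1)[OF elim(2)]] by (simp add: \<kappa>'_def)
  qed
  have "AE p in lborel. p \<in> interior P \<longrightarrow> subdifferential \<kappa> p \<inter> subdifferential \<kappa>' p \<noteq> {}"
    using good unfolding AE_lam by eventually_elim (use interior_subset in blast)
  note ae_common = this
  have Rb: "\<And>x v. v \<in> subdifferential \<kappa> x \<Longrightarrow> norm v \<le> R" by (rule subdifferential_norm_le[OF lipschitz_\<kappa>])
  have const: "\<kappa> q - \<kappa>' q = \<kappa> p - \<kappa>' p" if "p \<in> interior P" "q \<in> interior P" for p q
    by (rule common_subgradient_imp_const_diff[OF chi.convex chi'.convex Rb open_interior convex_interior[OF P(1)] ae_common that])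
  obtain p0 where p0: "p0 \<in> interior P" using P(3) by blast
  define c where "c = \<kappa> p0 - \<kappa>' p0"
  have "closed {q. \<kappa> q = \<kappa>' q + c}" by (intro closed_Collect_eq continuous_intros cont_\<kappa> c\<kappa>')
  then have "closure (interior P) \<subseteq> {q. \<kappa> q = \<kappa>' q + c}"
    using const[OF p0] by (intro closure_minimal) (auto simp: c_def algebra_simps)
  then have \<kappa>c: "\<kappa> q = \<kappa>' q + c" if "q \<in> P" for q using P_dense that by blast
  have "\<psi> x = legendre P \<kappa>' x" for x
  proof (rule antisym)
    obtain v where v: "v \<in> subdifferential \<psi> x" using subdifferential_nonempty[OF \<psi>] .
    have "z \<bullet> v - \<psi> z \<le> x \<bullet> v - \<psi> x" for z
      using subdifferentialD[OF v, of z] by (simp add: inner_diff_right inner_commute)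
    then have "\<kappa>' v \<le> x \<bullet> v - \<psi> x" by (simp add: chi'.le_iff)
    moreover have "v \<in> P" using v sub by blast
    ultimately show "\<psi> x \<le> legendre P \<kappa>' x" using psi.ge[of v x] by (simp add: inner_commute)
    \<comment> \<open>The inequality is known for almost every \<open>p\<close>. It fails on an open
      set, which is therefore empty; density of \<open>interior P\<close> covers the rest of
      \<open>P\<close>.\<close>
    have "interior P \<inter> {p. p \<bullet> x - \<kappa>' p > \<psi> x} = {}"
    proof (rule open_AE_empty)
      show "open (interior P \<inter> {p. p \<bullet> x - \<kappa>' p > \<psi> x})"
        by (intro open_Int open_interior open_Collect_less continuous_intros c\<kappa>')
      show "AE p in lborel. p \<notin> interior P \<inter> {p. p \<bullet> x - \<kappa>' p > \<psi> x}"
        using good unfolding AE_lam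
      proof eventually_elim
        case (elim p)
        show ?case
        proof
          assume p: "p \<in> interior P \<inter> {p. p \<bullet> x - \<kappa>' p > \<psi> x}"
          then have "p \<in> P" using interior_subset by blast
          then have "\<kappa>' p = \<tau> p \<bullet> p - \<psi> (\<tau> p)" "p \<in> subdifferential \<psi> (\<tau> p)" using elim by auto
          then show False using subdifferentialD[of p \<psi> "\<tau> p" x] p by (simp add: inner_diff_right inner_commute)
        qed
      qed
    qed
    then have "interior P \<subseteq> {p. p \<bullet> x - \<kappa>' p \<le> \<psi> x}" by force
    moreover have "closed {p. p \<bullet> x - \<kappa>' p \<le> \<psi> x}" by (intro closed_Collect_le continuous_intros c\<kappa>')
    ultimately have "closure (interior P) \<subseteq> {p. p \<bullet> x - \<kappa>' p \<le> \<psi> x}" by (rule closure_minimal)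
    then show "legendre P \<kappa>' x \<le> \<psi> x" using P_dense by (auto simp: psi.le_iff)
  qed
  moreover have "\<phi> x = legendre P \<kappa>' x - c" for x
    using legendre_cong[of P \<kappa> "\<lambda>q. \<kappa>' q + c" x] \<kappa>c legendre_shift(2)[OF c\<kappa>', of c x] bi_\<phi>
    by (simp add: bi_def \<kappa>_def)
  ultimately have eq: "\<psi> x = \<phi> x + c" for x by simp
  then have "(\<integral>x. \<phi> x + c \<partial>\<mu>) = 0" using int by simp
  then have "c = 0" using integrable_mu[OF cont_\<phi>] normalized by simp
  then show ?thesis using eq by auto
qed

text \<open>The gradient \<open>y\<close> of the transform of \<psi> also pushes \<open>lam\<close>
  to \<mu>, so \<open>h\<close> has mean \<open>J \<phi> - J \<psi> \<le> 0\<close>. At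
  \<open>(y p, p)\<close> the duality inequality is an equality for \<psi> and still an inequality
  for \<phi>, so \<open>h\<close> is nonnegative and thus vanishes almost everywhere. Equality for
  \<phi> then says \<open>y p = \<tau> p\<close>.\<close>

lemma \<phi>_unique:
  assumes sol: "solves_second_bvp \<mu> P \<psi>" and int: "(\<integral>x. \<psi> x \<partial>\<mu>) = 0"
  shows "\<psi> = \<phi>"
proof (rule eq_\<phi>I[OF _ _ _ int])
  show \<psi>: "convex_on UNIV \<psi>" and sub: "subdifferential \<psi> x \<subseteq> P" for x
    using sol by (auto simp: solves_second_bvp_def)
  have c\<psi>: "continuous_on UNIV \<psi>" by (rule convex_on_UNIV_continuous[OF \<psi>])
  have Lsub: "\<And>x v. v \<in> subdifferential \<psi> x \<Longrightarrow> norm v \<le> L" using sub L(2) by blast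
  have ma: "emeasure lebesgue (subdifferential_image \<psi> E) = emeasure \<mu> E" if "E \<in> sets borel" for E
    using sol mu.emeasure_space_1 sets_\<mu> that by (intro monge_ampere_eq_imp) (auto simp: solves_second_bvp_def)
  define \<kappa>' where "\<kappa>' = legendre X \<psi>"
  interpret chi': compact_legendre X \<psi> rewrites "legendre X \<psi> = \<kappa>'"
    by (simp_all add: legendre_X[OF c\<psi>] \<kappa>'_def)
  have c\<kappa>': "continuous_on UNIV \<kappa>'" by (rule convex_on_UNIV_continuous[OF chi'.convex])
  define y where "y = sgrad \<kappa>'"
  have y [measurable]: "y \<in> borel_measurable borel" unfolding y_def by (rule borel_measurable_sgrad[OF chi'.convex])
  \<comment> \<open>\<mu> does not charge the complement of \<open>X\<close>, so almost no slope is
    attained there; the remaining subgradients sit at points of \<open>X\<close>, where duality over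
    \<open>X\<close> applies.\<close>
  have "subdifferential_image \<psi> (- X) \<in> sets borel"
    using X by (intro borel_subdifferential_image_open[OF \<psi> Lsub]) (auto simp: compact_imp_closed)
  moreover have "emeasure \<mu> (- X) = 0"
    using AE_X by (subst (asm) AE_iff_measurable[of "- X"]) (auto simp: sets_\<mu>)
  ultimately have "subdifferential_image \<psi> (- X) \<in> null_sets lborel"
    using ma[of "- X"] by (simp add: null_sets_def)
  then have 1: "AE p in lborel. p \<notin> subdifferential_image \<psi> (- X)" by (rule AE_not_in)
  have "negligible (P - (\<Union>x. subdifferential \<psi> x))" using sol by (simp add: solves_second_bvp_def)
  then have "AE p in lebesgue. p \<notin> P - (\<Union>x. subdifferential \<psi> x)"
    unfolding negligible_iff_null_sets by (rule AE_not_in)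
  then have 2: "AE p in lborel. p \<notin> P - (\<Union>x. subdifferential \<psi> x)" by (simp add: AE_completion_iff)
  have 3: "AE p in lborel. subdifferential \<kappa>' p = {y p}"
    unfolding y_def by (rule AE_subdifferential_singleton[OF chi'.convex])
  have ae: "AE p in lborel. p \<in> P \<longrightarrow> (y p \<in> X \<and> \<kappa>' p = y p \<bullet> p - \<psi> (y p) \<and> (\<forall>x. p \<in> subdifferential \<psi> x \<longleftrightarrow> x = y p))"
    using 1 2 3
  proof eventually_elim
    case (elim p)
    show ?case
    proof
      assume "p \<in> P"
      then obtain x where x: "p \<in> subdifferential \<psi> x" using elim(2) by blast
      have inX: "z \<in> X \<and> z = y p" if "p \<in> subdifferential \<psi> z" for z
      proof -
        have "z \<in> X" using elim(1) that by (auto simp: subdifferential_image_def)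
        then show ?thesis using subgradient_maximizes(2)[OF c\<psi> that] elim(3) by (simp add: \<kappa>'_def)
      qed
      then have "x = y p" "x \<in> X" using x by auto
      then show "y p \<in> X \<and> \<kappa>' p = y p \<bullet> p - \<psi> (y p) \<and> (\<forall>x. p \<in> subdifferential \<psi> x \<longleftrightarrow> x = y p)"
        using inX x subgradient_maximizes(1)[OF c\<psi> x] by (auto simp: \<kappa>'_def)
    qed
  qed
  have ae_lam: "AE p in lam. y p \<in> X \<and> \<kappa>' p = y p \<bullet> p - \<psi> (y p) \<and> (\<forall>x. p \<in> subdifferential \<psi> x \<longleftrightarrow> x = y p)"
    unfolding AE_lam by (rule ae)
  have push_y: "distr lam borel y = \<mu>"
  proof (rule measure_eqI)
    fix E assume "E \<in> sets (distr lam borel y)"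
    then have E: "E \<in> sets borel" by simp
    have "AE p in lam. \<forall>x. p \<in> subdifferential \<psi> x \<longleftrightarrow> x = y p" using ae_lam by eventually_elim blast
    from subdifferential_image_measure[OF y sub this E] ma[OF E]
    show "emeasure (distr lam borel y) E = emeasure \<mu> E" by simp
  qed (simp add: sets_\<mu>)
  have int_y: "integrable lam (\<lambda>p. f (y p))" "(\<integral>p. f (y p) \<partial>lam) = (\<integral>x. f x \<partial>\<mu>)" if f: "continuous_on UNIV f" for f :: "'a \<Rightarrow> real"
  proof -
    have fm [measurable]: "f \<in> borel_measurable borel" by (rule borel_measurable_continuous_onI[OF f])
    have "integrable (distr lam borel y) f" using integrable_mu[OF f] by (simp add: push_y)
    then show "integrable lam (\<lambda>p. f (y p))" by (subst (asm) integrable_distr_eq) measurable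
    have "(\<integral>x. f x \<partial>distr lam borel y) = (\<integral>p. f (y p) \<partial>lam)" by (rule integral_distr) measurable
    then show "(\<integral>p. f (y p) \<partial>lam) = (\<integral>x. f x \<partial>\<mu>)" by (simp add: push_y)
  qed
  define h where "h p = (\<phi> (y p) + \<kappa> p) - (\<psi> (y p) + \<kappa>' p)" for p
  have inth: "integrable lam h"
    unfolding h_def
    by (intro Bochner_Integration.integrable_diff Bochner_Integration.integrable_add int_y integrable_lam cont_\<phi> cont_\<kappa> c\<psi> c\<kappa>')
  have "AE p in lam. 0 \<le> h p"
    using ae_lam
  proof eventually_elim
    case (elim p)
    then show ?case using chi.ge[of "y p" p] by (simp add: h_def)
  qed
  moreover have "(\<integral>p. h p \<partial>lam) = J \<phi> - J \<psi>"
    unfolding h_def using int_y[OF cont_\<phi>] int_y[OF c\<psi>] integrable_lam[OF cont_\<kappa>] integrable_lam[OF c\<kappa>']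
    by (simp add: J_def \<kappa>_def[symmetric] \<kappa>'_def[symmetric])
  ultimately have "AE p in lam. h p = 0"
    using minimal[OF c\<psi>] integral_nonneg_eq_0_iff_AE[OF inth] integral_nonneg_AE[where M = lam and f = h] by simp
  then show "AE p in lam. p \<in> subdifferential \<psi> (\<tau> p)"
    using ae_lam AE_lamI[OF AE_\<tau>]
  proof eventually_elim
    case (elim p)
    then have "y p \<in> subdifferential \<kappa> p" by (intro chi.maximizer_subgradient) (auto simp: h_def)
    then show ?case using elim by auto
  qed
qed

end


section \<open>Stability\<close>

lemma convex_on_if_subgradients:
  fixes f :: "'a::real_inner \<Rightarrow> real"
  assumes "\<And>x. subdifferential f x \<noteq> {}"
  shows "convex_on UNIV f"
proof (rule convex_onI)
  fix t :: real and x y :: 'a assume t: "0 < t" "t < 1"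
  define z where "z = (1 - t) *\<^sub>R x + t *\<^sub>R y"
  obtain v where v: "v \<in> subdifferential f z" using assms by blast
  have "(1 - t) * (f z + v \<bullet> (x - z)) + t * (f z + v \<bullet> (y - z)) \<le> (1 - t) * f x + t * f y"
    using t by (intro add_mono mult_left_mono subdifferentialD[OF v]) auto
  moreover have "(1 - t) * (f z + v \<bullet> (x - z)) + t * (f z + v \<bullet> (y - z)) = f z + v \<bullet> ((1 - t) *\<^sub>R x + t *\<^sub>R y - z)"
    by (simp add: inner_diff_right inner_add_right algebra_simps)
  ultimately show "f ((1 - t) *\<^sub>R x + t *\<^sub>R y) \<le> (1 - t) * f x + t * f y" by (simp add: z_def)
qed simp

lemma subgradient_LIMSEQ:
  fixes f :: "'a::euclidean_space \<Rightarrow> real"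
  assumes lim: "\<And>y. (\<lambda>n. g n y) \<longlonglongrightarrow> f y" and g: "\<And>n. v n \<in> subdifferential (g n) x"
    and v: "v \<longlonglongrightarrow> w"
  shows "w \<in> subdifferential f x"
proof (rule subdifferentialI)
  fix y
  have "(\<lambda>n. g n x + v n \<bullet> (y - x)) \<longlonglongrightarrow> f x + w \<bullet> (y - x)" by (intro tendsto_intros lim v)
  then show "f x + w \<bullet> (y - x) \<le> f y"
    by (rule LIMSEQ_le[OF _ lim]) (use subdifferentialD[OF g] in auto)
qed

lemma subgradient_convergence:
  fixes f :: "'a::euclidean_space \<Rightarrow> real"
  assumes lim: "\<And>y. (\<lambda>n. g n y) \<longlonglongrightarrow> f y" and g: "\<And>n. v n \<in> subdifferential (g n) x"
    and K: "compact K" "\<And>n. v n \<in> K" and w: "subdifferential f x = {w}"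
  shows "v \<longlonglongrightarrow> w"
proof (rule tendstoI, rule ccontr)
  fix e :: real assume e: "e > 0" and "\<not> eventually (\<lambda>n. dist (v n) w < e) sequentially"
  then obtain r where r: "strict_mono (r :: nat \<Rightarrow> nat)" "\<And>n. \<not> dist (v (r n)) w < e"
    using not_eventually_sequentiallyD by blast
  obtain l r' where r': "strict_mono (r' :: nat \<Rightarrow> nat)" "((\<lambda>n. v (r n)) \<circ> r') \<longlonglongrightarrow> l"
    using K unfolding compact_def by meson
  have "l \<in> subdifferential f x"
  proof (rule subgradient_LIMSEQ)
    show "(\<lambda>n. g (r (r' n)) y) \<longlonglongrightarrow> f y" for y
      using LIMSEQ_subseq_LIMSEQ[OF LIMSEQ_subseq_LIMSEQ[OF lim r(1)] r'(1)] by (simp add: o_def)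
    show "v (r (r' n)) \<in> subdifferential (g (r (r' n))) x" for n by (rule g)
    show "(\<lambda>n. v (r (r' n))) \<longlonglongrightarrow> l" using r'(2) by (simp add: o_def)
  qed
  then have "l = w" using w by simp
  then have "eventually (\<lambda>n. dist (v (r (r' n))) w < e) sequentially"
    using r'(2) e by (auto simp: o_def dest: tendstoD)
  then obtain n where "dist (v (r (r' n))) w < e" using eventually_happens'[OF sequentially_bot] by blast
  then show False using r(2) by blast
qed

context brenier
begin

definition gap :: "'a \<Rightarrow> 'a \<Rightarrow> real" where "gap x p = \<phi> x + \<kappa> p - x \<bullet> p"

lemma gap_nonneg: "x \<in> X \<Longrightarrow> 0 \<le> gap x p"
  using chi.ge[of x p] by (simp add: gap_def)

lemma gap_eq_0_imp: assumes "p \<in> P" "gap x p = 0" shows "p \<in> subdifferential \<phi> x"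
proof (rule subdifferentialI)
  show "\<phi> x + p \<bullet> (y - x) \<le> \<phi> y" for y
    using phi.ge[OF assms(1), of y] assms(2) by (simp add: gap_def inner_diff_right inner_commute)
qed

lemma gap_bounded: obtains B where "B \<ge> 0" "\<And>x p. x \<in> X \<Longrightarrow> p \<in> P \<Longrightarrow> \<bar>gap x p\<bar> \<le> B"
proof -
  obtain B1 where B1: "B1 \<ge> 0" "\<And>x. x \<in> X \<Longrightarrow> \<bar>\<phi> x\<bar> \<le> B1" using bounded_on_compact[OF cont_\<phi> X] by blast
  obtain B2 where B2: "B2 \<ge> 0" "\<And>p. p \<in> P \<Longrightarrow> \<bar>\<kappa> p\<bar> \<le> B2" using bounded_on_compact[OF cont_\<kappa> P(2)] by blast
  have "\<bar>gap x p\<bar> \<le> B1 + B2 + R * L" if "x \<in> X" "p \<in> P" for x p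
    using B1(2)[OF that(1)] B2(2)[OF that(2)] inner_bound[OF that] unfolding gap_def by linarith
  moreover have "B1 + B2 + R * L \<ge> 0" using B1 B2 R(1) L(1) by (simp add: mult_pos_pos less_imp_le)
  ultimately show ?thesis using that by blast
qed

lemma borel_\<phi> [measurable]: "\<phi> \<in> borel_measurable borel" by (rule borel_measurable_continuous_onI[OF cont_\<phi>])
lemma borel_\<kappa> [measurable]: "\<kappa> \<in> borel_measurable borel" by (rule borel_measurable_continuous_onI[OF cont_\<kappa>])

lemma AE_mu_\<tau>: "AE x in \<mu>. Q x \<Longrightarrow> AE p in lam. Q (\<tau> p)"
  unfolding push_\<tau>[symmetric] by (rule AE_distrD[rotated]) measurable

text \<open>The limit \<psi> inherits convexity, slopes in \<open>P\<close> and mean 0. Where it has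
  a single subgradient, \<open>T n x\<close> converges to it, so the gap is 0 at
  \<open>(x, sgrad \<psi> x)\<close> for almost every \<open>x\<close>. Zero gap makes that vector a
  subgradient of \<phi>, which has just one almost everywhere; pulling back by \<tau> gives the
  criterion \<open>eq_\<phi>I\<close>.\<close>

lemma subsequence_limit:
  assumes sub: "\<And>n x. T n x \<in> subdifferential (f n) x" and TP: "\<And>n x. T n x \<in> P"
    and meas: "\<And>n. T n \<in> borel_measurable borel" and int: "\<And>n. (\<integral>x. f n x \<partial>\<mu>) = 0"
    and gap0: "(\<lambda>n. \<integral>x. gap x (T n x) \<partial>\<mu>) \<longlonglongrightarrow> 0"
    and lip: "\<And>n. L-lipschitz_on UNIV (f n)" and lip\<psi>: "L-lipschitz_on UNIV \<psi>"
    and ul: "\<And>K. compact K \<Longrightarrow> uniform_limit K f \<psi> sequentially"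
  shows "\<psi> = \<phi>"
proof -
  note [measurable] = meas
  have lim: "(\<lambda>n. f n y) \<longlonglongrightarrow> \<psi> y" for y
    using tendsto_uniform_limitI[OF ul[of "{y}"], of y] by simp
  have ne: "subdifferential \<psi> x \<noteq> {}" for x
  proof -
    obtain l r where "strict_mono (r :: nat \<Rightarrow> nat)" "((\<lambda>n. T n x) \<circ> r) \<longlonglongrightarrow> l"
      using P(2) TP unfolding compact_def by meson
    then have "l \<in> subdifferential \<psi> x"
      using LIMSEQ_subseq_LIMSEQ[OF lim, of r] sub
      by (intro subgradient_LIMSEQ[of "\<lambda>n. f (r n)" \<psi> "\<lambda>n. T (r n) x"]) (auto simp: o_def)
    then show ?thesis by blast
  qed
  have \<psi>: "convex_on UNIV \<psi>" using ne by (rule convex_on_if_subgradients)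
  have subP: "subdifferential \<psi> x \<subseteq> P" for x
  proof
    fix v assume v: "v \<in> subdifferential \<psi> x"
    show "v \<in> P"
    proof (rule ccontr)
      assume "v \<notin> P"
      from separating_hyperplane_closed_point[OF P(1) compact_imp_closed[OF P(2)] this]
      obtain e b where eb: "e \<bullet> v < b" "\<And>p. p \<in> P \<Longrightarrow> e \<bullet> p > b" by blast
      \<comment> \<open>The slopes \<open>T n\<close> lie in \<open>P\<close>, beyond the
        hyperplane, so every \<open>f n\<close> drops by at least \<open>b\<close> along
        \<open>- e\<close>. The drop survives the limit and excludes the slope
        \<open>v\<close>.\<close>
      have "f n (x - e) \<le> f n x - b" for n
        using subdifferentialD[OF sub[of n "x - e"], of x] eb(2)[OF TP[of n "x - e"]] by (simp add: inner_commute)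
      then have "\<psi> (x - e) \<le> \<psi> x - b"
        by (intro LIMSEQ_le[OF lim[of "x - e"] tendsto_diff[OF lim[of x] tendsto_const]]) auto
      then show False using subdifferentialD[OF v, of "x - e"] eb(1) by (simp add: inner_commute)
    qed
  qed
  have int\<psi>: "(\<integral>x. \<psi> x \<partial>\<mu>) = 0"
  proof -
    have "\<bar>\<integral>x. \<psi> x \<partial>\<mu>\<bar> \<le> e" if e: "e > 0" for e
    proof -
      have "eventually (\<lambda>n. \<forall>x\<in>X. dist (f n x) (\<psi> x) < e) sequentially" by (rule uniform_limitD[OF ul[OF X] e])
      then obtain n where n: "\<And>x. x \<in> X \<Longrightarrow> dist (f n x) (\<psi> x) < e" using eventually_happens'[OF sequentially_bot] by blast
      have i: "integrable \<mu> \<psi>" "integrable \<mu> (f n)" using integrable_mu lipschitz_cont lip lip\<psi> by blast+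
      have "\<bar>\<integral>x. \<psi> x - f n x \<partial>\<mu>\<bar> \<le> (\<integral>x. e \<partial>\<mu>)"
      proof (rule integral_abs_bound_integral[THEN order_trans, OF _ _ _])
        show "integrable \<mu> (\<lambda>x. \<psi> x - f n x)" using i by simp
        show "integrable \<mu> (\<lambda>x. \<bar>\<psi> x - f n x\<bar>)" using i by simp
        show "(\<integral>x. \<bar>\<psi> x - f n x\<bar> \<partial>\<mu>) \<le> (\<integral>x. e \<partial>\<mu>)"
          using AE_X i by (intro integral_mono_AE) (auto elim!: eventually_mono dest!: n simp: dist_real_def)
      qed auto
      then show ?thesis using i int[of n] by simp
    qed
    then show ?thesis by (metis abs_le_zero_iff field_le_epsilon add_0)
  qed
  obtain B where B: "B \<ge> 0" "\<And>x p. x \<in> X \<Longrightarrow> p \<in> P \<Longrightarrow> \<bar>gap x p\<bar> \<le> B" by (rule gap_bounded) blast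
  have sing: "AE x in \<mu>. subdifferential \<psi> x = {sgrad \<psi> x}" by (rule ac[OF AE_subdifferential_singleton[OF \<psi>]])
  have sm [measurable]: "sgrad \<psi> \<in> borel_measurable borel" by (rule borel_measurable_sgrad[OF \<psi>])
  have gm [measurable]: "(\<lambda>x. gap x (S x)) \<in> borel_measurable borel" if [measurable]: "S \<in> borel_measurable borel" for S
    unfolding gap_def by measurable
  have "(\<lambda>n. \<integral>x. gap x (T n x) \<partial>\<mu>) \<longlonglongrightarrow> (\<integral>x. gap x (sgrad \<psi> x) \<partial>\<mu>)"
  proof (rule integral_dominated_convergence[where w = "\<lambda>_. B"])
    show "AE x in \<mu>. (\<lambda>n. gap x (T n x)) \<longlonglongrightarrow> gap x (sgrad \<psi> x)"
      using sing
    proof eventually_elim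
      case (elim x)
      have "(\<lambda>n. T n x) \<longlonglongrightarrow> sgrad \<psi> x"
        by (rule subgradient_convergence[OF lim sub P(2) TP elim])
      moreover have "isCont \<kappa> q" for q using cont_\<kappa> by (simp add: continuous_on_eq_continuous_at)
      ultimately show ?case unfolding gap_def by (intro tendsto_intros isCont_tendsto_compose[where g = \<kappa>])
    qed
    show "AE x in \<mu>. norm (gap x (T n x)) \<le> B" for n using AE_X by eventually_elim (use B TP in auto)
  qed measurable
  then have z: "(\<integral>x. gap x (sgrad \<psi> x) \<partial>\<mu>) = 0" using gap0 LIMSEQ_unique by blast
  have "AE x in \<mu>. gap x (sgrad \<psi> x) = 0"
  proof (subst integral_nonneg_eq_0_iff_AE[symmetric])
    show "AE x in \<mu>. 0 \<le> gap x (sgrad \<psi> x)" using AE_X by eventually_elim (rule gap_nonneg)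
    show "integrable \<mu> (\<lambda>x. gap x (sgrad \<psi> x))"
    proof (rule mu.integrable_const_bound)
      show "AE x in \<mu>. norm (gap x (sgrad \<psi> x)) \<le> B" using AE_X sing
      proof eventually_elim
        case (elim x)
        then have "sgrad \<psi> x \<in> P" using subP[of x] by simp
        then show ?case using B(2)[OF elim(1)] by simp
      qed
    qed measurable
  qed (rule z)
  moreover have "AE x in \<mu>. subdifferential \<phi> x = {sgrad \<phi> x}" by (rule ac[OF AE_subdifferential_singleton[OF phi.convex]])
  ultimately have "AE x in \<mu>. subdifferential \<phi> x \<subseteq> subdifferential \<psi> x"
    using sing
  proof eventually_elim
    case (elim x)
    then have "sgrad \<psi> x \<in> subdifferential \<phi> x" using subP by (intro gap_eq_0_imp) auto
    then show ?case using elim by auto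
  qed
  from AE_mu_\<tau>[OF this] have "AE p in lam. p \<in> subdifferential \<psi> (\<tau> p)"
    using AE_subdifferential_iff by eventually_elim blast
  then show ?thesis by (rule eq_\<phi>I[OF \<psi> subP _ int\<psi>])
qed

text \<open>Slopes in \<open>P\<close> make the \<open>f n\<close> equi-Lipschitz and the zero mean
  bounds them at one point. Every subsequence thus has a locally uniformly convergent one, whose
  limit can only be \<phi>.\<close>

lemma convergence:
  assumes sub: "\<And>n x. T n x \<in> subdifferential (f n) x" and TP: "\<And>n x. T n x \<in> P"
    and meas: "\<And>n. T n \<in> borel_measurable borel" and int: "\<And>n. (\<integral>x. f n x \<partial>\<mu>) = 0"
    and gap0: "(\<lambda>n. \<integral>x. gap x (T n x) \<partial>\<mu>) \<longlonglongrightarrow> 0"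
  shows "compact K \<Longrightarrow> uniform_limit K f \<phi> sequentially"
    and "subdifferential \<phi> x = {v} \<Longrightarrow> (\<lambda>n. T n x) \<longlonglongrightarrow> v"
proof -
  have lip: "L-lipschitz_on UNIV (f n)" for n
  proof (rule lipschitz_onI)
    have *: "f n x - f n y \<le> L * dist x y" for x y
    proof -
      have "f n x - f n y \<le> T n x \<bullet> (x - y)"
        using subdifferentialD[OF sub[of n x], of y] by (simp add: inner_diff_right)
      also have "\<dots> \<le> norm (T n x) * norm (x - y)" by (rule norm_cauchy_schwarz)
      also have "\<dots> \<le> L * dist x y" using L(2)[OF TP] by (simp add: dist_norm mult_right_mono)
      finally show ?thesis .
    qed
    then show "dist (f n x) (f n y) \<le> L * dist x y" for x y
      using *[of x y] *[of y x] by (simp add: dist_real_def abs_le_iff dist_commute)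
  qed (use L(1) in simp)
  obtain x0 where x0: "x0 \<in> X" using X_ne by blast
  have b0: "\<bar>f n x0\<bar> \<le> L * (2 * R)" for n
  proof -
    have i: "integrable \<mu> (f n)" using integrable_mu lipschitz_cont lip by blast
    have "\<bar>\<integral>x. f n x0 - f n x \<partial>\<mu>\<bar> \<le> (\<integral>x. L * (2 * R) \<partial>\<mu>)"
    proof (rule integral_abs_bound_integral[THEN order_trans])
      show "(\<integral>x. \<bar>f n x0 - f n x\<bar> \<partial>\<mu>) \<le> (\<integral>x. L * (2 * R) \<partial>\<mu>)"
      proof (rule integral_mono_AE)
        show "AE x in \<mu>. \<bar>f n x0 - f n x\<bar> \<le> L * (2 * R)"
          using AE_X
        proof eventually_elim
          case (elim x)
          have "dist x0 x \<le> 2 * R" using R(2)[OF elim] R(2)[OF x0] norm_triangle_ineq4[of x0 x] by (simp add: dist_norm)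
          then have "L * dist x0 x \<le> L * (2 * R)" using L(1) by simp
          then show ?case using lipschitz_onD[OF lip[of n], of x0 x] by (simp add: dist_real_def)
        qed
      qed (use i in auto)
    qed (use i in auto)
    then show ?thesis using i int[of n] by simp
  qed
  have ul: "uniform_limit K f \<phi> sequentially" if K: "compact K" for K
  proof (rule uniform_limitI, rule ccontr)
    fix e :: real assume e: "e > 0" and "\<not> eventually (\<lambda>n. \<forall>x\<in>K. dist (f n x) (\<phi> x) < e) sequentially"
    then obtain r0 where r0: "strict_mono (r0 :: nat \<Rightarrow> nat)" "\<And>n. \<not> (\<forall>x\<in>K. dist (f (r0 n) x) (\<phi> x) < e)"
      using not_eventually_sequentiallyD by blast
    obtain r \<psi> where r: "strict_mono (r :: nat \<Rightarrow> nat)" and \<psi>: "L-lipschitz_on UNIV \<psi>"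
      and ul: "\<And>K. compact K \<Longrightarrow> uniform_limit K (\<lambda>n. f (r0 (r n))) \<psi> sequentially"
      by (rule lipschitz_subsequence[of L "\<lambda>n. f (r0 n)" x0 "L * (2 * R)", OF lip b0]) blast
    have "\<psi> = \<phi>"
    proof (rule subsequence_limit[of "\<lambda>n. T (r0 (r n))" "\<lambda>n. f (r0 (r n))"])
      show "(\<lambda>n. \<integral>x. gap x (T (r0 (r n)) x) \<partial>\<mu>) \<longlonglongrightarrow> 0"
        using LIMSEQ_subseq_LIMSEQ[OF LIMSEQ_subseq_LIMSEQ[OF gap0 r0(1)] r] by (simp add: o_def)
    qed (use sub TP meas int lip \<psi> ul in auto)
    then have "eventually (\<lambda>n. \<forall>x\<in>K. dist (f (r0 (r n)) x) (\<phi> x) < e) sequentially"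
      using uniform_limitD[OF ul[OF K] e] by simp
    then obtain n where "\<forall>x\<in>K. dist (f (r0 (r n)) x) (\<phi> x) < e" using eventually_happens'[OF sequentially_bot] by blast
    then show False using r0(2) by blast
  qed
  then show "compact K \<Longrightarrow> uniform_limit K f \<phi> sequentially" .
  have lim: "(\<lambda>n. f n y) \<longlonglongrightarrow> \<phi> y" for y using tendsto_uniform_limitI[OF ul[of "{y}"], of y] by simp
  show "subdifferential \<phi> x = {v} \<Longrightarrow> (\<lambda>n. T n x) \<longlonglongrightarrow> v"
    by (rule subgradient_convergence[OF lim sub P(2) TP])
qed

end

section \<open>The optimal map\<close>

lemma locally_hoelder_on_imp_continuous_on:
  fixes S :: "'a::euclidean_space set"
  assumes "locally_hoelder_on S f" "open S"
  shows "continuous_on S f"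
proof -
  obtain \<alpha> where \<alpha>': "0 < \<alpha> \<and> \<alpha> \<le> 1 \<and>
      (\<forall>K. compact K \<and> K \<subseteq> S \<longrightarrow> (\<exists>C. \<forall>x\<in>K. \<forall>y\<in>K. dist (f x) (f y) \<le> C * dist x y powr \<alpha>))"
    using assms(1) unfolding locally_hoelder_on_def ..
  then have \<alpha>: "0 < \<alpha>" by blast
  have H: "\<exists>C. \<forall>x\<in>K. \<forall>y\<in>K. dist (f x) (f y) \<le> C * dist x y powr \<alpha>" if "compact K" "K \<subseteq> S" for K
    using \<alpha>' that by blast
  have "isCont f x" if x: "x \<in> S" for x
  proof -
    obtain d where d: "d > 0" "cball x d \<subseteq> S" using assms(2) x open_contains_cball by blast
    obtain C where C: "\<And>y z. y \<in> cball x d \<Longrightarrow> z \<in> cball x d \<Longrightarrow> dist (f y) (f z) \<le> C * dist y z powr \<alpha>"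
      using H[OF compact_cball d(2)] by blast
    have "((\<lambda>y. dist (f y) (f x)) \<longlongrightarrow> 0) (at x)"
    proof (rule tendsto_sandwich)
      show "eventually (\<lambda>y. 0 \<le> dist (f y) (f x)) (at x)" by simp
      have "eventually (\<lambda>y. dist y x < d) (at x)" using d(1) eventually_at by blast
      then show "eventually (\<lambda>y. dist (f y) (f x) \<le> C * dist y x powr \<alpha>) (at x)"
        by eventually_elim (use d(1) in \<open>auto intro!: C simp: dist_commute\<close>)
      have "((\<lambda>y. dist y x powr \<alpha>) \<longlongrightarrow> dist x x powr \<alpha>) (at x)"
        using \<alpha> by (intro tendsto_powr' tendsto_intros) auto
      then have "((\<lambda>y. C * dist y x powr \<alpha>) \<longlongrightarrow> C * 0) (at x)"
        using \<alpha> by (intro tendsto_mult tendsto_const) simp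
      then show "((\<lambda>y. C * dist y x powr \<alpha>) \<longlongrightarrow> 0) (at x)" by simp
    qed simp
    then have "(f \<longlongrightarrow> f x) (at x)" by (rule tendsto_dist_iff[THEN iffD2])
    then show ?thesis unfolding isCont_def .
  qed
  then show ?thesis by (simp add: continuous_at_imp_continuous_on)
qed

locale brenier_density = brenier +
  fixes a b :: real
  assumes a: "a > 0" and b: "b > 0"
    and mu_lower: "\<And>E. open E \<Longrightarrow> a * measure lebesgue (E \<inter> X) \<le> measure \<mu> E"
    and mu_upper: "\<And>E. open E \<Longrightarrow> measure \<mu> E \<le> b * measure lebesgue (E \<inter> X)"
    and AE_interior_X: "AE x in \<mu>. x \<in> interior X"
begin

lemma measure_subdifferential_image: "E \<in> sets borel \<Longrightarrow> measure lebesgue (subdifferential_image \<phi> E) = measure \<mu> E"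
  using monge_ampere_eq_imp[of \<phi> \<mu> E] \<phi>_solves mu.emeasure_space_1 sets_\<mu>
  by (auto simp: solves_second_bvp_def measure_def)

sublocale ma_bounds \<phi> X a b L
proof
  show "convex_on UNIV \<phi>" by (rule phi.convex)
  show "norm v \<le> L" if "v \<in> subdifferential \<phi> x" for x v using phi.subdifferential_subset[OF P(1) that] L(2) by blast
  show "\<exists>p0 \<eta> c0. \<eta> > 0 \<and> (\<forall>z. p0 \<bullet> z + \<eta> * norm z - c0 \<le> \<phi> z)"
  proof -
    \<comment> \<open>Coercivity reflects the interior of \<open>P\<close>: testing with
      \<open>p0\<close> shifted by \<open>e\<close> in the direction of \<open>z\<close> gives the
      linear growth.\<close>
    obtain p0 e where e: "e > 0" "cball p0 e \<subseteq> P" using P(3) mem_interior_cball by blast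
    obtain B where B: "B \<ge> 0" "\<And>p. p \<in> P \<Longrightarrow> \<bar>\<kappa> p\<bar> \<le> B" using bounded_on_compact[OF cont_\<kappa> P(2)] by blast
    have "p0 \<bullet> z + e * norm z - B \<le> \<phi> z" for z
    proof (cases "z = 0")
      case True
      have p0: "p0 \<in> P" using e by auto
      show ?thesis using phi.ge[OF p0, of z] B(2)[OF p0] True by simp
    next
      case False
      define p where "p = p0 + (e / norm z) *\<^sub>R z"
      have p: "p \<in> P" using e False by (auto simp: p_def subset_iff dist_norm)
      have "p \<bullet> z = p0 \<bullet> z + e * norm z"
        using False by (simp add: p_def inner_add_left dot_square_norm power2_eq_square)
      then show ?thesis using phi.ge[OF p, of z] B(2)[OF p] by linarith
    qed
    then show ?thesis using e(1) by blast
  qed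
qed (use X a b mu_lower mu_upper measure_subdifferential_image in auto)

text \<open>Set to 0 off \<open>interior X\<close>, a \<mu>-null region, so that continuity on the
  open set makes the map Borel.\<close>

definition T :: "'a \<Rightarrow> 'a" where "T x = (if x \<in> interior X then THE v. v \<in> subdifferential \<phi> x else 0)"

lemma T: assumes "x \<in> interior X" shows "subdifferential \<phi> x = {T x}"
proof -
  obtain v where v: "v \<in> subdifferential \<phi> x" using subdifferential_nonempty[OF phi.convex] .
  have eq: "w = v" if "w \<in> subdifferential \<phi> x" for w
    by (rule subdifferential_singleton_interior[OF assms that v])
  have "(THE w. w \<in> subdifferential \<phi> x) = v" by (rule the_equality[of "\<lambda>w. w \<in> subdifferential \<phi> x", OF v eq])
  then have "T x = v" using assms by (simp add: T_def)
  moreover have "subdifferential \<phi> x = {v}" using v eq by blast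
  ultimately show ?thesis by simp
qed

lemma T_hoelder: "locally_hoelder_on (interior X) T"
  unfolding locally_hoelder_on_def
proof (rule exI[of _ hoelder_exponent], intro conjI hoelder_exponent allI impI)
  fix K assume K: "compact K \<and> K \<subseteq> interior X"
  obtain C where C: "\<And>x y v w. x \<in> K \<Longrightarrow> y \<in> K \<Longrightarrow> v \<in> subdifferential \<phi> x \<Longrightarrow> w \<in> subdifferential \<phi> y
      \<Longrightarrow> dist v w \<le> C * dist x y powr hoelder_exponent"
    by (rule hoelder_subgradient[OF conjunct1[OF K] conjunct2[OF K]]) blast
  show "\<exists>C. \<forall>x\<in>K. \<forall>y\<in>K. dist (T x) (T y) \<le> C * dist x y powr hoelder_exponent"
    using C K T by (intro exI[of _ C]) blast
qed

lemma T_measurable [measurable]: "T \<in> borel_measurable borel"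
proof -
  have "(\<lambda>x. indicator (interior X) x *\<^sub>R T x) \<in> borel_measurable borel"
    by (intro borel_measurable_continuous_on_indicator locally_hoelder_on_imp_continuous_on[OF T_hoelder]) auto
  moreover have "(\<lambda>x. indicator (interior X) x *\<^sub>R T x) = T" by (auto simp: T_def indicator_def)
  ultimately show ?thesis by simp
qed

lemma T_\<tau>: "AE p in lam. T (\<tau> p) = p"
  using AE_mu_\<tau>[OF AE_interior_X] AE_subdifferential_iff
proof eventually_elim
  case (elim p)
  then have "p \<in> {T (\<tau> p)}" using T[OF elim(1)] by blast
  then show ?case by simp
qed

text \<open>\<open>T\<close> undoes \<tau> almost everywhere, and \<tau> pushes \<open>lam\<close>
  to \<mu>.\<close>

lemma push_T: "distr \<mu> borel T = lam"
proof (rule measure_eqI)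
  fix E assume "E \<in> sets (distr \<mu> borel T)"
  then have E [measurable]: "E \<in> sets borel" by simp
  have "emeasure (distr \<mu> borel T) E = emeasure (distr lam borel \<tau>) (T -` E)"
    by (subst emeasure_distr) (auto simp: push_\<tau>)
  also have "\<dots> = emeasure lam (\<tau> -` T -` E)"
    using measurable_sets_borel[OF T_measurable E] by (subst emeasure_distr) auto
  also have "\<dots> = emeasure lam E"
  proof (rule emeasure_eq_AE)
    show "AE p in lam. p \<in> \<tau> -` T -` E \<longleftrightarrow> p \<in> E" using T_\<tau> by eventually_elim simp
    show "\<tau> -` T -` E \<in> sets lam"
      using measurable_sets_borel[OF \<tau>_measurable measurable_sets_borel[OF T_measurable E]] by simp
  qed simp
  finally show "emeasure (distr \<mu> borel T) E = emeasure lam E" .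
qed simp

lemma transport_map_in_P:
  assumes "transport_map \<mu> lam S"
  shows "AE x in \<mu>. S x \<in> P"
proof -
  have [measurable]: "S \<in> measurable \<mu> borel" using assms by (simp add: transport_map_def)
  have d: "distr \<mu> borel S = lam" using assms by (simp add: transport_map_def)
  have "AE p in distr \<mu> borel S. p \<in> P" unfolding d by (rule AE_lam_P)
  then show ?thesis by (rule AE_distrD[rotated]) measurable
qed

text \<open>The mean of \<open>\<kappa> (S x)\<close> is the same for all transport maps, so their
  cost exceeds the constant \<open>- J \<phi>\<close> by exactly the mean gap.\<close>

lemma transport_cost:
  assumes S: "transport_map \<mu> lam S"
  shows "integrable \<mu> (\<lambda>x. gap x (S x))" "(\<integral>x. x \<bullet> S x \<partial>\<mu>) = J \<phi> - (\<integral>x. gap x (S x) \<partial>\<mu>)"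
proof -
  have [measurable]: "S \<in> measurable \<mu> borel" and d: "distr \<mu> borel S = lam" using S by (auto simp: transport_map_def)
  have ixS: "integrable \<mu> (\<lambda>x. x \<bullet> S x)"
  proof (rule mu.integrable_const_bound)
    show "AE x in \<mu>. norm (x \<bullet> S x) \<le> R * L"
      using AE_X transport_map_in_P[OF S] by eventually_elim (use inner_bound in auto)
  qed measurable
  have "integrable (distr \<mu> borel S) \<kappa>" using integrable_lam[OF cont_\<kappa>] by (simp add: d)
  then have i\<kappa>: "integrable \<mu> (\<lambda>x. \<kappa> (S x))" by (subst (asm) integrable_distr_eq) measurable
  have "(\<integral>p. \<kappa> p \<partial>distr \<mu> borel S) = (\<integral>x. \<kappa> (S x) \<partial>\<mu>)" by (rule integral_distr) measurable
  then have e\<kappa>: "(\<integral>x. \<kappa> (S x) \<partial>\<mu>) = (\<integral>p. \<kappa> p \<partial>lam)" by (simp add: d)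
  show "integrable \<mu> (\<lambda>x. gap x (S x))"
    unfolding gap_def using ixS i\<kappa> integrable_mu[OF cont_\<phi>] by auto
  show "(\<integral>x. x \<bullet> S x \<partial>\<mu>) = J \<phi> - (\<integral>x. gap x (S x) \<partial>\<mu>)"
    unfolding gap_def using ixS i\<kappa> integrable_mu[OF cont_\<phi>] e\<kappa> by (simp add: J_def \<kappa>_def[symmetric])
qed

lemma transport_T: "transport_map \<mu> lam T"
  unfolding transport_map_def using push_T by (auto simp: measurable_cong_sets[OF sets_\<mu> refl])

lemma gap_T: "AE x in \<mu>. gap x (T x) = 0"
  using AE_interior_X
proof eventually_elim
  case (elim x)
  then have "T x \<in> subdifferential \<phi> x" using T by simp
  from subgradient_maximizes(1)[OF cont_\<phi> this] show ?case
    using elim interior_subset[of X] by (auto simp: gap_def \<kappa>_def)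
qed

lemma cost_T: "(\<integral>x. x \<bullet> T x \<partial>\<mu>) = J \<phi>"
proof -
  have "(\<integral>x. gap x (T x) \<partial>\<mu>) = 0" by (rule integral_eq_zero_AE[OF gap_T])
  then show ?thesis using transport_cost(2)[OF transport_T] by simp
qed

lemma gap_integral_nonneg: "0 \<le> (\<integral>x. gap x (S x) \<partial>\<mu>)"
  using AE_X by (intro integral_nonneg_AE) (auto elim: eventually_mono simp: gap_nonneg)

lemma optimal_T: "optimal_map \<mu> lam T"
  unfolding optimal_map_def
proof (intro conjI transport_T allI impI)
  fix S assume "transport_map \<mu> lam S"
  then show "(\<integral>x. - (x \<bullet> T x) \<partial>\<mu>) \<le> (\<integral>x. - (x \<bullet> S x) \<partial>\<mu>)"
    using transport_cost(2) gap_integral_nonneg[of S] cost_T by simp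
qed

text \<open>Equal cost forces mean gap 0, so the values of \<open>S\<close> are almost surely
  subgradients of \<phi>, and on \<open>interior X\<close> there is only one.\<close>

lemma optimal_unique:
  assumes S: "optimal_map \<mu> lam S"
  shows "AE x in \<mu>. S x = T x"
proof -
  have tS: "transport_map \<mu> lam S" using S by (simp add: optimal_map_def)
  have "(\<integral>x. - (x \<bullet> S x) \<partial>\<mu>) \<le> (\<integral>x. - (x \<bullet> T x) \<partial>\<mu>)"
    using S transport_T by (auto simp: optimal_map_def)
  then have "(\<integral>x. gap x (S x) \<partial>\<mu>) = 0"
    using transport_cost(2)[OF tS] cost_T gap_integral_nonneg[of S] by simp
  then have "AE x in \<mu>. gap x (S x) = 0"
    using AE_X by (subst integral_nonneg_eq_0_iff_AE[OF transport_cost(1)[OF tS], symmetric])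
      (auto elim: eventually_mono simp: gap_nonneg)
  then show ?thesis
    using AE_interior_X transport_map_in_P[OF tS]
    by eventually_elim (use gap_eq_0_imp T in blast)
qed

end


section \<open>Softmax weights and matchings\<close>

definition softmax :: "'b set \<Rightarrow> ('b \<Rightarrow> real) \<Rightarrow> 'b \<Rightarrow> real" where
  "softmax A h a = exp (h a) / (\<Sum>a'\<in>A. exp (h a'))"

context
  fixes A :: "'b set" and h :: "'b \<Rightarrow> real"
  assumes A: "finite A" "A \<noteq> {}"
begin

lemma sum_exp_pos: "0 < (\<Sum>a\<in>A. exp (h a))"
  using A by (intro sum_pos) auto

lemma softmax_pos: "0 < softmax A h a"
  using sum_exp_pos by (simp add: softmax_def)

lemma sum_softmax: "(\<Sum>a\<in>A. softmax A h a) = 1"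
  using sum_exp_pos by (simp add: softmax_def sum_divide_distrib[symmetric])

lemma ln_sum_exp_ge: "a \<in> A \<Longrightarrow> h a \<le> ln (\<Sum>a\<in>A. exp (h a))"
  using A by (subst ln_ge_iff[OF sum_exp_pos]) (auto intro: member_le_sum)

lemma ln_sum_exp_bound:
  assumes "\<And>a. a \<in> A \<Longrightarrow> \<bar>h a\<bar> \<le> B"
  shows "\<bar>ln (\<Sum>a\<in>A. exp (h a))\<bar> \<le> ln (card A) + B"
proof -
  have cA: "1 \<le> real (card A)" using A by (simp add: Suc_leI card_gt_0_iff)
  obtain a where a: "a \<in> A" using A by blast
  have "- B \<le> ln (\<Sum>a\<in>A. exp (h a))" using ln_sum_exp_ge[OF a] assms[OF a] by linarith
  moreover have "(\<Sum>a\<in>A. exp (h a)) \<le> (\<Sum>a\<in>A. exp B)"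
    using assms by (intro sum_mono) (force simp: abs_le_iff)
  then have "ln (\<Sum>a\<in>A. exp (h a)) \<le> ln (real (card A) * exp B)"
    using sum_exp_pos by (intro ln_mono) auto
  then have "ln (\<Sum>a\<in>A. exp (h a)) \<le> ln (card A) + B" using cA by (simp add: ln_mult)
  moreover have "0 \<le> ln (real (card A))" using cA by simp
  ultimately show ?thesis by simp
qed

text \<open>The softmax weights are the gradient of log-sum-exp. The inequality is Jensen's for
  \<open>exp\<close>, by the tangent of \<open>exp\<close> at the weighted mean \<open>m\<close> of
  \<open>d\<close>.\<close>

lemma ln_sum_exp_subgradient:
  "ln (\<Sum>a\<in>A. exp (h a)) + (\<Sum>a\<in>A. softmax A h a * d a) \<le> ln (\<Sum>a\<in>A. exp (h a + d a))"
proof -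
  define m where "m = (\<Sum>a\<in>A. softmax A h a * d a)"
  have "exp m = (\<Sum>a\<in>A. softmax A h a * (exp m * (1 + (d a - m))))"
  proof -
    have "(\<Sum>a\<in>A. softmax A h a * (exp m * (1 + (d a - m))))
      = exp m * ((\<Sum>a\<in>A. softmax A h a) * (1 - m) + (\<Sum>a\<in>A. softmax A h a * d a))"
      by (simp add: sum_distrib_left sum_distrib_right sum.distrib[symmetric] algebra_simps)
    then show ?thesis by (simp add: sum_softmax m_def)
  qed
  also have "\<dots> \<le> (\<Sum>a\<in>A. softmax A h a * exp (d a))"
  proof (intro sum_mono mult_left_mono)
    fix a
    have "exp m * (1 + (d a - m)) \<le> exp m * exp (d a - m)" by (intro mult_left_mono exp_ge_add_one_self) auto
    also have "\<dots> = exp (d a)" by (simp flip: exp_add)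
    finally show "exp m * (1 + (d a - m)) \<le> exp (d a)" .
  qed (use softmax_pos less_imp_le in auto)
  also have "\<dots> = (\<Sum>a\<in>A. exp (h a + d a)) / (\<Sum>a\<in>A. exp (h a))"
    by (simp add: softmax_def sum_divide_distrib exp_add)
  finally have "exp m * (\<Sum>a\<in>A. exp (h a)) \<le> (\<Sum>a\<in>A. exp (h a + d a))"
    using sum_exp_pos by (simp add: pos_le_divide_eq)
  then have "ln (exp m * (\<Sum>a\<in>A. exp (h a))) \<le> ln (\<Sum>a\<in>A. exp (h a + d a))"
    using sum_exp_pos by (intro ln_mono) auto
  then show ?thesis using sum_exp_pos by (simp add: ln_mult m_def)
qed

text \<open>The entropy of the softmax weights is at most \<open>ln (card A)\<close>.\<close>

lemma softmax_mean_ge: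
  assumes a0: "a0 \<in> A"
  shows "h a0 - ln (card A) \<le> (\<Sum>a\<in>A. softmax A h a * h a)"
proof -
  have cA: "0 < real (card A)" using A by (simp add: card_gt_0_iff)
  define S where "S = (\<Sum>a\<in>A. exp (h a))"
  have S: "S > 0" unfolding S_def by (rule sum_exp_pos)
  have "softmax A h a * (ln S - h a - ln (card A)) \<le> 1 / card A - softmax A h a" for a
  proof -
    have w: "softmax A h a > 0" by (rule softmax_pos)
    \<comment> \<open>The bound \<open>ln z \<le> z - 1\<close> at the ratio of the uniform weight
      to the softmax weight: nonnegativity of relative entropy, term by term.\<close>
    have "ln (1 / (softmax A h a * card A)) \<le> 1 / (softmax A h a * card A) - 1"
      using w cA by (intro ln_le_minus_one) auto
    moreover have "ln (1 / (softmax A h a * card A)) = ln S - h a - ln (card A)"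
      using w cA S by (simp add: ln_div ln_mult softmax_def S_def[symmetric])
    ultimately have "softmax A h a * (ln S - h a - ln (card A)) \<le> softmax A h a * (1 / (softmax A h a * card A) - 1)"
      using w by (intro mult_left_mono) auto
    also have "\<dots> = 1 / card A - softmax A h a" using w by (simp add: right_diff_distrib)
    finally show ?thesis .
  qed
  then have "(\<Sum>a\<in>A. softmax A h a * (ln S - h a - ln (card A))) \<le> (\<Sum>a\<in>A. 1 / card A - softmax A h a)"
    by (rule sum_mono)
  also have "\<dots> = 0" using cA by (simp add: sum_subtractf sum_softmax)
  also have "(\<Sum>a\<in>A. softmax A h a * (ln S - h a - ln (card A)))
    = (ln S - ln (card A)) * (\<Sum>a\<in>A. softmax A h a) - (\<Sum>a\<in>A. softmax A h a * h a)"
    by (simp add: sum_distrib_left sum_subtractf[symmetric] algebra_simps)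
  finally show ?thesis using ln_sum_exp_ge[OF a0] by (simp add: sum_softmax S_def)
qed

end

text \<open>Within each label class pair off as many elements as both sides possess, and complete by
  any bijection of the leftovers. Mismatches occur only among leftovers, per label at most the
  excess of \<open>A\<close> over \<open>B\<close>.\<close>

lemma matching_permutation:
  fixes A B :: "'b \<Rightarrow> 'l"
  assumes S: "finite S" and \<Lambda>: "finite \<Lambda>" "A ` S \<subseteq> \<Lambda>"
  obtains \<sigma> where "\<sigma> permutes S"
    "real (card {i \<in> S. A i \<noteq> B (\<sigma> i)}) \<le> (\<Sum>l\<in>\<Lambda>. \<bar>real (card {i \<in> S. A i = l}) - real (card {j \<in> S. B j = l})\<bar>)"
proof -
  define a where "a l = {i \<in> S. A i = l}" for l
  define b where "b l = {i \<in> S. B i = l}" for l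
  define m where "m l = min (card (a l)) (card (b l))" for l
  have fin: "finite (a l)" "finite (b l)" for l using S by (auto simp: a_def b_def)
  have "\<forall>l. \<exists>U V f. U \<subseteq> a l \<and> V \<subseteq> b l \<and> card U = m l \<and> bij_betw f U V"
  proof
    fix l
    have "m l \<le> card (a l)" "m l \<le> card (b l)" by (simp_all add: m_def)
    then obtain U V where U: "U \<subseteq> a l" "card U = m l" and V: "V \<subseteq> b l" "card V = m l"
      by (meson obtain_subset_with_card_n)
    obtain f where "bij_betw f U V"
      using finite_same_card_bij[of U V] U(2) V(2) finite_subset[OF U(1) fin(1)] finite_subset[OF V(1) fin(2)] by auto
    with U V show "\<exists>U V f. U \<subseteq> a l \<and> V \<subseteq> b l \<and> card U = m l \<and> bij_betw f U V" by blast
  qed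
  then obtain U V f where U: "\<And>l. U l \<subseteq> a l" and V: "\<And>l. V l \<subseteq> b l" and cU: "\<And>l. card (U l) = m l"
    and f: "\<And>l. bij_betw (f l) (U l) (V l)" unfolding choice_iff by blast
  define UU where "UU = (\<Union>l\<in>\<Lambda>. U l)"
  define VV where "VV = (\<Union>l\<in>\<Lambda>. V l)"
  define F where "F i = f (A i) i" for i
  have AU: "A i = l" if "i \<in> U l" for i l using U that by (auto simp: a_def)
  have FU: "F i = f l i" if "i \<in> U l" for i l using AU[OF that] by (simp add: F_def)
  have BV: "B j = l" if "j \<in> V l" for j l using V that by (auto simp: b_def)
  have fV: "f l i \<in> V l" if "i \<in> U l" for i l using f[of l] that by (auto simp: bij_betw_def)
  have bF: "bij_betw F UU VV"
    unfolding bij_betw_def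
  proof
    show "inj_on F UU"
    proof (rule inj_onI)
      fix i j assume ij: "i \<in> UU" "j \<in> UU" "F i = F j"
      obtain l l' where l: "i \<in> U l" "j \<in> U l'" using ij by (auto simp: UU_def)
      have "f l i = f l' j" using ij(3) FU l by simp
      then have "l = l'" using BV[OF fV[OF l(1)]] BV[OF fV[OF l(2)]] by simp
      then show "i = j" using f[of l] l \<open>f l i = f l' j\<close> by (auto simp: bij_betw_def inj_on_def)
    qed
    show "F ` UU = VV"
    proof
      show "F ` UU \<subseteq> VV" using fV FU by (auto simp: UU_def VV_def)
      show "VV \<subseteq> F ` UU"
      proof
        fix j assume "j \<in> VV"
        then obtain l where l: "l \<in> \<Lambda>" "j \<in> V l" by (auto simp: VV_def)
        then obtain i where i: "i \<in> U l" "j = f l i" using f[of l] by (auto simp: bij_betw_def)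
        then have "i \<in> UU" "F i = j" using l FU[OF i(1)] by (auto simp: UU_def)
        then show "j \<in> F ` UU" by blast
      qed
    qed
  qed
  have sub: "UU \<subseteq> S" "VV \<subseteq> S" using U V by (auto simp: UU_def VV_def a_def b_def)
  have "card (S - UU) = card (S - VV)"
    using bij_betw_same_card[OF bF] sub S by (simp add: card_Diff_subset finite_subset)
  then obtain G where G: "bij_betw G (S - UU) (S - VV)"
    using finite_same_card_bij[of "S - UU" "S - VV"] S by blast
  define \<sigma> where "\<sigma> i = (if i \<in> UU then F i else if i \<in> S then G i else i)" for i
  have "bij_betw \<sigma> (UU \<union> (S - UU)) (VV \<union> (S - VV))"
  proof (rule bij_betw_combine)
    show "bij_betw \<sigma> UU VV" using bF by (subst bij_betw_cong[of UU \<sigma> F]) (auto simp: \<sigma>_def)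
    show "bij_betw \<sigma> (S - UU) (S - VV)" using G by (subst bij_betw_cong[of "S - UU" \<sigma> G]) (auto simp: \<sigma>_def)
  qed auto
  then have "bij_betw \<sigma> S S" using sub by (simp add: Un_absorb1)
  then have perm: "\<sigma> permutes S" using sub by (intro bij_imp_permutes) (auto simp: \<sigma>_def)
  have "{i \<in> S. A i \<noteq> B (\<sigma> i)} \<subseteq> S - UU"
  proof
    fix i assume i: "i \<in> {i \<in> S. A i \<noteq> B (\<sigma> i)}"
    have "A i = B (\<sigma> i)" if "i \<in> UU"
    proof -
      obtain l where l: "i \<in> U l" using \<open>i \<in> UU\<close> by (auto simp: UU_def)
      then have "\<sigma> i = f l i" using FU \<open>i \<in> UU\<close> by (simp add: \<sigma>_def)
      then show ?thesis using BV[OF fV[OF l]] AU[OF l] by simp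
    qed
    then show "i \<in> S - UU" using i by blast
  qed
  then have "card {i \<in> S. A i \<noteq> B (\<sigma> i)} \<le> card (S - UU)" using S by (intro card_mono) auto
  also have "real (card (S - UU)) = real (card S) - real (card UU)"
    using sub S by (simp add: card_Diff_subset finite_subset of_nat_diff card_mono)
  also have "card UU = (\<Sum>l\<in>\<Lambda>. card (U l))"
  proof -
    have "U l \<inter> U l' = {}" if "l \<noteq> l'" for l l' using AU that by blast
    then show ?thesis
      unfolding UU_def using \<Lambda>(1) finite_subset[OF U fin(1)] by (intro card_UN_disjoint) auto
  qed
  also have "card S = (\<Sum>l\<in>\<Lambda>. card (a l))"
  proof -
    have "S = (\<Union>l\<in>\<Lambda>. a l)" using \<Lambda>(2) by (auto simp: a_def)
    moreover have "card (\<Union>l\<in>\<Lambda>. a l) = (\<Sum>l\<in>\<Lambda>. card (a l))"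
      using \<Lambda>(1) fin(1) by (intro card_UN_disjoint) (auto simp: a_def)
    ultimately show ?thesis by simp
  qed
  finally have "real (card {i \<in> S. A i \<noteq> B (\<sigma> i)}) \<le> (\<Sum>l\<in>\<Lambda>. real (card (a l)) - real (m l))"
    by (simp add: cU sum_subtractf)
  also have "\<dots> \<le> (\<Sum>l\<in>\<Lambda>. \<bar>real (card (a l)) - real (card (b l))\<bar>)"
    by (intro sum_mono) (auto simp: m_def min_def)
  finally show ?thesis using perm that by (simp add: a_def b_def)
qed

section \<open>Riemann sums over lattice points\<close>

lemma lattice_points_iff:
  assumes "k > 0"
  shows "z \<in> lattice_points A k \<longleftrightarrow> (1 / real k) *\<^sub>R z \<in> A \<and> (\<forall>i. z $ i \<in> \<int>)"
proof
  assume "z \<in> lattice_points A k"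
  then show "(1 / real k) *\<^sub>R z \<in> A \<and> (\<forall>i. z $ i \<in> \<int>)" using assms by (auto simp: lattice_points_def)
next
  assume *: "(1 / real k) *\<^sub>R z \<in> A \<and> (\<forall>i. z $ i \<in> \<int>)"
  then have "z = real k *\<^sub>R ((1 / real k) *\<^sub>R z)" using assms by simp
  then have "z \<in> (\<lambda>x. real k *\<^sub>R x) ` A" using * by blast
  then show "z \<in> lattice_points A k" using * by (simp add: lattice_points_def)
qed

lemma finite_vec_components:
  assumes "finite S"
  shows "finite {z :: 'b ^ 'n. \<forall>i. z $ i \<in> S}"
proof -
  have "{z :: 'b ^ 'n. \<forall>i. z $ i \<in> S} \<subseteq> vec_lambda ` (UNIV \<rightarrow>\<^sub>E S)"
  proof
    fix z :: "'b ^ 'n" assume "z \<in> {z. \<forall>i. z $ i \<in> S}"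
    then have "($) z \<in> UNIV \<rightarrow>\<^sub>E S" by auto
    then show "z \<in> vec_lambda ` (UNIV \<rightarrow>\<^sub>E S)" by (intro image_eqI[of _ _ "($) z"]) auto
  qed
  moreover have "finite (vec_lambda ` ((UNIV :: 'n set) \<rightarrow>\<^sub>E S) :: ('b ^ 'n) set)"
    using assms by (intro finite_imageI finite_PiE) auto
  ultimately show ?thesis by (rule finite_subset)
qed

lemma finite_lattice_points:
  fixes A :: "(real ^ 'n) set"
  assumes "bounded A"
  shows "finite (lattice_points A k)"
proof -
  obtain B where B: "\<And>x. x \<in> A \<Longrightarrow> norm x \<le> B" using assms by (auto simp: bounded_iff)
  have "lattice_points A k \<subseteq> {z. \<forall>i. z $ i \<in> real_of_int ` {- \<lceil>real k * B\<rceil>..\<lceil>real k * B\<rceil>}}"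
  proof
    fix z assume z: "z \<in> lattice_points A k"
    then obtain x where x: "x \<in> A" "z = real k *\<^sub>R x" by (auto simp: lattice_points_def)
    have "z $ i \<in> real_of_int ` {- \<lceil>real k * B\<rceil>..\<lceil>real k * B\<rceil>}" for i
    proof -
      obtain j where j: "z $ i = real_of_int j" using z by (auto simp: lattice_points_def elim: Ints_cases)
      have "\<bar>z $ i\<bar> \<le> norm z" by (rule component_le_norm_cart)
      also have "\<dots> \<le> real k * B" using B[OF x(1)] by (simp add: x(2) mult_left_mono)
      finally have "\<bar>real_of_int j\<bar> \<le> real_of_int \<lceil>real k * B\<rceil>" using le_of_int_ceiling[of "real k * B"] j by linarith
      then have "- \<lceil>real k * B\<rceil> \<le> j" "j \<le> \<lceil>real k * B\<rceil>" by linarith+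
      then show ?thesis using j by (intro image_eqI[of _ _ j]) auto
    qed
    then show "z \<in> {z. \<forall>i. z $ i \<in> real_of_int ` {- \<lceil>real k * B\<rceil>..\<lceil>real k * B\<rceil>}}" by blast
  qed
  moreover have "finite {z :: real ^ 'n. \<forall>i. z $ i \<in> real_of_int ` {- \<lceil>real k * B\<rceil>..\<lceil>real k * B\<rceil>}}"
    by (intro finite_vec_components) auto
  ultimately show ?thesis by (rule finite_subset)
qed

text \<open>The lower corner of the grid cell of mesh \<open>1 / k\<close> containing
  \<open>x\<close>, in integer coordinates. It serves the Riemann sums at scale \<open>k\<close> and
  also the coarse partition of \<open>P\<close> at a fixed scale \<open>m\<close>.\<close>

definition lattice_floor :: "nat \<Rightarrow> real ^ 'n \<Rightarrow> real ^ 'n" where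
  "lattice_floor k x = (\<chi> i. of_int \<lfloor>real k * x $ i\<rfloor>)"

lemma norm_lattice_floor:
  fixes x :: "real ^ 'n"
  assumes "k > 0"
  shows "norm ((1 / real k) *\<^sub>R lattice_floor k x - x) \<le> real CARD('n) / real k"
proof -
  have "norm ((1 / real k) *\<^sub>R lattice_floor k x - x) \<le> (\<Sum>i\<in>UNIV. \<bar>((1 / real k) *\<^sub>R lattice_floor k x - x) $ i\<bar>)"
    by (rule norm_le_l1_cart)
  also have "\<dots> \<le> (\<Sum>i\<in>(UNIV :: 'n set). 1 / real k)"
  proof (rule sum_mono)
    fix i :: 'n
    have "((1 / real k) *\<^sub>R lattice_floor k x - x) $ i = (of_int \<lfloor>real k * x $ i\<rfloor> - real k * x $ i) / real k"
      using assms by (simp add: lattice_floor_def diff_divide_distrib)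
    moreover have "\<bar>of_int \<lfloor>real k * x $ i\<rfloor> - real k * x $ i\<bar> \<le> 1" by linarith
    ultimately show "\<bar>((1 / real k) *\<^sub>R lattice_floor k x - x) $ i\<bar> \<le> 1 / real k"
      using assms by (simp add: abs_divide divide_right_mono)
  qed
  finally show ?thesis by simp
qed

lemma lattice_cell:
  fixes z :: "real ^ 'n"
  assumes k: "k > 0" and z: "\<And>i. z $ i \<in> \<int>"
  defines "C \<equiv> {x. lattice_floor k x = z}"
  shows "C \<in> sets borel" "measure lborel C = 1 / real k ^ CARD('n)" "emeasure lborel C < \<infinity>" "convex C"
proof -
  define u where "u = (1 / real k) *\<^sub>R z"
  define v where "v = (1 / real k) *\<^sub>R (z + (\<chi> i. 1))"
  have eq: "C = {x. \<forall>i. u $ i \<le> x $ i \<and> x $ i < v $ i}"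
  proof (rule Collect_eqI[of "\<lambda>x. lattice_floor k x = z", folded C_def])
    fix x
    have "of_int \<lfloor>real k * x $ i\<rfloor> = z $ i \<longleftrightarrow> u $ i \<le> x $ i \<and> x $ i < v $ i" for i
    proof -
      obtain j where j: "z $ i = of_int j" using z[of i] by (auto elim: Ints_cases)
      have "u $ i \<le> x $ i \<longleftrightarrow> of_int j \<le> real k * x $ i" "x $ i < v $ i \<longleftrightarrow> real k * x $ i < of_int j + 1"
        using k j by (auto simp: u_def v_def pos_divide_le_eq pos_less_divide_eq mult.commute)
      then show ?thesis using j by (simp add: floor_eq_iff)
    qed
    then show "(lattice_floor k x = z) = (\<forall>i. u $ i \<le> x $ i \<and> x $ i < v $ i)"
      by (simp add: lattice_floor_def vec_eq_iff)
  qed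
  have half: "C = (\<Inter>i\<in>UNIV. {x. u $ i \<le> x $ i} \<inter> {x. x $ i < v $ i})" using eq by auto
  have "{x :: real ^ 'n. c \<le> x $ i} = {x. axis i 1 \<bullet> x \<ge> c}" "{x :: real ^ 'n. x $ i < c} = {x. axis i 1 \<bullet> x < c}" for c i
    by (simp_all add: inner_axis' )
  then show "convex C" unfolding half by (intro convex_INT convex_Int) (simp_all add: convex_halfspace_ge convex_halfspace_lt)
  have "C = (\<Inter>i\<in>UNIV. {x. u $ i \<le> x $ i} \<inter> {x. x $ i < v $ i})" by (rule half)
  also have "\<dots> \<in> sets borel"
    by (intro sets.countable_INT' sets.Int borel_closed borel_open closed_Collect_le open_Collect_less continuous_intros) auto
  finally show C: "C \<in> sets borel" .
  have bx: "box u v \<subseteq> C" "C \<subseteq> cbox u v"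
    unfolding eq by (auto simp: mem_box_cart less_imp_le)
  have uv: "u $ i \<le> v $ i" for i using k by (simp add: u_def v_def divide_right_mono)
  then have ne: "cbox u v \<noteq> {}" by (simp add: interval_ne_empty_cart)
  have "measure lborel (cbox u v) = (\<Prod>i\<in>(UNIV :: 'n set). v $ i - u $ i)" using ne by (rule content_cbox_cart)
  also have "\<dots> = 1 / real k ^ CARD('n)" using k by (simp add: u_def v_def add_divide_distrib power_divide power_one_over)
  finally have m: "measure lborel (cbox u v) = 1 / real k ^ CARD('n)" .
  have e: "emeasure lborel (box u v) = emeasure lborel (cbox u v)"
    by (simp only: emeasure_lborel_box_eq emeasure_lborel_cbox_eq)
  have "emeasure lborel (box u v) \<le> emeasure lborel C" "emeasure lborel C \<le> emeasure lborel (cbox u v)"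
    using bx C by (auto intro!: emeasure_mono)
  then have "emeasure lborel C = emeasure lborel (cbox u v)" using e by simp
  then show "measure lborel C = 1 / real k ^ CARD('n)" "emeasure lborel C < \<infinity>"
    using m emeasure_lborel_cbox_finite[of u v] by (auto simp: measure_def less_top)
qed

text \<open>The normalised sum is the integral of the step function evaluating
  \<open>indicator A * f\<close> at the rounded point. Rounding moves points by
  \<open>O(1 / k)\<close>, so the step functions converge off \<open>frontier A\<close>, with
  bounded range and a common bounded support.\<close>

lemma riemann_sum_lattice:
  fixes A :: "(real ^ 'n) set" and f :: "real ^ 'n \<Rightarrow> real"
  assumes A: "bounded A" "A \<in> sets borel" "negligible (frontier A)" and f: "continuous_on UNIV f"
  shows "(\<lambda>k. (\<Sum>z\<in>lattice_points A k. f ((1 / real k) *\<^sub>R z)) / real k ^ CARD('n))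
    \<longlonglongrightarrow> (\<integral>x. indicator A x * f x \<partial>lborel)"
proof -
  define C where "C k z = {x. lattice_floor k x = z}" for k and z :: "real ^ 'n"
  define g where "g k x = (\<Sum>z\<in>lattice_points A k. f ((1 / real k) *\<^sub>R z) * indicator (C k z) x)" for k x
  have fm [measurable]: "f \<in> borel_measurable borel" by (rule borel_measurable_continuous_onI[OF f])
  note [measurable] = A(2)
  have g_eq: "g k x = indicator A ((1 / real k) *\<^sub>R lattice_floor k x) * f ((1 / real k) *\<^sub>R lattice_floor k x)"
    if k: "k > 0" for k x
  proof -
    have "g k x = (\<Sum>z\<in>lattice_points A k. if lattice_floor k x = z then f ((1 / real k) *\<^sub>R z) else 0)"
      unfolding g_def by (intro sum.cong) (auto simp: C_def)
    also have "\<dots> = (if lattice_floor k x \<in> lattice_points A k then f ((1 / real k) *\<^sub>R lattice_floor k x) else 0)"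
      using finite_lattice_points[OF A(1)] by simp
    also have "lattice_floor k x \<in> lattice_points A k \<longleftrightarrow> (1 / real k) *\<^sub>R lattice_floor k x \<in> A"
      using k by (simp add: lattice_points_iff lattice_floor_def)
    finally show ?thesis by simp
  qed
  obtain r where r: "\<And>x. x \<in> A \<Longrightarrow> norm x \<le> r" using A(1) by (auto simp: bounded_iff)
  have "compact (f ` cball 0 r)" using f by (meson compact_cball compact_continuous_image continuous_on_subset subset_UNIV)
  then obtain B where B0: "B > 0" and B: "\<And>x. norm x \<le> r \<Longrightarrow> \<bar>f x\<bar> \<le> B"
    using compact_imp_bounded by (force simp: bounded_pos)
  define D where "D = cball (0 :: real ^ 'n) (r + real CARD('n))"
  have int_g: "(\<integral>x. g k x \<partial>lborel) = (\<Sum>z\<in>lattice_points A k. f ((1 / real k) *\<^sub>R z)) / real k ^ CARD('n)" if k: "k > 0" for k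
  proof -
    have C: "C k z \<in> sets borel" "measure lborel (C k z) = 1 / real k ^ CARD('n)" "emeasure lborel (C k z) < \<infinity>"
      if "z \<in> lattice_points A k" for z
      using lattice_cell[OF k, of z] that k by (auto simp: C_def lattice_points_iff)
    have "(\<integral>x. g k x \<partial>lborel) = (\<Sum>z\<in>lattice_points A k. \<integral>x. f ((1 / real k) *\<^sub>R z) * indicator (C k z) x \<partial>lborel)"
      unfolding g_def using C by (intro Bochner_Integration.integral_sum integrable_mult_right integrable_real_indicator) auto
    also have "\<dots> = (\<Sum>z\<in>lattice_points A k. f ((1 / real k) *\<^sub>R z) * (1 / real k ^ CARD('n)))"
      using C by (intro sum.cong) (auto simp: less_top)
    finally show ?thesis by (simp add: sum_divide_distrib)
  qed
  have fr: "AE x in lborel. x \<notin> frontier A"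
  proof (rule AE_not_in)
    have "frontier A \<in> sets borel" by simp
    then show "frontier A \<in> null_sets lborel" using A(3) by (simp add: negligible_iff_null_sets null_sets_completion_iff)
  qed
  have conv: "(\<lambda>k. (1 / real k) *\<^sub>R lattice_floor k x) \<longlonglongrightarrow> x" for x :: "real ^ 'n"
  proof (rule LIM_zero_cancel, rule Lim_null_comparison)
    show "eventually (\<lambda>k. norm ((1 / real k) *\<^sub>R lattice_floor k x - x) \<le> real CARD('n) / real k) sequentially"
      using eventually_gt_at_top[of 0] by eventually_elim (rule norm_lattice_floor)
    show "(\<lambda>k. real CARD('n) / real k) \<longlonglongrightarrow> 0" by (rule lim_const_over_n)
  qed
  \<comment> \<open>The index is shifted because rounding at scale 0 is degenerate.\<close>
  have "(\<lambda>k. \<integral>x. g (Suc k) x \<partial>lborel) \<longlonglongrightarrow> (\<integral>x. indicator A x * f x \<partial>lborel)"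
  proof (rule integral_dominated_convergence[where w = "\<lambda>x. B * indicator D x"])
    show "(\<lambda>x. indicator A x * f x) \<in> borel_measurable lborel" by measurable
    show "g (Suc k) \<in> borel_measurable lborel" for k
    proof -
      have "C (Suc k) z \<in> sets borel" if "z \<in> lattice_points A (Suc k)" for z
        using lattice_cell(1)[of "Suc k" z] that by (auto simp: C_def lattice_points_iff)
      then show ?thesis unfolding g_def by (intro borel_measurable_sum borel_measurable_times) auto
    qed
    show "integrable lborel (\<lambda>x. B * indicator D x)"
      unfolding D_def by (intro integrable_mult_right integrable_real_indicator) (use emeasure_bounded_finite[OF bounded_cball, of "0 :: real ^ 'n" "r + real CARD('n)"] in \<open>auto simp: less_top\<close>)
    show "AE x in lborel. (\<lambda>k. g (Suc k) x) \<longlonglongrightarrow> indicator A x * f x"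
      using fr
    proof eventually_elim
      case (elim x)
      have fl: "(\<lambda>k. f ((1 / real k) *\<^sub>R lattice_floor k x)) \<longlonglongrightarrow> f x"
        using f conv[of x] by (intro isCont_tendsto_compose[where g = f]) (auto simp: continuous_on_eq_continuous_at)
      consider "x \<in> interior A" | "x \<notin> closure A" using elim by (auto simp: frontier_def)
      then have "(\<lambda>k. g k x) \<longlonglongrightarrow> indicator A x * f x"
      proof cases
        case 1
        then have "eventually (\<lambda>k. (1 / real k) *\<^sub>R lattice_floor k x \<in> interior A) sequentially"
          by (intro topological_tendstoD[OF conv] open_interior)
        then have ev: "eventually (\<lambda>k. f ((1 / real k) *\<^sub>R lattice_floor k x) = g k x) sequentially"
          using eventually_gt_at_top[of 0]
          by eventually_elim (use interior_subset[of A] g_eq in \<open>auto simp: indicator_def\<close>)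
        have "x \<in> A" using 1 interior_subset by blast
        then show ?thesis using Lim_transform_eventually[OF fl ev] by simp
      next
        case 2
        then have "eventually (\<lambda>k. (1 / real k) *\<^sub>R lattice_floor k x \<in> - closure A) sequentially"
          by (intro topological_tendstoD[OF conv]) auto
        then have ev: "eventually (\<lambda>k. 0 = g k x) sequentially"
          using eventually_gt_at_top[of 0]
          by eventually_elim (use closure_subset[of A] g_eq in \<open>auto simp: indicator_def\<close>)
        have "x \<notin> A" using 2 closure_subset by blast
        then show ?thesis using Lim_transform_eventually[OF tendsto_const ev] by simp
      qed
      then show ?case by (rule LIMSEQ_Suc)
    qed
    show "AE x in lborel. norm (g (Suc k) x) \<le> B * indicator D x" for k
    proof (intro AE_I2)
      fix x :: "real ^ 'n"
      let ?y = "(1 / real (Suc k)) *\<^sub>R lattice_floor (Suc k) x"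
      show "norm (g (Suc k) x) \<le> B * indicator D x"
      proof (cases "?y \<in> A")
        case True
        have "norm (?y - x) \<le> real CARD('n) / real (Suc k)" by (rule norm_lattice_floor) simp
        also have "\<dots> \<le> real CARD('n) / 1" by (intro divide_left_mono) auto
        finally have "norm (?y - x) \<le> real CARD('n)" by simp
        then have "norm x \<le> r + real CARD('n)" using r[OF True] norm_triangle_sub[of x ?y] by (simp add: norm_minus_commute)
        then have "x \<in> D" by (simp add: D_def)
        then show ?thesis using B[OF r[OF True]] g_eq[of "Suc k" x] True by (simp del: of_nat_Suc)
      next
        case False
        then show ?thesis using B0 g_eq[of "Suc k" x] by (simp del: of_nat_Suc)
      qed
    qed
  qed
  then have "(\<lambda>k. (\<Sum>z\<in>lattice_points A (Suc k). f ((1 / real (Suc k)) *\<^sub>R z)) / real (Suc k) ^ CARD('n))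
    \<longlonglongrightarrow> (\<integral>x. indicator A x * f x \<partial>lborel)"
    by (simp only: int_g[OF zero_less_Suc])
  then show ?thesis by (rule LIMSEQ_imp_Suc)
qed


section \<open>The potentials \<open>phiN\<close>\<close>

text \<open>The subgradient inequalities at \<open>x\<close> and at \<open>x + h\<close> enclose the
  first-order remainder between 0 and \<open>(T (x + h) - T x) \<bullet> h\<close>.\<close>

lemma gderiv_of_subgradients:
  fixes f :: "'a::real_inner \<Rightarrow> real"
  assumes sub: "\<And>x. T x \<in> subdifferential f x" and cont: "isCont T x"
  shows "GDERIV f x :> T x"
  unfolding gderiv_def has_derivative_at
proof (intro conjI)
  show "bounded_linear (\<lambda>h. h \<bullet> T x)" by (rule bounded_linear_inner_left)
  show "((\<lambda>h. norm (f (x + h) - f x - h \<bullet> T x) / norm h) \<longlongrightarrow> 0) (at 0)"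
  proof (rule Lim_null_comparison)
    have "norm (norm (f (x + h) - f x - h \<bullet> T x) / norm h) \<le> norm (T (x + h) - T x)" for h
    proof (cases "h = 0")
      case False
      have "0 \<le> f (x + h) - f x - h \<bullet> T x"
        using subdifferentialD[OF sub[of x], of "x + h"] by (simp add: inner_commute)
      moreover have "f (x + h) - f x - h \<bullet> T x \<le> (T (x + h) - T x) \<bullet> h"
        using subdifferentialD[OF sub[of "x + h"], of x] by (simp add: inner_diff_left inner_diff_right inner_commute)
      moreover have "(T (x + h) - T x) \<bullet> h \<le> norm (T (x + h) - T x) * norm h" by (rule norm_cauchy_schwarz)
      ultimately have "norm (f (x + h) - f x - h \<bullet> T x) \<le> norm (T (x + h) - T x) * norm h" by simp
      then show ?thesis using False by (simp add: divide_le_eq)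
    qed simp
    then show "eventually (\<lambda>h. norm (norm (f (x + h) - f x - h \<bullet> T x) / norm h) \<le> norm (T (x + h) - T x)) (at 0)" by simp
    have "((\<lambda>h. T (x + h)) \<longlongrightarrow> T x) (at 0)" using cont by (simp add: isCont_def LIM_offset_zero)
    then show "((\<lambda>h. norm (T (x + h) - T x)) \<longlongrightarrow> 0) (at 0)" by (intro tendsto_norm_zero LIM_zero)
  qed
qed

locale sample = brenier_density P X \<mu> \<phi> a b
  for P X :: "(real ^ 'n) set" and \<mu> :: "(real ^ 'n) measure" and \<phi> :: "real ^ 'n \<Rightarrow> real" and a b :: real +
  fixes k N :: nat and p :: "nat \<Rightarrow> real ^ 'n"
  assumes k: "k > 0" and N: "N > 0" and p_P: "\<And>j. j \<in> {1..N} \<Longrightarrow> (1 / real k) *\<^sub>R p j \<in> P"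
begin

abbreviation perms :: "(nat \<Rightarrow> nat) set" where "perms \<equiv> {\<sigma>. \<sigma> permutes {1..N}}"
definition H :: "(nat \<Rightarrow> nat) \<Rightarrow> (nat \<Rightarrow> real ^ 'n) \<Rightarrow> real" where "H \<sigma> x = (\<Sum>i\<in>{1..N}. x i \<bullet> p (\<sigma> i))"
definition W :: "(nat \<Rightarrow> real ^ 'n) \<Rightarrow> (nat \<Rightarrow> nat) \<Rightarrow> real" where "W x = softmax perms (\<lambda>\<sigma>. H \<sigma> x)"
abbreviation M2 :: "(nat \<Rightarrow> real ^ 'n) measure" where "M2 \<equiv> (\<Pi>\<^sub>M i\<in>{2..N}. \<mu>)"
text \<open>The mean of \<open>p (\<sigma> 1)\<close> under the Gibbs weights of the configuration
  with first point \<open>x\<close>; averaged over \<open>y\<close> and divided by \<open>k\<close>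
  it becomes \<open>TN\<close>.\<close>

definition G :: "(nat \<Rightarrow> real ^ 'n) \<Rightarrow> real ^ 'n \<Rightarrow> real ^ 'n" where
  "G y x = (\<Sum>\<sigma>\<in>perms. W (y(1 := x)) \<sigma> *\<^sub>R p (\<sigma> 1))"

lemma finite_perms: "finite perms" by (simp add: finite_permutations)
lemma perms_ne: "perms \<noteq> {}" using permutes_id by blast
lemmas pfin = finite_perms perms_ne

lemma card_perms: "card perms = fact N" using card_permutations[of "{1..N}" N] by simp

lemma perm_in: "\<sigma> \<in> perms \<Longrightarrow> i \<in> {1..N} \<Longrightarrow> \<sigma> i \<in> {1..N}"
  using permutes_in_image[of \<sigma> "{1..N}" i] by simp

lemma one_in: "1 \<in> {1..N}" using N by simp

lemma norm_p: "j \<in> {1..N} \<Longrightarrow> norm (p j) \<le> real k * L"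
  using L(2)[OF p_P, of j] k by (simp add: divide_le_eq mult.commute)

lemma Per_eq: "Per N p x = (\<Sum>\<sigma>\<in>perms. exp (H \<sigma> x))"
  unfolding Per_def H_def by (simp add: exp_sum)

lemma W_pos: "0 < W x \<sigma>" unfolding W_def by (rule softmax_pos[OF pfin])
lemma sum_W: "(\<Sum>\<sigma>\<in>perms. W x \<sigma>) = 1" unfolding W_def by (rule sum_softmax[OF pfin])

lemma TN_eq: "TN \<mu> k N p x = (1 / real k) *\<^sub>R (\<integral>y. G y x \<partial>M2)"
  unfolding TN_def G_def W_def softmax_def H_def
  by (simp add: scaleR_sum_right divide_inverse mult.commute)

lemma upd_sum: "(\<Sum>i\<in>{1..N}. f i ((y(1 := x)) i)) = f 1 x + (\<Sum>i\<in>{2..N}. f i (y i))" for f :: "nat \<Rightarrow> 'b \<Rightarrow> 'c::comm_monoid_add"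
proof -
  have "{1..N} = insert 1 {2..N}" using N by auto
  then show ?thesis by (auto intro!: arg_cong2[where f = "(+)"] sum.cong)
qed

lemma H_upd: "H \<sigma> (y(1 := x)) = x \<bullet> p (\<sigma> 1) + (\<Sum>i\<in>{2..N}. y i \<bullet> p (\<sigma> i))"
  unfolding H_def using upd_sum[of "\<lambda>i v. v \<bullet> p (\<sigma> i)"] by simp

lemma H_measurable [measurable]: "(\<lambda>(x, y). H \<sigma> (y(1 := x))) \<in> borel_measurable (borel \<Otimes>\<^sub>M M2)"
  unfolding H_upd by measurable

lemma W_measurable [measurable]: "(\<lambda>(x, y). W (y(1 := x)) \<sigma>) \<in> borel_measurable (borel \<Otimes>\<^sub>M M2)"
  unfolding W_def softmax_def by measurable

lemma G_measurable_pair [measurable]: "(\<lambda>(x, y). G y x) \<in> borel_measurable (borel \<Otimes>\<^sub>M M2)"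
  unfolding G_def by measurable

lemma G_measurable [measurable]: "(\<lambda>y. G y x) \<in> borel_measurable M2"
  using measurable_compose[OF measurable_Pair1'[of x borel M2] G_measurable_pair] by simp

lemma Per_measurable [measurable]: "(\<lambda>y. Per N p (y(1 := x))) \<in> borel_measurable M2"
proof -
  have "(\<lambda>y. H \<sigma> (y(1 := x))) \<in> borel_measurable M2" for \<sigma>
    using measurable_compose[OF measurable_Pair1'[of x borel M2] H_measurable] by simp
  then show ?thesis unfolding Per_eq by measurable
qed

sublocale M2: prob_space M2 by (intro prob_space_PiM prob)

lemma AE_M2: "AE y in M2. \<forall>i\<in>{2..N}. y i \<in> X"
  by (intro AE_finite_allI AE_PiM_component prob AE_X) auto

lemma convex_combination_P:
  assumes "\<And>\<sigma>. \<sigma> \<in> perms \<Longrightarrow> q \<sigma> \<in> P"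
  shows "(\<Sum>\<sigma>\<in>perms. W x \<sigma> *\<^sub>R q \<sigma>) \<in> P"
  using sum_W less_imp_le[OF W_pos] assms by (intro convex_sum finite_perms P) auto

lemma G_in_P: "(1 / real k) *\<^sub>R G y x \<in> P"
proof -
  have "(1 / real k) *\<^sub>R G y x = (\<Sum>\<sigma>\<in>perms. W (y(1 := x)) \<sigma> *\<^sub>R ((1 / real k) *\<^sub>R p (\<sigma> 1)))"
    unfolding G_def scaleR_sum_right by (intro sum.cong refl) (simp add: mult.commute)
  also have "\<dots> \<in> P" by (rule convex_combination_P, rule p_P, rule perm_in[OF _ one_in])
  finally show ?thesis .
qed

lemma norm_G: "norm (G y x) \<le> real k * L"
  using L(2)[OF G_in_P, of y x] k by (simp add: divide_le_eq mult.commute)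

lemma integrable_G: "integrable M2 (\<lambda>y. G y x)"
  by (rule M2.integrable_const_bound[of _ "real k * L"]) (use norm_G in auto)

lemma integral_inner_G: "(\<integral>y. G y x \<bullet> v \<partial>M2) = real k * (TN \<mu> k N p x \<bullet> v)"
  using integrable_G k by (simp add: TN_eq)

lemma TN_in_P: "TN \<mu> k N p x \<in> P"
proof (rule ccontr)
  assume "TN \<mu> k N p x \<notin> P"
  from separating_hyperplane_closed_point[OF P(1) compact_imp_closed[OF P(2)] this]
  obtain e c where e: "e \<bullet> TN \<mu> k N p x < c" "\<And>q. q \<in> P \<Longrightarrow> e \<bullet> q > c" by blast
  have "real k * c \<le> G y x \<bullet> e" for y
    using e(2)[OF G_in_P, of y x] k by (simp add: inner_commute less_divide_eq mult.commute)
  then have "(\<integral>y. real k * c \<partial>M2) \<le> (\<integral>y. G y x \<bullet> e \<partial>M2)"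
    by (intro integral_mono_AE) (auto intro: integrable_G)
  then have "real k * c \<le> real k * (TN \<mu> k N p x \<bullet> e)"
    by (simp only: integral_inner_G) (simp add: M2.prob_space)
  then show False using e(1) k by (simp add: inner_commute)
qed

lemma continuous_W: "continuous_on UNIV (\<lambda>x. W (y(1 := x)) \<sigma>)"
  unfolding W_def softmax_def H_upd
  by (intro continuous_intros) (use sum_exp_pos[OF pfin] in \<open>auto simp: less_imp_neq[THEN not_sym]\<close>)

lemma continuous_G: "continuous_on UNIV (G y)"
  unfolding G_def[abs_def] by (intro continuous_intros continuous_W)

lemma continuous_TN: "isCont (TN \<mu> k N p) x"
  unfolding continuous_at_sequentially
proof (intro allI impI)
  fix z :: "nat \<Rightarrow> real ^ 'n" assume z: "z \<longlonglongrightarrow> x"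
  have "(\<lambda>n. \<integral>y. G y (z n) \<partial>M2) \<longlonglongrightarrow> (\<integral>y. G y x \<partial>M2)"
  proof (rule integral_dominated_convergence[where w = "\<lambda>_. real k * L"])
    show "AE y in M2. (\<lambda>n. G y (z n)) \<longlonglongrightarrow> G y x"
    proof (rule AE_I2)
      fix y
      have "isCont (G y) x" using continuous_G[of y] by (simp add: continuous_on_eq_continuous_at)
      then show "(\<lambda>n. G y (z n)) \<longlonglongrightarrow> G y x" using z by (rule isCont_tendsto_compose)
    qed
  qed (use norm_G in auto)
  then have "(\<lambda>n. (1 / real k) *\<^sub>R (\<integral>y. G y (z n) \<partial>M2)) \<longlonglongrightarrow> (1 / real k) *\<^sub>R (\<integral>y. G y x \<partial>M2)"
    by (intro tendsto_intros)
  then show "(TN \<mu> k N p \<circ> z) \<longlonglongrightarrow> TN \<mu> k N p x" by (simp add: TN_eq o_def)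
qed

lemma TN_measurable [measurable]: "TN \<mu> k N p \<in> borel_measurable borel"
  using continuous_TN by (intro borel_measurable_continuous_onI) (simp add: continuous_on_eq_continuous_at)

lemma abs_H_le:
  assumes "\<sigma> \<in> perms" "\<forall>i\<in>{2..N}. y i \<in> X"
  shows "\<bar>H \<sigma> (y(1 := x))\<bar> \<le> norm x * (real k * L) + real N * (R * (real k * L))"
proof -
  have b: "\<bar>v \<bullet> p (\<sigma> i)\<bar> \<le> norm v * (real k * L)" if "i \<in> {1..N}" for i v
    using Cauchy_Schwarz_ineq2[of v "p (\<sigma> i)"] mult_left_mono[OF norm_p[OF perm_in[OF assms(1) that]], of "norm v"] by simp
  have "\<bar>\<Sum>i\<in>{2..N}. y i \<bullet> p (\<sigma> i)\<bar> \<le> (\<Sum>i\<in>{2..N}. R * (real k * L))"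
  proof (rule order_trans[OF sum_abs], rule sum_mono)
    fix i assume i: "i \<in> {2..N}"
    have "\<bar>y i \<bullet> p (\<sigma> i)\<bar> \<le> norm (y i) * (real k * L)" using i by (intro b) auto
    also have "\<dots> \<le> R * (real k * L)" using R(2) assms(2) i L(1) by (intro mult_right_mono) auto
    finally show "\<bar>y i \<bullet> p (\<sigma> i)\<bar> \<le> R * (real k * L)" .
  qed
  also have "\<dots> \<le> real N * (R * (real k * L))" using R(1) L(1) by (simp add: mult_right_mono)
  finally show ?thesis unfolding H_upd using b[OF one_in, of x] by linarith
qed

lemma integrable_ln_Per: "integrable M2 (\<lambda>y. ln (Per N p (y(1 := x))))"
proof (rule M2.integrable_const_bound)
  show "AE y in M2. norm (ln (Per N p (y(1 := x)))) \<le> ln (card perms) + (norm x * (real k * L) + real N * (R * (real k * L)))"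
    using AE_M2
  proof eventually_elim
    case (elim y)
    then show ?case unfolding Per_eq real_norm_def by (intro ln_sum_exp_bound[OF pfin] abs_H_le)
  qed
qed measurable

text \<open>For fixed \<open>y\<close> the logarithm of the permanent is a log-sum-exp of affine
  functions of \<open>x\<close>, with gradient \<open>G y x\<close>. Integrating the subgradient
  inequality over \<open>y\<close> takes the place of differentiation under the integral.\<close>

lemma phi_unnormalized_subgradient: "TN \<mu> k N p x \<in> subdifferential (phi_unnormalized \<mu> k N p) x"
proof (rule subdifferentialI)
  fix z
  have pt: "ln (Per N p (y(1 := x))) + G y x \<bullet> (z - x) \<le> ln (Per N p (y(1 := z)))" for y
  proof -
    have "G y x \<bullet> (z - x) = (\<Sum>\<sigma>\<in>perms. W (y(1 := x)) \<sigma> * ((z - x) \<bullet> p (\<sigma> 1)))"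
      unfolding G_def inner_sum_left by (intro sum.cong refl) (simp add: inner_commute)
    moreover have "H \<sigma> (y(1 := z)) = H \<sigma> (y(1 := x)) + (z - x) \<bullet> p (\<sigma> 1)" for \<sigma>
      unfolding H_upd by (simp add: inner_diff_left)
    ultimately show ?thesis
      unfolding Per_eq W_def using ln_sum_exp_subgradient[OF pfin, of "\<lambda>\<sigma>. H \<sigma> (y(1 := x))" "\<lambda>\<sigma>. (z - x) \<bullet> p (\<sigma> 1)"]
      by simp
  qed
  have "(\<integral>y. ln (Per N p (y(1 := x))) + G y x \<bullet> (z - x) \<partial>M2) \<le> (\<integral>y. ln (Per N p (y(1 := z))) \<partial>M2)"
    by (intro integral_mono pt Bochner_Integration.integrable_add integrable_ln_Per integrable_inner_left integrable_G)
  then have "(\<integral>y. ln (Per N p (y(1 := x))) \<partial>M2) + real k * (TN \<mu> k N p x \<bullet> (z - x)) \<le> (\<integral>y. ln (Per N p (y(1 := z))) \<partial>M2)"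
    using integrable_ln_Per integrable_G by (simp add: integral_inner_G[symmetric])
  then have "(1 / real k) * ((\<integral>y. ln (Per N p (y(1 := x))) \<partial>M2) + real k * (TN \<mu> k N p x \<bullet> (z - x)))
      \<le> (1 / real k) * (\<integral>y. ln (Per N p (y(1 := z))) \<partial>M2)"
    by (rule mult_left_mono) simp
  then show "phi_unnormalized \<mu> k N p x + TN \<mu> k N p x \<bullet> (z - x) \<le> phi_unnormalized \<mu> k N p z"
    using k by (simp add: phi_unnormalized_def distrib_left)
qed

lemma TN_subgradient: "TN \<mu> k N p x \<in> subdifferential (phiN \<mu> k N p) x"
  using phi_unnormalized_subgradient[of x] by (simp add: subdifferential_def phiN_def algebra_simps)

lemma integral_phiN: "(\<integral>x. phiN \<mu> k N p x \<partial>\<mu>) = 0"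
proof -
  have "convex_on UNIV (phi_unnormalized \<mu> k N p)"
    by (rule convex_on_if_subgradients) (use phi_unnormalized_subgradient in blast)
  then have i: "integrable \<mu> (phi_unnormalized \<mu> k N p)" by (intro integrable_mu convex_on_UNIV_continuous)
  then have e: "(\<integral>x. phi_unnormalized \<mu> k N p x - c \<partial>\<mu>) = (\<integral>x. phi_unnormalized \<mu> k N p x \<partial>\<mu>) - c" for c by simp
  \<comment> \<open>The mean is affine in \<open>c\<close> with slope -1, so the definite
    description is well defined.\<close>
  have "phi_const \<mu> k N p = (\<integral>x. phi_unnormalized \<mu> k N p x \<partial>\<mu>)"
    unfolding phi_const_def e by (rule the_equality) auto
  then show ?thesis unfolding phiN_def e by simp
qed

lemma gderiv_phiN: "GDERIV (phiN \<mu> k N p) x :> TN \<mu> k N p x"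
  by (rule gderiv_of_subgradients[OF TN_subgradient continuous_TN])

end


section \<open>Estimating the gap\<close>

text \<open>Independence and mean 0 remove the off-diagonal terms, so the second moment of the sum
  is at most \<open>card I\<close>; its square root bounds the first absolute moment.\<close>

lemma (in prob_space) mean_abs_deviation_le:
  fixes f :: "'a \<Rightarrow> real"
  assumes f [measurable]: "f \<in> borel_measurable M" and bound: "\<And>x. \<bar>f x\<bar> \<le> 1" and mean: "expectation f = 0" and I: "finite I" "I \<noteq> {}"
  shows "(\<integral>\<omega>. \<bar>\<Sum>i\<in>I. f (\<omega> i)\<bar> \<partial>(\<Pi>\<^sub>M i\<in>I. M)) \<le> sqrt (card I)"
proof -
  interpret PI: prob_space "\<Pi>\<^sub>M i\<in>I. M" by (intro prob_space_PiM prob_space_axioms)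
  interpret product_sigma_finite "\<lambda>_. M" by standard
  have int_f: "integrable M f" using bound by (intro integrable_const_bound[of _ 1]) auto
  define n where "n = real (card I)"
  have n: "n > 0" using I by (simp add: n_def card_gt_0_iff)
  have bsq: "\<bar>f x * f y\<bar> \<le> 1" for x y using mult_mono[OF bound[of x] bound[of y]] by (simp add: abs_mult)
  have meas2: "(\<lambda>\<omega>. f (\<omega> i) * f (\<omega> j)) \<in> borel_measurable (\<Pi>\<^sub>M i\<in>I. M)" if [measurable]: "i \<in> I" "j \<in> I" for i j
    by measurable
  have int2: "integrable (\<Pi>\<^sub>M i\<in>I. M) (\<lambda>\<omega>. f (\<omega> i) * f (\<omega> j))" if "i \<in> I" "j \<in> I" for i j
    by (rule PI.integrable_const_bound[of _ 1]) (use bsq meas2[OF that] in auto)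
  have off: "(\<integral>\<omega>. f (\<omega> i) * f (\<omega> j) \<partial>(\<Pi>\<^sub>M i\<in>I. M)) = 0" if ij: "i \<in> I" "j \<in> I" "i \<noteq> j" for i j
  proof -
    \<comment> \<open>Writes \<open>f (\<omega> i) * f (\<omega> j)\<close> as a product over all of
      \<open>I\<close>, whose integral factorises.\<close>
    define h where "h l x = (if l = i \<or> l = j then f x else 1)" for l x
    have "(\<integral>\<omega>. (\<Prod>l\<in>I. h l (\<omega> l)) \<partial>(\<Pi>\<^sub>M i\<in>I. M)) = (\<Prod>l\<in>I. expectation (h l))"
    proof (intro product_integral_prod I)
      fix l
      have "h l = (if l = i \<or> l = j then f else (\<lambda>_. 1))" by (auto simp: h_def)
      then show "integrable M (h l)" using int_f by simp
    qed
    also have "\<dots> = 0"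
    proof -
      have "h i = f" by (auto simp: h_def)
      then show ?thesis using I ij mean by (intro prod_zero) auto
    qed
    finally have "(\<integral>\<omega>. (\<Prod>l\<in>I. h l (\<omega> l)) \<partial>(\<Pi>\<^sub>M i\<in>I. M)) = 0" .
    moreover have "(\<Prod>l\<in>I. h l (\<omega> l)) = f (\<omega> i) * f (\<omega> j)" for \<omega>
    proof -
      have "(\<Prod>l\<in>I. h l (\<omega> l)) = (\<Prod>l\<in>{i, j}. h l (\<omega> l))"
        using I ij by (intro prod.mono_neutral_right) (auto simp: h_def)
      then show ?thesis using ij by (simp add: h_def)
    qed
    ultimately show ?thesis by simp
  qed
  have diag: "(\<integral>\<omega>. f (\<omega> i) * f (\<omega> i) \<partial>(\<Pi>\<^sub>M i\<in>I. M)) \<le> 1" if "i \<in> I" for i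
  proof -
    have "(\<integral>\<omega>. f (\<omega> i) * f (\<omega> i) \<partial>(\<Pi>\<^sub>M i\<in>I. M)) \<le> (\<integral>\<omega>. 1 \<partial>(\<Pi>\<^sub>M i\<in>I. M))"
      using bsq abs_le_D1 by (intro integral_mono int2 that) auto
    then show ?thesis by (simp add: PI.prob_space)
  qed
  have "(\<integral>\<omega>. (\<Sum>i\<in>I. f (\<omega> i))\<^sup>2 \<partial>(\<Pi>\<^sub>M i\<in>I. M)) = (\<Sum>i\<in>I. \<Sum>j\<in>I. \<integral>\<omega>. f (\<omega> i) * f (\<omega> j) \<partial>(\<Pi>\<^sub>M i\<in>I. M))"
    unfolding power2_eq_square sum_product
    by (subst Bochner_Integration.integral_sum, intro Bochner_Integration.integrable_sum int2,
        (assumption+)[2], intro sum.cong refl Bochner_Integration.integral_sum int2, assumption+)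
  also have "\<dots> \<le> (\<Sum>i\<in>I. \<Sum>j\<in>I. if i = j then 1 else 0)"
    using off diag by (intro sum_mono) auto
  also have "\<dots> = n" using I by (simp add: n_def)
  finally have sq: "(\<integral>\<omega>. (\<Sum>i\<in>I. f (\<omega> i))\<^sup>2 \<partial>(\<Pi>\<^sub>M i\<in>I. M)) \<le> n" .
  have intsq: "integrable (\<Pi>\<^sub>M i\<in>I. M) (\<lambda>\<omega>. (\<Sum>i\<in>I. f (\<omega> i))\<^sup>2)"
    unfolding power2_eq_square sum_product by (intro Bochner_Integration.integrable_sum int2)
  \<comment> \<open>A pointwise bound whose integral is at most \<open>sqrt n\<close> once the
    second moment is at most \<open>n\<close>.\<close>
  have amgm: "\<bar>s\<bar> \<le> (s\<^sup>2 / sqrt n + sqrt n) / 2" for s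
  proof -
    have "0 \<le> (\<bar>s\<bar> - sqrt n)\<^sup>2" by simp
    then have "2 * (\<bar>s\<bar> * sqrt n) \<le> s\<^sup>2 + n" using n by (simp add: power2_diff)
    then have "2 * \<bar>s\<bar> \<le> (s\<^sup>2 + n) / sqrt n" using n by (simp add: pos_le_divide_eq mult.assoc)
    then show ?thesis using n by (simp add: add_divide_distrib real_div_sqrt)
  qed
  have "(\<integral>\<omega>. \<bar>\<Sum>i\<in>I. f (\<omega> i)\<bar> \<partial>(\<Pi>\<^sub>M i\<in>I. M)) \<le> (\<integral>\<omega>. ((\<Sum>i\<in>I. f (\<omega> i))\<^sup>2 / sqrt n + sqrt n) / 2 \<partial>(\<Pi>\<^sub>M i\<in>I. M))"
  proof (rule integral_mono)
    have [measurable]: "(\<lambda>\<omega>. \<Sum>i\<in>I. f (\<omega> i)) \<in> borel_measurable (\<Pi>\<^sub>M i\<in>I. M)" by measurable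
    show "integrable (\<Pi>\<^sub>M i\<in>I. M) (\<lambda>\<omega>. \<bar>\<Sum>i\<in>I. f (\<omega> i)\<bar>)"
    proof (rule PI.integrable_const_bound[of _ n])
      show "AE \<omega> in \<Pi>\<^sub>M i\<in>I. M. norm \<bar>\<Sum>i\<in>I. f (\<omega> i)\<bar> \<le> n"
      proof (rule AE_I2)
        fix \<omega>
        have "norm (\<Sum>i\<in>I. f (\<omega> i)) \<le> of_nat (card I) * 1" using bound by (intro sum_norm_bound) auto
        then show "norm \<bar>\<Sum>i\<in>I. f (\<omega> i)\<bar> \<le> n" by (simp add: n_def)
      qed
    qed measurable
    show "integrable (\<Pi>\<^sub>M i\<in>I. M) (\<lambda>\<omega>. ((\<Sum>i\<in>I. f (\<omega> i))\<^sup>2 / sqrt n + sqrt n) / 2)" using intsq by auto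
  qed (rule amgm)
  also have "\<dots> = ((\<integral>\<omega>. (\<Sum>i\<in>I. f (\<omega> i))\<^sup>2 \<partial>(\<Pi>\<^sub>M i\<in>I. M)) / sqrt n + sqrt n) / 2"
    using intsq by (simp add: PI.prob_space)
  also have "\<dots> \<le> (n / sqrt n + sqrt n) / 2" using sq n by (simp add: divide_right_mono)
  also have "\<dots> = sqrt n" using n by (simp add: real_div_sqrt)
  finally show ?thesis by (simp add: n_def)
qed

section \<open>Exchangeability of the sample and the mean energy\<close>

context sample
begin

declare One_nat_def [simp del]
abbreviation MN :: "(nat \<Rightarrow> real ^ 'n) measure" where "MN \<equiv> (\<Pi>\<^sub>M i\<in>{1..N}. \<mu>)"

sublocale MN: prob_space MN by (intro prob_space_PiM prob)

lemma AE_MN: "AE x in \<mu>. Q x \<Longrightarrow> AE \<omega> in MN. \<forall>i\<in>{1..N}. Q (\<omega> i)"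
  by (intro AE_finite_allI AE_PiM_component prob) auto

lemma H_measurable_MN [measurable]: "H \<sigma> \<in> borel_measurable MN"
  unfolding H_def[abs_def] by measurable

lemma W_measurable_MN [measurable]: "(\<lambda>\<omega>. W \<omega> \<sigma>) \<in> borel_measurable MN"
  unfolding W_def softmax_def by measurable

lemma abs_mean_le:
  assumes "\<And>\<sigma>. \<sigma> \<in> perms \<Longrightarrow> \<bar>c \<sigma>\<bar> \<le> B"
  shows "\<bar>\<Sum>\<sigma>\<in>perms. W x \<sigma> * c \<sigma>\<bar> \<le> B"
proof -
  have "\<bar>\<Sum>\<sigma>\<in>perms. W x \<sigma> * c \<sigma>\<bar> \<le> (\<Sum>\<sigma>\<in>perms. W x \<sigma> * B)"
  proof (rule order_trans[OF sum_abs], rule sum_mono)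
    fix \<sigma> assume "\<sigma> \<in> perms"
    then show "\<bar>W x \<sigma> * c \<sigma>\<bar> \<le> W x \<sigma> * B"
      using assms[of \<sigma>] less_imp_le[OF W_pos[of x \<sigma>]] by (simp add: abs_mult mult_left_mono)
  qed
  also have "\<dots> = B" by (simp add: sum_W flip: sum_distrib_right)
  finally show ?thesis .
qed

text \<open>\<open>\<phi> x + c x j\<close> is the gap between \<open>x\<close> and the \<open>j\<close>th (rescaled) lattice point.\<close>

definition c :: "real ^ 'n \<Rightarrow> nat \<Rightarrow> real" where
  "c x j = \<kappa> ((1 / real k) *\<^sub>R p j) - x \<bullet> ((1 / real k) *\<^sub>R p j)"

lemma c_measurable [measurable]: "(\<lambda>x. c x j) \<in> borel_measurable borel"
  unfolding c_def by measurable

lemma c_bounded: obtains B where "B \<ge> 0" "\<And>x j. x \<in> X \<Longrightarrow> j \<in> {1..N} \<Longrightarrow> \<bar>c x j\<bar> \<le> B"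
proof -
  obtain B where B: "B \<ge> 0" "\<And>q. q \<in> P \<Longrightarrow> \<bar>\<kappa> q\<bar> \<le> B" using bounded_on_compact[OF cont_\<kappa> P(2)] by blast
  have "\<bar>c x j\<bar> \<le> B + R * L" if "x \<in> X" "j \<in> {1..N}" for x j
    using B(2)[OF p_P[OF that(2)]] inner_bound[OF that(1) p_P[OF that(2)]] unfolding c_def by linarith
  moreover have "B + R * L \<ge> 0" using B(1) R(1) L(1) by simp
  ultimately show ?thesis using that by blast
qed

text \<open>\<open>\<phi> (\<omega> i) + Q i \<omega>\<close> is the mean gap between the sample
  point \<open>\<omega> i\<close> and the lattice point that the Gibbs measure assigns to
  it.\<close>

definition Q :: "nat \<Rightarrow> (nat \<Rightarrow> real ^ 'n) \<Rightarrow> real" where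
  "Q i \<omega> = (\<Sum>\<sigma>\<in>perms. W \<omega> \<sigma> * c (\<omega> i) (\<sigma> i))"

lemma Q_measurable [measurable]: "i \<in> {1..N} \<Longrightarrow> Q i \<in> borel_measurable MN"
  unfolding Q_def[abs_def] by measurable

lemma integrable_Q:
  assumes i: "i \<in> {1..N}"
  shows "integrable MN (Q i)"
proof -
  obtain B where B: "\<And>x j. x \<in> X \<Longrightarrow> j \<in> {1..N} \<Longrightarrow> \<bar>c x j\<bar> \<le> B" using c_bounded by metis
  show ?thesis
  proof (rule MN.integrable_const_bound)
    show "AE \<omega> in MN. norm (Q i \<omega>) \<le> B"
      using AE_MN[OF AE_X]
    proof eventually_elim
      case (elim \<omega>)
      then show ?case unfolding Q_def real_norm_def using i perm_in by (intro abs_mean_le B) auto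
    qed
  qed (use i in measurable)
qed

text \<open>Swapping two sample points only reindexes the sum over permutations.\<close>

lemma Q_exchange:
  assumes i: "i \<in> {1..N}"
  shows "(\<integral>\<omega>. Q i \<omega> \<partial>MN) = (\<integral>\<omega>. Q 1 \<omega> \<partial>MN)"
proof -
  define t where "t = Transposition.transpose 1 i"
  have t: "t permutes {1..N}" unfolding t_def using one_in i by (rule permutes_swap_id)
  have t1: "t 1 = i" "t i = 1" by (simp_all add: t_def)
  define \<Theta> where "\<Theta> \<omega> = (\<lambda>n\<in>{1..N}. \<omega> (t n))" for \<omega> :: "nat \<Rightarrow> real ^ 'n"
  have tin: "t n \<in> {1..N} \<longleftrightarrow> n \<in> {1..N}" for n using permutes_in_image[OF t] .
  have H\<Theta>: "H \<sigma> (\<Theta> \<omega>) = H (\<sigma> \<circ> t) \<omega>" for \<sigma> \<omega>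
  proof -
    have tt: "t (t n) = n" for n by (simp add: t_def)
    have "H \<sigma> (\<Theta> \<omega>) = (\<Sum>n\<in>{1..N}. \<omega> (t n) \<bullet> p (\<sigma> n))" unfolding H_def \<Theta>_def by (intro sum.cong) auto
    also have "\<dots> = (\<Sum>n\<in>{1..N}. \<omega> n \<bullet> p (\<sigma> (t n)))"
      by (rule sum.reindex_bij_witness[of _ t t]) (use tin tt in auto)
    finally show ?thesis by (simp add: H_def)
  qed
  have reindex: "(\<Sum>\<sigma>\<in>perms. g (\<sigma> \<circ> t)) = (\<Sum>\<sigma>\<in>perms. g \<sigma>)" for g :: "(nat \<Rightarrow> nat) \<Rightarrow> real"
    by (rule sum_permutations_compose_right[OF t, symmetric])
  have "Q 1 (\<Theta> \<omega>) = Q i \<omega>" for \<omega>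
  proof -
    have "W (\<Theta> \<omega>) \<sigma> = W \<omega> (\<sigma> \<circ> t)" for \<sigma>
      unfolding W_def softmax_def H\<Theta> using reindex[of "\<lambda>\<sigma>. exp (H \<sigma> \<omega>)"] by simp
    moreover have "\<Theta> \<omega> 1 = \<omega> i" using one_in by (simp add: \<Theta>_def t1)
    ultimately have "Q 1 (\<Theta> \<omega>) = (\<Sum>\<sigma>\<in>perms. W \<omega> (\<sigma> \<circ> t) * c (\<omega> i) ((\<sigma> \<circ> t) i))"
      by (simp add: Q_def t1)
    then show ?thesis unfolding Q_def by (simp only: reindex[of "\<lambda>\<sigma>. W \<omega> \<sigma> * c (\<omega> i) (\<sigma> i)"])
  qed
  then have "(\<integral>\<omega>. Q i \<omega> \<partial>MN) = (\<integral>\<omega>. Q 1 (\<Theta> \<omega>) \<partial>MN)" by simp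
  also have "\<dots> = (\<integral>\<omega>. Q 1 \<omega> \<partial>distr MN MN \<Theta>)"
  proof (rule integral_distr[symmetric])
    show "\<Theta> \<in> measurable MN MN"
      unfolding \<Theta>_def by (intro measurable_restrict measurable_component_singleton) (simp only: tin)
  qed (use one_in in measurable)
  also have "distr MN MN \<Theta> = MN"
    unfolding \<Theta>_def[abs_def]
  proof (rule distr_PiM_reindex)
    show "t \<in> {1..N} \<rightarrow> {1..N}" using tin by blast
  qed (use prob permutes_inj_on[OF t] in auto)
  finally show ?thesis .
qed

text \<open>A permutation uses every lattice point once, so the \<kappa> terms add up to the same
  number for all \<sigma>; what is left is the Gibbs mean of \<open>H\<close>.\<close>

lemma sum_Q: "(\<Sum>i\<in>{1..N}. Q i \<omega>) = (\<Sum>j\<in>{1..N}. \<kappa> ((1 / real k) *\<^sub>R p j)) - (1 / real k) * (\<Sum>\<sigma>\<in>perms. W \<omega> \<sigma> * H \<sigma> \<omega>)"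
proof -
  have lin: "(\<Sum>\<sigma>\<in>perms. W \<omega> \<sigma> * (K - t * H \<sigma> \<omega>)) = K - t * (\<Sum>\<sigma>\<in>perms. W \<omega> \<sigma> * H \<sigma> \<omega>)" for K t
  proof -
    have "(\<Sum>\<sigma>\<in>perms. W \<omega> \<sigma> * (K - t * H \<sigma> \<omega>)) = (\<Sum>\<sigma>\<in>perms. W \<omega> \<sigma> * K) - (\<Sum>\<sigma>\<in>perms. t * (W \<omega> \<sigma> * H \<sigma> \<omega>))"
      by (simp add: right_diff_distrib sum_subtractf mult.left_commute)
    then show ?thesis by (simp add: sum_W flip: sum_distrib_left sum_distrib_right)
  qed
  have "(\<Sum>i\<in>{1..N}. c (\<omega> i) (\<sigma> i)) = (\<Sum>j\<in>{1..N}. \<kappa> ((1 / real k) *\<^sub>R p j)) - (1 / real k) * H \<sigma> \<omega>"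
    if "\<sigma> \<in> perms" for \<sigma>
  proof -
    have "(\<Sum>i\<in>{1..N}. \<kappa> ((1 / real k) *\<^sub>R p (\<sigma> i))) = (\<Sum>j\<in>{1..N}. \<kappa> ((1 / real k) *\<^sub>R p j))"
      using that sum.permute[of \<sigma> "{1..N}" "\<lambda>j. \<kappa> ((1 / real k) *\<^sub>R p j)"] by (simp add: o_def)
    then show ?thesis by (simp add: c_def sum_subtractf H_def sum_distrib_left)
  qed
  then have "(\<Sum>\<sigma>\<in>perms. W \<omega> \<sigma> * (\<Sum>i\<in>{1..N}. c (\<omega> i) (\<sigma> i)))
    = (\<Sum>\<sigma>\<in>perms. W \<omega> \<sigma> * ((\<Sum>j\<in>{1..N}. \<kappa> ((1 / real k) *\<^sub>R p j)) - (1 / real k) * H \<sigma> \<omega>))"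
    by (intro sum.cong) auto
  also note lin
  finally have "(\<Sum>\<sigma>\<in>perms. W \<omega> \<sigma> * (\<Sum>i\<in>{1..N}. c (\<omega> i) (\<sigma> i)))
    = (\<Sum>j\<in>{1..N}. \<kappa> ((1 / real k) *\<^sub>R p j)) - (1 / real k) * (\<Sum>\<sigma>\<in>perms. W \<omega> \<sigma> * H \<sigma> \<omega>)" .
  moreover have "(\<Sum>\<sigma>\<in>perms. W \<omega> \<sigma> * (\<Sum>i\<in>{1..N}. c (\<omega> i) (\<sigma> i))) = (\<Sum>i\<in>{1..N}. Q i \<omega>)"
    unfolding Q_def sum_distrib_left by (rule sum.swap)
  ultimately show ?thesis by simp
qed

lemma integral_Q1: "(\<integral>\<omega>. Q 1 \<omega> \<partial>MN) = (\<integral>x. (\<integral>y. Q 1 (y(1 := x)) \<partial>M2) \<partial>\<mu>)"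
  and integrable_Q1: "integrable \<mu> (\<lambda>x. \<integral>y. Q 1 (y(1 := x)) \<partial>M2)"
proof -
  have ins: "{1..N} = insert 1 {2..N}" using N by auto
  define ins1 where "ins1 = (\<lambda>(x, y). y(1 := x) :: nat \<Rightarrow> real ^ 'n)"
  have m: "ins1 \<in> measurable (\<mu> \<Otimes>\<^sub>M M2) MN" unfolding ins1_def ins by measurable
  have d: "distr (\<mu> \<Otimes>\<^sub>M M2) MN ins1 = MN"
    unfolding ins ins1_def by (rule distr_pair_PiM_eq_PiM) (auto intro: prob)
  interpret pair: pair_sigma_finite \<mu> M2 ..
  note Q1m = Q_measurable[OF one_in]
  have "integrable (distr (\<mu> \<Otimes>\<^sub>M M2) MN ins1) (Q 1)" using integrable_Q[OF one_in] by (simp add: d)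
  then have i: "integrable (\<mu> \<Otimes>\<^sub>M M2) (\<lambda>z. Q 1 (ins1 z))" using integrable_distr_eq[OF m Q1m] by simp
  have "(\<integral>\<omega>. Q 1 \<omega> \<partial>distr (\<mu> \<Otimes>\<^sub>M M2) MN ins1) = (\<integral>z. Q 1 (ins1 z) \<partial>(\<mu> \<Otimes>\<^sub>M M2))"
    by (rule integral_distr[OF m Q1m])
  then have "(\<integral>\<omega>. Q 1 \<omega> \<partial>MN) = (\<integral>z. Q 1 (ins1 z) \<partial>(\<mu> \<Otimes>\<^sub>M M2))" by (simp only: d)
  also have "\<dots> = (\<integral>x. (\<integral>y. Q 1 (ins1 (x, y)) \<partial>M2) \<partial>\<mu>)" using pair.integral_fst'[OF i] by simp
  finally show "(\<integral>\<omega>. Q 1 \<omega> \<partial>MN) = (\<integral>x. (\<integral>y. Q 1 (y(1 := x)) \<partial>M2) \<partial>\<mu>)" by (simp add: ins1_def)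
  show "integrable \<mu> (\<lambda>x. \<integral>y. Q 1 (y(1 := x)) \<partial>M2)" using pair.integrable_fst'[OF i] by (simp add: ins1_def)
qed

lemma gap_TN_le:
  assumes x: "x \<in> X"
  shows "gap x (TN \<mu> k N p x) \<le> \<phi> x + (\<integral>y. Q 1 (y(1 := x)) \<partial>M2)"
proof -
  define T0 where "T0 = TN \<mu> k N p x"
  \<comment> \<open>Jensen's inequality by a subgradient of \<kappa> at \<open>T0\<close>: since
    \<open>T0\<close> is the mean of \<open>G y x\<close> divided by \<open>k\<close>, the linear
    term integrates to 0.\<close>
  obtain v where v: "v \<in> subdifferential \<kappa> T0" using subdifferential_nonempty[OF chi.convex] .
  have pt: "(\<kappa> T0 - x \<bullet> T0) + (v - x) \<bullet> ((1 / real k) *\<^sub>R G y x - T0) \<le> Q 1 (y(1 := x))" for y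
  proof -
    have "(\<Sum>\<sigma>\<in>perms. W (y(1 := x)) \<sigma> * ((\<kappa> T0 - x \<bullet> T0 - (v - x) \<bullet> T0) + (v - x) \<bullet> ((1 / real k) *\<^sub>R p (\<sigma> 1)))) \<le> Q 1 (y(1 := x))"
      unfolding Q_def
    proof (intro sum_mono mult_left_mono less_imp_le[OF W_pos])
      fix \<sigma>
      show "(\<kappa> T0 - x \<bullet> T0 - (v - x) \<bullet> T0) + (v - x) \<bullet> ((1 / real k) *\<^sub>R p (\<sigma> 1)) \<le> c ((y(1 := x)) 1) (\<sigma> 1)"
        using subdifferentialD[OF v, of "(1 / real k) *\<^sub>R p (\<sigma> 1)"]
        by (simp add: c_def inner_diff_left inner_diff_right diff_divide_distrib)
    qed
    moreover have "(\<Sum>\<sigma>\<in>perms. W (y(1 := x)) \<sigma> * ((\<kappa> T0 - x \<bullet> T0 - (v - x) \<bullet> T0) + (v - x) \<bullet> ((1 / real k) *\<^sub>R p (\<sigma> 1))))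
      = (\<Sum>\<sigma>\<in>perms. W (y(1 := x)) \<sigma>) * (\<kappa> T0 - x \<bullet> T0 - (v - x) \<bullet> T0) + (v - x) \<bullet> ((1 / real k) *\<^sub>R G y x)"
      unfolding G_def scaleR_sum_right inner_sum_right sum_distrib_right sum.distrib[symmetric]
      by (intro sum.cong refl) (simp add: distrib_left)
    ultimately show ?thesis by (simp only: sum_W) (simp add: inner_diff_right)
  qed
  obtain B where B: "\<And>x j. x \<in> X \<Longrightarrow> j \<in> {1..N} \<Longrightarrow> \<bar>c x j\<bar> \<le> B" using c_bounded by metis
  have "(\<lambda>y. W (y(1 := x)) \<sigma>) \<in> borel_measurable M2" for \<sigma>
    using measurable_compose[OF measurable_Pair1'[of x borel M2] W_measurable] by simp
  then have m: "(\<lambda>y. Q 1 (y(1 := x))) \<in> borel_measurable M2" unfolding Q_def fun_upd_same by measurable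
  have intQ: "integrable M2 (\<lambda>y. Q 1 (y(1 := x)))"
  proof (rule M2.integrable_const_bound[OF AE_I2 m])
    show "norm (Q 1 (y(1 := x))) \<le> B" for y
      unfolding Q_def real_norm_def using x perm_in[OF _ one_in] by (intro abs_mean_le) (auto intro!: B)
  qed
  have "(\<integral>y. (\<kappa> T0 - x \<bullet> T0) + (v - x) \<bullet> ((1 / real k) *\<^sub>R G y x - T0) \<partial>M2) \<le> (\<integral>y. Q 1 (y(1 := x)) \<partial>M2)"
    using integrable_G by (intro integral_mono pt intQ) auto
  moreover have "(\<integral>y. (\<kappa> T0 - x \<bullet> T0) + (v - x) \<bullet> ((1 / real k) *\<^sub>R G y x - T0) \<partial>M2)
    = (\<kappa> T0 - x \<bullet> T0) + (v - x) \<bullet> ((1 / real k) *\<^sub>R (\<integral>y. G y x \<partial>M2) - T0)"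
    using integrable_G by (simp add: M2.prob_space inner_diff_right)
  ultimately show ?thesis by (simp add: TN_eq[symmetric] T0_def gap_def)
qed

lemma integrable_mean_H: "integrable MN (\<lambda>\<omega>. \<Sum>\<sigma>\<in>perms. W \<omega> \<sigma> * H \<sigma> \<omega>)"
proof -
  have "(\<lambda>\<omega>. \<Sum>\<sigma>\<in>perms. W \<omega> \<sigma> * H \<sigma> \<omega>)
    = (\<lambda>\<omega>. real k * ((\<Sum>j\<in>{1..N}. \<kappa> ((1 / real k) *\<^sub>R p j)) - (\<Sum>i\<in>{1..N}. Q i \<omega>)))"
    using k by (intro ext) (simp add: sum_Q)
  then show ?thesis by (simp only:) (intro integrable_mult_right Bochner_Integration.integrable_diff Bochner_Integration.integrable_sum integrable_Q, auto)
qed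

text \<open>\<phi> has mean 0, and by exchangeability the mean of \<open>Q 1\<close> equals the
  average of the means of all \<open>Q i\<close>, whose sum involves only lattice values of \<kappa>
  and the energy.\<close>

lemma integral_gap_TN_le:
  "(\<integral>x. gap x (TN \<mu> k N p x) \<partial>\<mu>)
    \<le> ((\<Sum>j\<in>{1..N}. \<kappa> ((1 / real k) *\<^sub>R p j)) - (1 / real k) * (\<integral>\<omega>. (\<Sum>\<sigma>\<in>perms. W \<omega> \<sigma> * H \<sigma> \<omega>) \<partial>MN)) / real N"
proof -
  obtain B where B: "B \<ge> 0" "\<And>x q. x \<in> X \<Longrightarrow> q \<in> P \<Longrightarrow> \<bar>gap x q\<bar> \<le> B" by (rule gap_bounded) blast
  have "integrable \<mu> (\<lambda>x. gap x (TN \<mu> k N p x))"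
  proof (rule mu.integrable_const_bound)
    show "AE x in \<mu>. norm (gap x (TN \<mu> k N p x)) \<le> B" using AE_X by eventually_elim (use B TN_in_P in auto)
    show "(\<lambda>x. gap x (TN \<mu> k N p x)) \<in> borel_measurable \<mu>" unfolding gap_def by measurable
  qed
  then have "(\<integral>x. gap x (TN \<mu> k N p x) \<partial>\<mu>) \<le> (\<integral>x. \<phi> x + (\<integral>y. Q 1 (y(1 := x)) \<partial>M2) \<partial>\<mu>)"
    using AE_X integrable_mu[OF cont_\<phi>] integrable_Q1 gap_TN_le
    by (intro integral_mono_AE) (auto elim: eventually_mono)
  also have "\<dots> = (\<integral>\<omega>. Q 1 \<omega> \<partial>MN)"
    using integrable_mu[OF cont_\<phi>] integrable_Q1 normalized integral_Q1 by simp
  also have "(\<integral>\<omega>. Q 1 \<omega> \<partial>MN) = (\<Sum>i\<in>{1..N}. \<integral>\<omega>. Q 1 \<omega> \<partial>MN) / real N"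
    using N by simp
  also have "(\<Sum>i\<in>{1..N}. \<integral>\<omega>. Q 1 \<omega> \<partial>MN) = (\<Sum>i\<in>{1..N}. \<integral>\<omega>. Q i \<omega> \<partial>MN)"
    by (intro sum.cong refl Q_exchange[symmetric])
  also have "(\<Sum>i\<in>{1..N}. \<integral>\<omega>. Q i \<omega> \<partial>MN) = (\<integral>\<omega>. (\<Sum>i\<in>{1..N}. Q i \<omega>) \<partial>MN)"
    by (intro Bochner_Integration.integral_sum[symmetric] integrable_Q)
  also have "\<dots> = (\<Sum>j\<in>{1..N}. \<kappa> ((1 / real k) *\<^sub>R p j)) - (1 / real k) * (\<integral>\<omega>. (\<Sum>\<sigma>\<in>perms. W \<omega> \<sigma> * H \<sigma> \<omega>) \<partial>MN)"
    unfolding sum_Q using integrable_mean_H by (simp add: MN.prob_space)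
  finally show ?thesis .
qed

section \<open>Near-optimal matchings of the sample with the lattice points\<close>

lemma lattice_floor_close:
  fixes q q' :: "real ^ 'n"
  assumes "m > 0" "lattice_floor m q = lattice_floor m q'"
  shows "norm (q - q') \<le> 2 * real CARD('n) / real m"
  using norm_lattice_floor[OF assms(1), of q] norm_lattice_floor[OF assms(1), of q'] assms(2)
    norm_triangle_ineq4[of "(1 / real m) *\<^sub>R lattice_floor m q - q'" "(1 / real m) *\<^sub>R lattice_floor m q - q"]
  by simp

text \<open>An index whose target \<open>A i\<close> shares its cell with the assigned lattice point
  loses at most \<open>R\<close> times the bound on the cell diameter, any other at most
  \<open>2 * (R * L)\<close>; the number of the others is controlled by the differences of cell
  counts.\<close>

lemma H_matching:
  fixes A :: "nat \<Rightarrow> real ^ 'n" and m :: nat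
  assumes m: "m > 0" and \<Lambda>: "finite \<Lambda>" "lattice_floor m ` P \<subseteq> \<Lambda>"
    and \<omega>: "\<And>i. i \<in> {1..N} \<Longrightarrow> \<omega> i \<in> X" and A: "\<And>i. i \<in> {1..N} \<Longrightarrow> A i \<in> P"
  obtains \<sigma> where "\<sigma> \<in> perms"
    "real k * ((\<Sum>i\<in>{1..N}. \<omega> i \<bullet> A i) - real N * (R * (2 * real CARD('n) / real m))
      - 2 * (R * L) * (\<Sum>l\<in>\<Lambda>. \<bar>real (card {i \<in> {1..N}. lattice_floor m (A i) = l})
          - real (card {j \<in> {1..N}. lattice_floor m ((1 / real k) *\<^sub>R p j) = l})\<bar>)) \<le> H \<sigma> \<omega>"
proof -
  let ?b = "\<lambda>j. lattice_floor m ((1 / real k) *\<^sub>R p j)"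
  have "(\<lambda>i. lattice_floor m (A i)) ` {1..N} \<subseteq> \<Lambda>" using A \<Lambda>(2) by blast
  then obtain \<sigma> where \<sigma>: "\<sigma> permutes {1..N}"
    and mis: "real (card {i \<in> {1..N}. lattice_floor m (A i) \<noteq> ?b (\<sigma> i)})
      \<le> (\<Sum>l\<in>\<Lambda>. \<bar>real (card {i \<in> {1..N}. lattice_floor m (A i) = l}) - real (card {j \<in> {1..N}. ?b j = l})\<bar>)"
    by (rule matching_permutation[where A = "\<lambda>i. lattice_floor m (A i)" and B = ?b, OF finite_atLeastAtMost \<Lambda>(1)]) blast
  define bad where "bad = {i \<in> {1..N}. lattice_floor m (A i) \<noteq> ?b (\<sigma> i)}"
  define \<epsilon> where "\<epsilon> = R * (2 * real CARD('n) / real m)"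
  have \<epsilon>: "\<epsilon> \<ge> 0" using R(1) by (simp add: \<epsilon>_def)
  have one: "\<omega> i \<bullet> A i - \<epsilon> - 2 * (R * L) * (if i \<in> bad then 1 else 0) \<le> \<omega> i \<bullet> ((1 / real k) *\<^sub>R p (\<sigma> i))"
    if i: "i \<in> {1..N}" for i
  proof -
    have pP: "(1 / real k) *\<^sub>R p (\<sigma> i) \<in> P" using p_P perm_in[OF _ i, of \<sigma>] \<sigma> by simp
    show ?thesis
    proof (cases "i \<in> bad")
      case True
      have "- (R * L) \<le> \<omega> i \<bullet> ((1 / real k) *\<^sub>R p (\<sigma> i))" "\<omega> i \<bullet> A i \<le> R * L"
        using inner_bound[OF \<omega>[OF i] pP] inner_bound[OF \<omega>[OF i] A[OF i]] by linarith+
      then show ?thesis using \<epsilon> by (subst if_P[OF True]) linarith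
    next
      case False
      then have "norm (A i - (1 / real k) *\<^sub>R p (\<sigma> i)) \<le> 2 * real CARD('n) / real m"
        using i by (intro lattice_floor_close m) (simp add: bad_def)
      then have "norm (\<omega> i) * norm (A i - (1 / real k) *\<^sub>R p (\<sigma> i)) \<le> \<epsilon>"
        unfolding \<epsilon>_def using R(2)[OF \<omega>[OF i]] R(1) by (intro mult_mono) auto
      then have "\<omega> i \<bullet> (A i - (1 / real k) *\<^sub>R p (\<sigma> i)) \<le> \<epsilon>"
        using norm_cauchy_schwarz order_trans by blast
      then show ?thesis using False by (simp add: inner_diff_right)
    qed
  qed
  have "(\<Sum>i\<in>{1..N}. \<omega> i \<bullet> A i - \<epsilon> - 2 * (R * L) * (if i \<in> bad then 1 else 0))
      \<le> (\<Sum>i\<in>{1..N}. \<omega> i \<bullet> ((1 / real k) *\<^sub>R p (\<sigma> i)))" by (rule sum_mono[OF one])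
  also have "\<dots> = (1 / real k) * H \<sigma> \<omega>" by (simp add: H_def sum_distrib_left)
  also have "(\<Sum>i\<in>{1..N}. \<omega> i \<bullet> A i - \<epsilon> - 2 * (R * L) * (if i \<in> bad then 1 else 0))
      = (\<Sum>i\<in>{1..N}. \<omega> i \<bullet> A i) - real N * \<epsilon> - 2 * (R * L) * real (card bad)"
  proof -
    have "{1..N} \<inter> bad = bad" by (auto simp: bad_def)
    then have "(\<Sum>i\<in>{1..N}. if i \<in> bad then 1 else 0) = real (card bad)" by (simp add: sum.If_cases)
    then show ?thesis by (simp add: sum_subtractf flip: sum_distrib_left)
  qed
  finally have le: "(\<Sum>i\<in>{1..N}. \<omega> i \<bullet> A i) - real N * \<epsilon> - 2 * (R * L) * real (card bad) \<le> (1 / real k) * H \<sigma> \<omega>" .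
  let ?S = "\<Sum>l\<in>\<Lambda>. \<bar>real (card {i \<in> {1..N}. lattice_floor m (A i) = l}) - real (card {j \<in> {1..N}. ?b j = l})\<bar>"
  have "2 * (R * L) * real (card bad) \<le> 2 * (R * L) * ?S"
    using mis R(1) L(1) unfolding bad_def by (intro mult_left_mono) auto
  then have "(\<Sum>i\<in>{1..N}. \<omega> i \<bullet> A i) - real N * \<epsilon> - 2 * (R * L) * ?S \<le> (1 / real k) * H \<sigma> \<omega>"
    using le by linarith
  then have "real k * ((\<Sum>i\<in>{1..N}. \<omega> i \<bullet> A i) - real N * \<epsilon> - 2 * (R * L) * ?S) \<le> real k * ((1 / real k) * H \<sigma> \<omega>)"
    by (rule mult_left_mono) simp
  also have "\<dots> = H \<sigma> \<omega>" using k by simp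
  finally show ?thesis using \<sigma> by (intro that[of \<sigma>]) (auto simp: \<epsilon>_def)
qed

lemma T_in_P: "AE x in \<mu>. T x \<in> P" by (rule transport_map_in_P[OF transport_T])

text \<open>The targets are \<open>T (\<omega> i)\<close>. They are independent with law
  \<open>lam\<close>, so each cell count deviates from its mean by at most \<open>sqrt N\<close> on
  average, and \<open>\<omega> i \<bullet> T (\<omega> i)\<close> has mean \<open>J \<phi>\<close>.
  Passing from the energy of the matching to the Gibbs mean costs the entropy
  \<open>ln (fact N)\<close>.\<close>

lemma mean_H_lower:
  fixes m :: nat
  assumes m: "m > 0" and \<Lambda>: "finite \<Lambda>" "lattice_floor m ` P \<subseteq> \<Lambda>"
  shows "real k * (real N * J \<phi> - real N * (R * (2 * real CARD('n) / real m))
      - 2 * (R * L) * (\<Sum>l\<in>\<Lambda>. sqrt (real N) + \<bar>real N * measure lam {q. lattice_floor m q = l}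
          - real (card {j \<in> {1..N}. lattice_floor m ((1 / real k) *\<^sub>R p j) = l})\<bar>)) - ln (fact N)
    \<le> (\<integral>\<omega>. (\<Sum>\<sigma>\<in>perms. W \<omega> \<sigma> * H \<sigma> \<omega>) \<partial>MN)"
proof -
  define E where "E l = {q :: real ^ 'n. lattice_floor m q = l}" for l
  define \<pi> where "\<pi> l = measure lam (E l)" for l
  define g where "g l = real (card {j \<in> {1..N}. lattice_floor m ((1 / real k) *\<^sub>R p j) = l})" for l
  define n where "n l \<omega> = real (card {i \<in> {1..N}. lattice_floor m (T (\<omega> i)) = l})" for l and \<omega> :: "nat \<Rightarrow> real ^ 'n"
  have E [measurable]: "E l \<in> sets borel" for l
  proof (cases "\<forall>i. l $ i \<in> \<int>")
    case True
    then show ?thesis using lattice_cell(1)[OF m, of l] by (simp add: E_def)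
  next
    case False
    then have "E l = {}" by (auto simp: E_def lattice_floor_def)
    then show ?thesis by simp
  qed
  have n_sum: "n l \<omega> = (\<Sum>i\<in>{1..N}. indicator (E l) (T (\<omega> i)))" for l \<omega>
  proof -
    have "(\<Sum>i\<in>{1..N}. indicator (E l) (T (\<omega> i)) :: real) = (\<Sum>i\<in>{1..N}. if lattice_floor m (T (\<omega> i)) = l then 1 else 0)"
      by (intro sum.cong) (auto simp: E_def)
    also have "\<dots> = n l \<omega>" unfolding n_def by (simp add: sum.If_cases Int_def)
    finally show ?thesis by simp
  qed
  have nm [measurable]: "n l \<in> borel_measurable MN" for l unfolding n_sum[abs_def] by measurable
  have nN: "\<bar>n l \<omega>\<bar> \<le> real N" for l \<omega>
  proof -
    have "card {i \<in> {1..N}. lattice_floor m (T (\<omega> i)) = l} \<le> card {1..N}" by (intro card_mono) auto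
    then show ?thesis by (simp add: n_def)
  qed
  have \<pi>T: "(\<integral>x. indicator (E l) (T x) \<partial>\<mu>) = \<pi> l" for l
  proof -
    have "(\<integral>q. (indicator (E l) q :: real) \<partial>distr \<mu> borel T) = (\<integral>x. indicator (E l) (T x) \<partial>\<mu>)"
      by (rule integral_distr) measurable
    then show ?thesis by (simp add: push_T \<pi>_def)
  qed
  have \<pi>01: "0 \<le> \<pi> l" "\<pi> l \<le> 1" for l by (simp_all add: \<pi>_def)
  have dev: "(\<integral>\<omega>. \<bar>n l \<omega> - real N * \<pi> l\<bar> \<partial>MN) \<le> sqrt (real N)" for l
  proof -
    define f where "f x = indicator (E l) (T x) - \<pi> l" for x
    have fm: "f \<in> borel_measurable \<mu>" unfolding f_def by measurable
    have "integrable \<mu> (\<lambda>x. indicator (E l) (T x) :: real)"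
      by (rule mu.integrable_const_bound[of _ 1]) (auto simp: indicator_def)
    then have "(\<integral>x. f x \<partial>\<mu>) = 0" unfolding f_def by (simp add: \<pi>T)
    moreover have "\<bar>f x\<bar> \<le> 1" for x using \<pi>01[of l] by (auto simp: f_def indicator_def)
    ultimately have "(\<integral>\<omega>. \<bar>\<Sum>i\<in>{1..N}. f (\<omega> i)\<bar> \<partial>MN) \<le> sqrt (card {1..N})"
      using fm N by (intro mu.mean_abs_deviation_le) auto
    moreover have "(\<Sum>i\<in>{1..N}. f (\<omega> i)) = n l \<omega> - real N * \<pi> l" for \<omega> by (simp add: f_def sum_subtractf n_sum)
    ultimately show ?thesis by simp
  qed
  have int_dev: "integrable MN (\<lambda>\<omega>. \<bar>n l \<omega> - a\<bar>)" for l a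
  proof (rule MN.integrable_const_bound)
    show "AE \<omega> in MN. norm \<bar>n l \<omega> - a\<bar> \<le> real N + \<bar>a\<bar>"
    proof (rule AE_I2)
      fix \<omega>
      show "norm \<bar>n l \<omega> - a\<bar> \<le> real N + \<bar>a\<bar>" using nN[of l \<omega>] by (simp add: abs_le_iff) linarith
    qed
  qed measurable
  have dev': "(\<integral>\<omega>. \<bar>n l \<omega> - g l\<bar> \<partial>MN) \<le> sqrt (real N) + \<bar>real N * \<pi> l - g l\<bar>" for l
  proof -
    have "(\<integral>\<omega>. \<bar>n l \<omega> - g l\<bar> \<partial>MN) \<le> (\<integral>\<omega>. \<bar>n l \<omega> - real N * \<pi> l\<bar> + \<bar>real N * \<pi> l - g l\<bar> \<partial>MN)"
      using int_dev by (intro integral_mono) auto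
    also have "\<dots> = (\<integral>\<omega>. \<bar>n l \<omega> - real N * \<pi> l\<bar> \<partial>MN) + \<bar>real N * \<pi> l - g l\<bar>"
      using int_dev by (simp add: MN.prob_space)
    finally show ?thesis using dev[of l] by linarith
  qed
  have int_xT: "integrable \<mu> (\<lambda>x. x \<bullet> T x)"
  proof (rule mu.integrable_const_bound)
    show "AE x in \<mu>. norm (x \<bullet> T x) \<le> R * L" using AE_X T_in_P by eventually_elim (use inner_bound in auto)
  qed measurable
  have comp: "integrable MN (\<lambda>\<omega>. \<omega> i \<bullet> T (\<omega> i))" "(\<integral>\<omega>. \<omega> i \<bullet> T (\<omega> i) \<partial>MN) = J \<phi>" if i: "i \<in> {1..N}" for i
  proof -
    have d: "distr MN \<mu> (\<lambda>\<omega>. \<omega> i) = \<mu>" using i prob by (intro distr_PiM_component) auto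
    have m': "(\<lambda>\<omega>. \<omega> i) \<in> measurable MN \<mu>" using i by measurable
    have f: "(\<lambda>x. x \<bullet> T x) \<in> borel_measurable \<mu>" by measurable
    show "integrable MN (\<lambda>\<omega>. \<omega> i \<bullet> T (\<omega> i))" using int_xT integrable_distr_eq[OF m' f] by (simp add: d)
    show "(\<integral>\<omega>. \<omega> i \<bullet> T (\<omega> i) \<partial>MN) = J \<phi>" using integral_distr[OF m' f] cost_T by (simp add: d)
  qed
  define lowr where "lowr \<omega> = real k * ((\<Sum>i\<in>{1..N}. \<omega> i \<bullet> T (\<omega> i)) - real N * (R * (2 * real CARD('n) / real m))
      - 2 * (R * L) * (\<Sum>l\<in>\<Lambda>. \<bar>n l \<omega> - g l\<bar>)) - ln (fact N)" for \<omega>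
  have intl: "integrable MN lowr"
    unfolding lowr_def using comp int_dev
    by (intro Bochner_Integration.integrable_diff integrable_mult_right Bochner_Integration.integrable_sum) auto
  have "(\<integral>\<omega>. lowr \<omega> \<partial>MN) = real k * (real N * J \<phi> - real N * (R * (2 * real CARD('n) / real m))
      - 2 * (R * L) * (\<Sum>l\<in>\<Lambda>. \<integral>\<omega>. \<bar>n l \<omega> - g l\<bar> \<partial>MN)) - ln (fact N)"
  proof -
    define A where "A \<omega> = (\<Sum>i\<in>{1..N}. \<omega> i \<bullet> T (\<omega> i))" for \<omega>
    define B where "B \<omega> = (\<Sum>l\<in>\<Lambda>. \<bar>n l \<omega> - g l\<bar>)" for \<omega>
    have i: "integrable MN A" "integrable MN B" unfolding A_def B_def using comp int_dev by auto
    have "(\<integral>\<omega>. A \<omega> \<partial>MN) = (\<Sum>i\<in>{1..N}. \<integral>\<omega>. \<omega> i \<bullet> T (\<omega> i) \<partial>MN)"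
      unfolding A_def by (rule Bochner_Integration.integral_sum) (rule comp(1))
    also have "\<dots> = (\<Sum>i\<in>{1..N}. J \<phi>)" by (intro sum.cong refl comp(2))
    finally have eA: "(\<integral>\<omega>. A \<omega> \<partial>MN) = real N * J \<phi>" by simp
    have eB: "(\<integral>\<omega>. B \<omega> \<partial>MN) = (\<Sum>l\<in>\<Lambda>. \<integral>\<omega>. \<bar>n l \<omega> - g l\<bar> \<partial>MN)"
      unfolding B_def by (rule Bochner_Integration.integral_sum) (rule int_dev)
    show ?thesis
      unfolding lowr_def A_def[symmetric] B_def[symmetric] eA[symmetric] eB[symmetric]
      using i by (simp add: MN.prob_space)
  qed
  moreover have "(\<Sum>l\<in>\<Lambda>. \<integral>\<omega>. \<bar>n l \<omega> - g l\<bar> \<partial>MN) \<le> (\<Sum>l\<in>\<Lambda>. sqrt (real N) + \<bar>real N * \<pi> l - g l\<bar>)"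
    by (intro sum_mono dev')
  then have "real k * (real N * J \<phi> - real N * (R * (2 * real CARD('n) / real m)) - 2 * (R * L) * (\<Sum>l\<in>\<Lambda>. sqrt (real N) + \<bar>real N * \<pi> l - g l\<bar>))
    \<le> real k * (real N * J \<phi> - real N * (R * (2 * real CARD('n) / real m)) - 2 * (R * L) * (\<Sum>l\<in>\<Lambda>. \<integral>\<omega>. \<bar>n l \<omega> - g l\<bar> \<partial>MN))"
    using R(1) L(1) by (intro mult_left_mono diff_left_mono) auto
  moreover have "(\<integral>\<omega>. lowr \<omega> \<partial>MN) \<le> (\<integral>\<omega>. (\<Sum>\<sigma>\<in>perms. W \<omega> \<sigma> * H \<sigma> \<omega>) \<partial>MN)"
  proof (rule integral_mono_AE[OF intl integrable_mean_H])
    show "AE \<omega> in MN. lowr \<omega> \<le> (\<Sum>\<sigma>\<in>perms. W \<omega> \<sigma> * H \<sigma> \<omega>)"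
      using AE_MN[OF AE_X] AE_MN[OF T_in_P]
    proof eventually_elim
      case (elim \<omega>)
      obtain \<sigma> where \<sigma>: "\<sigma> \<in> perms" "lowr \<omega> + ln (fact N) \<le> H \<sigma> \<omega>"
        using H_matching[OF m \<Lambda>, of \<omega> "\<lambda>i. T (\<omega> i)"] elim unfolding lowr_def n_def g_def by auto
      have "H \<sigma> \<omega> - ln (real (card perms)) \<le> (\<Sum>\<sigma>\<in>perms. W \<omega> \<sigma> * H \<sigma> \<omega>)"
        unfolding W_def using softmax_mean_ge[OF pfin \<sigma>(1), of "\<lambda>\<sigma>. H \<sigma> \<omega>"] .
      then show ?case using \<sigma>(2) by (simp add: card_perms)
    qed
  qed
  ultimately show ?thesis unfolding \<pi>_def g_def E_def by linarith
qed

text \<open>The right-hand side becomes small when first \<open>k\<close>, then \<open>m\<close> tends to infinity.\<close>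

lemma integral_gap_TN_bound:
  fixes m :: nat
  assumes m: "m > 0" and \<Lambda>: "finite \<Lambda>" "lattice_floor m ` P \<subseteq> \<Lambda>"
  shows "(\<integral>x. gap x (TN \<mu> k N p x) \<partial>\<mu>)
    \<le> (\<Sum>j\<in>{1..N}. \<kappa> ((1 / real k) *\<^sub>R p j)) / real N - J \<phi> + R * (2 * real CARD('n) / real m)
      + 2 * (R * L) * (\<Sum>l\<in>\<Lambda>. 1 / sqrt (real N) + \<bar>measure lam {q. lattice_floor m q = l}
          - real (card {j \<in> {1..N}. lattice_floor m ((1 / real k) *\<^sub>R p j) = l}) / real N\<bar>)
      + ln (real N) / real k"
proof -
  define KS where "KS = (\<Sum>j\<in>{1..N}. \<kappa> ((1 / real k) *\<^sub>R p j))"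
  define MH where "MH = (\<integral>\<omega>. (\<Sum>\<sigma>\<in>perms. W \<omega> \<sigma> * H \<sigma> \<omega>) \<partial>MN)"
  define \<epsilon> where "\<epsilon> = R * (2 * real CARD('n) / real m)"
  define d where "d l = \<bar>measure lam {q. lattice_floor m q = l}
          - real (card {j \<in> {1..N}. lattice_floor m ((1 / real k) *\<^sub>R p j) = l}) / real N\<bar>" for l
  have NN: "real N > 0" using N by simp
  have sq: "sqrt (real N) = real N * (1 / sqrt (real N))" using NN by (simp add: real_div_sqrt)
  have dd: "\<bar>real N * measure lam {q. lattice_floor m q = l}
          - real (card {j \<in> {1..N}. lattice_floor m ((1 / real k) *\<^sub>R p j) = l})\<bar> = real N * d l" for l
  proof -
    have "real N * d l = \<bar>real N * (measure lam {q. lattice_floor m q = l}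
          - real (card {j \<in> {1..N}. lattice_floor m ((1 / real k) *\<^sub>R p j) = l}) / real N)\<bar>"
      using NN by (simp add: d_def abs_mult)
    then show ?thesis using NN by (simp add: right_diff_distrib)
  qed
  have "(\<Sum>l\<in>\<Lambda>. sqrt (real N) + \<bar>real N * measure lam {q. lattice_floor m q = l}
          - real (card {j \<in> {1..N}. lattice_floor m ((1 / real k) *\<^sub>R p j) = l})\<bar>)
    = real N * (\<Sum>l\<in>\<Lambda>. 1 / sqrt (real N) + d l)"
    unfolding dd sum_distrib_left by (intro sum.cong refl) (subst sq, simp add: distrib_left)
  then have "real k * (real N * J \<phi> - real N * \<epsilon> - 2 * (R * L) * (real N * (\<Sum>l\<in>\<Lambda>. 1 / sqrt (real N) + d l))) - ln (fact N) \<le> MH"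
    using mean_H_lower[OF m \<Lambda>] by (simp only: MH_def \<epsilon>_def)
  moreover have "ln (fact N) \<le> real N * ln (real N)"
  proof -
    have "(fact N :: real) \<le> real N ^ N" using fact_le_power[of N, where 'a = real] by simp
    then have "ln (fact N :: real) \<le> ln (real N ^ N)" by (intro ln_mono) (use NN in auto)
    then show ?thesis using NN by (simp add: ln_realpow)
  qed
  ultimately have "real k * (real N * (J \<phi> - \<epsilon> - 2 * (R * L) * (\<Sum>l\<in>\<Lambda>. 1 / sqrt (real N) + d l))) - real N * ln (real N) \<le> MH"
    by (simp add: right_diff_distrib mult.left_commute)
  then have "(1 / real k) * (real k * (real N * (J \<phi> - \<epsilon> - 2 * (R * L) * (\<Sum>l\<in>\<Lambda>. 1 / sqrt (real N) + d l))) - real N * ln (real N))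
     \<le> (1 / real k) * MH" by (rule mult_left_mono) simp
  then have "real N * (J \<phi> - \<epsilon> - 2 * (R * L) * (\<Sum>l\<in>\<Lambda>. 1 / sqrt (real N) + d l) - ln (real N) / real k) \<le> (1 / real k) * MH"
    using k by (simp add: right_diff_distrib)
  then have "(KS - (1 / real k) * MH) / real N \<le> (KS - real N * (J \<phi> - \<epsilon> - 2 * (R * L) * (\<Sum>l\<in>\<Lambda>. 1 / sqrt (real N) + d l) - ln (real N) / real k)) / real N"
    using NN by (intro divide_right_mono) auto
  also have "\<dots> = KS / real N - (J \<phi> - \<epsilon> - 2 * (R * L) * (\<Sum>l\<in>\<Lambda>. 1 / sqrt (real N) + d l) - ln (real N) / real k)"
    using NN by (simp add: diff_divide_distrib)
  finally show ?thesis
    using integral_gap_TN_le unfolding KS_def MH_def \<epsilon>_def d_def by linarith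
qed

end


section \<open>The limit\<close>

locale permanent_problem = brenier_density P X \<mu> \<phi> a b
  for P X :: "(real ^ 'n) set" and \<mu> :: "(real ^ 'n) measure" and \<phi> :: "real ^ 'n \<Rightarrow> real" and a b :: real +
  fixes p :: "nat \<Rightarrow> nat \<Rightarrow> real ^ 'n"
  assumes p_enum: "\<And>k. k > 0 \<Longrightarrow> bij_betw (p k) {1..num_points P k} (lattice_points P k)"
begin

lemma sample: "k > 0 \<Longrightarrow> num_points P k > 0 \<Longrightarrow> sample P X \<mu> \<phi> a b k (num_points P k) (p k)"
proof (intro sample.intro sample_axioms.intro brenier_density_axioms)
  fix j assume k: "k > 0" and j: "j \<in> {1..num_points P k}"
  have "p k j \<in> lattice_points P k" using bij_betwE[OF p_enum[OF k]] j by blast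
  then show "(1 / real k) *\<^sub>R p k j \<in> P" using k by (simp add: lattice_points_iff)
qed

lemma sum_points:
  fixes f :: "real ^ 'n \<Rightarrow> real"
  assumes "k > 0"
  shows "(\<Sum>j\<in>{1..num_points P k}. f (p k j)) = (\<Sum>z\<in>lattice_points P k. f z)"
  using sum.reindex_bij_betw[OF p_enum[OF assms]] .

lemma bounded_P: "bounded P" by (rule compact_imp_bounded[OF P(2)])

lemma frontier_P: "negligible (frontier P)" by (rule negligible_convex_frontier[OF P(1)])

lemma integral_lam:
  fixes f :: "real ^ 'n \<Rightarrow> real"
  assumes "f \<in> borel_measurable borel"
  shows "(\<integral>q. indicator P q * f q \<partial>lborel) = (\<integral>q. f q \<partial>lam)"
proof -
  have "lam = density lborel (\<lambda>q. ennreal (indicator P q))"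
    by (intro density_cong) (auto simp: indicator_def)
  then show ?thesis using assms by (simp add: integral_real_density)
qed

lemma riemann_P:
  fixes f :: "real ^ 'n \<Rightarrow> real"
  assumes f: "continuous_on UNIV f"
  shows "(\<lambda>k. (\<Sum>j\<in>{1..num_points P k}. f ((1 / real k) *\<^sub>R p k j)) / real k ^ CARD('n)) \<longlonglongrightarrow> (\<integral>q. f q \<partial>lam)"
proof -
  have "(\<lambda>k. (\<Sum>z\<in>lattice_points P k. f ((1 / real k) *\<^sub>R z)) / real k ^ CARD('n)) \<longlonglongrightarrow> (\<integral>q. f q \<partial>lam)"
    using riemann_sum_lattice[OF bounded_P P_borel frontier_P f]
      integral_lam[OF borel_measurable_continuous_onI[OF f]] by simp
  then show ?thesis
  proof (rule Lim_transform_eventually)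
    show "eventually (\<lambda>k. (\<Sum>z\<in>lattice_points P k. f ((1 / real k) *\<^sub>R z)) / real k ^ CARD('n)
        = (\<Sum>j\<in>{1..num_points P k}. f ((1 / real k) *\<^sub>R p k j)) / real k ^ CARD('n)) sequentially"
      using eventually_gt_at_top[of 0]
      by eventually_elim (simp only: sum_points[of _ "\<lambda>z. f ((1 / real _) *\<^sub>R z)"])
  qed
qed

lemma num_points_growth: "(\<lambda>k. real (num_points P k) / real k ^ CARD('n)) \<longlonglongrightarrow> 1"
  using riemann_P[of "\<lambda>_. 1"] by simp

lemma eventually_num_points: "eventually (\<lambda>k. real k / 2 \<le> real (num_points P k) \<and> real (num_points P k) \<le> 2 * real k ^ CARD('n)) sequentially"
proof -
  have "eventually (\<lambda>k. 1 / 2 < real (num_points P k) / real k ^ CARD('n)) sequentially"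
    "eventually (\<lambda>k. real (num_points P k) / real k ^ CARD('n) < 2) sequentially"
    using order_tendstoD(1)[OF num_points_growth, of "1 / 2"] order_tendstoD(2)[OF num_points_growth, of 2] by simp_all
  then show ?thesis
    using eventually_gt_at_top[of 0]
  proof eventually_elim
    case (elim k)
    then have "0 < real k ^ CARD('n)" by simp
    moreover have "real k ^ 1 \<le> real k ^ CARD('n)" using elim(3) by (intro power_increasing) (auto simp: Suc_leI)
    ultimately have "real k \<le> real k ^ CARD('n)" "real k ^ CARD('n) < 2 * real (num_points P k)"
      "real (num_points P k) < 2 * real k ^ CARD('n)"
      using elim(1,2) by (simp_all only: power_one_right pos_less_divide_eq pos_divide_less_eq)
    then show ?case by linarith
  qed
qed

lemma eventually_num_points_pos: "eventually (\<lambda>k. k > 0 \<and> num_points P k > 0) sequentially"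
  using eventually_num_points eventually_gt_at_top[of 0]
  by eventually_elim auto

lemma num_points_at_top: "filterlim (\<lambda>k. real (num_points P k)) at_top sequentially"
proof (rule filterlim_at_top_mono)
  show "filterlim (\<lambda>k. real k / 2) at_top sequentially"
    by (intro filterlim_at_top_mult_tendsto_pos[of "\<lambda>_. 1 / 2" "1 / 2", simplified] filterlim_real_sequentially tendsto_const)
  show "eventually (\<lambda>k. real k / 2 \<le> real (num_points P k)) sequentially"
    using eventually_num_points by eventually_elim simp
qed

lemma average_limit:
  assumes "(\<lambda>k. S k / real k ^ CARD('n)) \<longlonglongrightarrow> s"
  shows "(\<lambda>k. S k / real (num_points P k)) \<longlonglongrightarrow> s"
proof -
  have "(\<lambda>k. (S k / real k ^ CARD('n)) / (real (num_points P k) / real k ^ CARD('n))) \<longlonglongrightarrow> s / 1"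
    by (intro tendsto_divide assms num_points_growth) simp
  then have "(\<lambda>k. (S k / real k ^ CARD('n)) / (real (num_points P k) / real k ^ CARD('n))) \<longlonglongrightarrow> s" by simp
  then show ?thesis
    by (rule Lim_transform_eventually) (use eventually_gt_at_top[of 0] in eventually_elim, simp)
qed

text \<open>The number of points grows polynomially in \<open>k\<close>, so the entropy per point is
  negligible against \<open>k\<close>.\<close>

lemma ln_num_points: "(\<lambda>k. ln (real (num_points P k)) / real k) \<longlonglongrightarrow> 0"
proof (rule tendsto_sandwich)
  show "eventually (\<lambda>k. 0 \<le> ln (real (num_points P k)) / real k) sequentially"
    using eventually_num_points_pos by eventually_elim simp
  show "eventually (\<lambda>k. ln (real (num_points P k)) / real k \<le> ln 2 / real k + real CARD('n) * (ln (real k) / real k)) sequentially"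
    using eventually_num_points_pos eventually_num_points
  proof eventually_elim
    case (elim k)
    then have "ln (real (num_points P k)) \<le> ln (2 * real k ^ CARD('n))" by (intro ln_mono) auto
    also have "\<dots> = ln 2 + real CARD('n) * ln (real k)" using elim by (simp add: ln_mult ln_realpow)
    finally show ?case using elim by (simp add: divide_right_mono flip: add_divide_distrib)
  qed
  have "((\<lambda>x::real. ln x / x) \<longlongrightarrow> 0) at_top" by (rule ln_x_over_x_tendsto_0)
  then have "(\<lambda>k. ln (real k) / real k) \<longlonglongrightarrow> 0" by (rule filterlim_compose[OF _ filterlim_real_sequentially])
  then have "(\<lambda>k. ln 2 / real k + real CARD('n) * (ln (real k) / real k)) \<longlonglongrightarrow> 0 + real CARD('n) * 0"
    by (intro tendsto_intros lim_const_over_n)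
  then show "(\<lambda>k. ln 2 / real k + real CARD('n) * (ln (real k) / real k)) \<longlonglongrightarrow> 0" by simp
qed simp

text \<open>A cell is convex, hence so is its intersection with \<open>P\<close>; its frontier is
  therefore null and the Riemann sum limit applies to it.\<close>

lemma cell_limit:
  fixes m :: nat
  assumes m: "m > 0"
  shows "(\<lambda>k. real (card {j \<in> {1..num_points P k}. lattice_floor m ((1 / real k) *\<^sub>R p k j) = l}) / real (num_points P k))
    \<longlonglongrightarrow> measure lam {q. lattice_floor m q = l}"
proof (cases "\<forall>i. l $ i \<in> \<int>")
  case False
  then have "lattice_floor m q \<noteq> l" for q by (auto simp: lattice_floor_def)
  then show ?thesis by simp
next
  case True
  define C where "C = {q. lattice_floor m q = l}"
  have C: "C \<in> sets borel" "convex C" using lattice_cell[OF m, of l] True by (auto simp: C_def)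
  have PC: "bounded (P \<inter> C)" "P \<inter> C \<in> sets borel" "negligible (frontier (P \<inter> C))"
    using bounded_P C P(1) by (auto intro: bounded_Int negligible_convex_frontier convex_Int)
  have eq: "real (card {j \<in> {1..num_points P k}. lattice_floor m ((1 / real k) *\<^sub>R p k j) = l})
      = (\<Sum>z\<in>lattice_points (P \<inter> C) k. 1)" if k: "k > 0" for k
  proof -
    have "bij_betw (p k) {j \<in> {1..num_points P k}. lattice_floor m ((1 / real k) *\<^sub>R p k j) = l} (lattice_points (P \<inter> C) k)"
    proof (rule bij_betw_subset[OF p_enum[OF k]])
      have img: "p k ` {1..num_points P k} = lattice_points P k" using p_enum[OF k] by (simp add: bij_betw_def)
      show "p k ` {j \<in> {1..num_points P k}. lattice_floor m ((1 / real k) *\<^sub>R p k j) = l} = lattice_points (P \<inter> C) k"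
      proof
        show "p k ` {j \<in> {1..num_points P k}. lattice_floor m ((1 / real k) *\<^sub>R p k j) = l} \<subseteq> lattice_points (P \<inter> C) k"
          using img k by (auto simp: lattice_points_iff C_def)
        show "lattice_points (P \<inter> C) k \<subseteq> p k ` {j \<in> {1..num_points P k}. lattice_floor m ((1 / real k) *\<^sub>R p k j) = l}"
        proof
          fix z assume z: "z \<in> lattice_points (P \<inter> C) k"
          then have "z \<in> lattice_points P k" using k by (simp add: lattice_points_iff)
          then obtain j where "j \<in> {1..num_points P k}" "z = p k j" using img by blast
          then show "z \<in> p k ` {j \<in> {1..num_points P k}. lattice_floor m ((1 / real k) *\<^sub>R p k j) = l}"
            using z k by (auto simp: lattice_points_iff C_def)
        qed
      qed
    qed auto
    then show ?thesis by (simp add: bij_betw_same_card)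
  qed
  have "(\<integral>q. indicator (P \<inter> C) q * 1 \<partial>lborel) = measure lam C"
  proof -
    have "(\<integral>q. indicator (P \<inter> C) q * 1 \<partial>lborel) = (\<integral>q. indicator P q * (indicator C q :: real) \<partial>lborel)"
      by (intro Bochner_Integration.integral_cong) (auto simp: indicator_def)
    also have "\<dots> = (\<integral>q. indicator C q \<partial>lam)" using C by (intro integral_lam) simp
    also have "\<dots> = measure lam C" by simp
    finally show ?thesis .
  qed
  then have "(\<lambda>k. (\<Sum>z\<in>lattice_points (P \<inter> C) k. 1) / real k ^ CARD('n)) \<longlonglongrightarrow> measure lam C"
    using riemann_sum_lattice[OF PC, of "\<lambda>_. 1"] by simp
  then have "(\<lambda>k. real (card {j \<in> {1..num_points P k}. lattice_floor m ((1 / real k) *\<^sub>R p k j) = l}) / real k ^ CARD('n)) \<longlonglongrightarrow> measure lam C"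
    by (rule Lim_transform_eventually) (use eventually_gt_at_top[of 0] in eventually_elim, simp only: eq)
  then show ?thesis unfolding C_def by (rule average_limit)
qed

lemma finite_cells: assumes "m > 0" shows "finite (lattice_floor m ` P)"
proof -
  define D where "D = (\<Union>x\<in>P. \<Union>y\<in>cball 0 (real CARD('n) / real m). {x + y})"
  have "compact D" unfolding D_def using compact_sums'[OF P(2) compact_cball] by simp
  then have "finite (lattice_points D m)" by (intro finite_lattice_points compact_imp_bounded)
  moreover have "lattice_floor m ` P \<subseteq> lattice_points D m"
  proof
    fix z assume "z \<in> lattice_floor m ` P"
    then obtain q where q: "q \<in> P" "z = lattice_floor m q" by blast
    have "(1 / real m) *\<^sub>R z = q + ((1 / real m) *\<^sub>R z - q)" by simp
    moreover have "(1 / real m) *\<^sub>R z - q \<in> cball 0 (real CARD('n) / real m)"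
      using norm_lattice_floor[OF assms, of q] q by simp
    ultimately have "(1 / real m) *\<^sub>R z \<in> D" unfolding D_def using q(1) by blast
    moreover have "z $ i \<in> \<int>" for i using q by (simp add: lattice_floor_def)
    ultimately show "z \<in> lattice_points D m" using assms by (simp add: lattice_points_iff)
  qed
  ultimately show ?thesis by (rule finite_subset[rotated])
qed

lemma J_\<phi>: "J \<phi> = (\<integral>q. \<kappa> q \<partial>lam)"
  by (simp add: J_def normalized \<kappa>_def[symmetric])

lemma gap_tends_to_0: "(\<lambda>k. \<integral>x. gap x (TN \<mu> k (num_points P k) (p k) x) \<partial>\<mu>) \<longlonglongrightarrow> 0"
proof (rule LIMSEQ_I)
  fix \<epsilon> :: real assume \<epsilon>: "\<epsilon> > 0"
  \<comment> \<open>The mesh is fixed before \<open>k\<close> grows, so \<Lambda> stays the same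
    finite set and the errors of its cells vanish in the limit.\<close>
  obtain m :: nat where m: "m > 0" "R * (2 * real CARD('n) / real m) < \<epsilon> / 2"
  proof -
    have "(\<lambda>m. R * (2 * real CARD('n) / real m)) \<longlonglongrightarrow> R * 0" by (intro tendsto_intros lim_const_over_n)
    then have "eventually (\<lambda>m. R * (2 * real CARD('n) / real m) < \<epsilon> / 2) sequentially"
      using \<epsilon> by (intro order_tendstoD(2)[of _ 0]) auto
    then have "eventually (\<lambda>m. 0 < m \<and> R * (2 * real CARD('n) / real m) < \<epsilon> / 2) sequentially"
      using eventually_gt_at_top[of 0] by eventually_elim simp
    then show ?thesis using that eventually_happens'[OF sequentially_bot] by blast
  qed
  define \<Lambda> where "\<Lambda> = lattice_floor m ` P"
  define N where "N k = num_points P k" for k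
  define E where "E k = (\<Sum>j\<in>{1..N k}. \<kappa> ((1 / real k) *\<^sub>R p k j)) / real (N k) - J \<phi> + R * (2 * real CARD('n) / real m)
      + 2 * (R * L) * (\<Sum>l\<in>\<Lambda>. 1 / sqrt (real (N k)) + \<bar>measure lam {q. lattice_floor m q = l}
          - real (card {j \<in> {1..N k}. lattice_floor m ((1 / real k) *\<^sub>R p k j) = l}) / real (N k)\<bar>)
      + ln (real (N k)) / real k" for k
  have "(\<lambda>k. (\<Sum>j\<in>{1..N k}. \<kappa> ((1 / real k) *\<^sub>R p k j)) / real (N k)) \<longlonglongrightarrow> J \<phi>"
    unfolding N_def J_\<phi> by (intro average_limit riemann_P cont_\<kappa>)
  moreover have "(\<lambda>k. 1 / sqrt (real (N k))) \<longlonglongrightarrow> 0"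
    unfolding N_def by (intro tendsto_divide_0[OF tendsto_const] filterlim_at_top_imp_at_infinity
        filterlim_compose[OF sqrt_at_top num_points_at_top])
  moreover have "(\<lambda>k. real (card {j \<in> {1..N k}. lattice_floor m ((1 / real k) *\<^sub>R p k j) = l}) / real (N k))
      \<longlonglongrightarrow> measure lam {q. lattice_floor m q = l}" for l unfolding N_def by (rule cell_limit[OF m(1)])
  moreover have "(\<lambda>k. ln (real (N k)) / real k) \<longlonglongrightarrow> 0" unfolding N_def by (rule ln_num_points)
  ultimately have "E \<longlonglongrightarrow> J \<phi> - J \<phi> + R * (2 * real CARD('n) / real m)
      + 2 * (R * L) * (\<Sum>l\<in>\<Lambda>. 0 + \<bar>measure lam {q. lattice_floor m q = l} - measure lam {q. lattice_floor m q = l}\<bar>) + 0"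
    unfolding E_def[abs_def] by (intro tendsto_intros)
  then have "E \<longlonglongrightarrow> R * (2 * real CARD('n) / real m)" by simp
  then have "eventually (\<lambda>k. E k < \<epsilon>) sequentially"
    by (rule order_tendstoD(2)) (use m(2) \<epsilon> in linarith)
  then have "eventually (\<lambda>k. norm ((\<integral>x. gap x (TN \<mu> k (num_points P k) (p k) x) \<partial>\<mu>) - 0) < \<epsilon>) sequentially"
    using eventually_num_points_pos
  proof eventually_elim
    case (elim k)
    interpret sample P X \<mu> \<phi> a b k "num_points P k" "p k" using elim by (intro sample) auto
    have "(\<integral>x. gap x (TN \<mu> k (num_points P k) (p k) x) \<partial>\<mu>) \<le> E k"
      using integral_gap_TN_bound[OF m(1) finite_cells[OF m(1)] order_refl] unfolding E_def N_def \<Lambda>_def .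
    then show ?case using elim(1) gap_integral_nonneg[of "TN \<mu> k (num_points P k) (p k)"] by simp
  qed
  then show "\<exists>n0. \<forall>k\<ge>n0. norm ((\<integral>x. gap x (TN \<mu> k (num_points P k) (p k) x) \<partial>\<mu>) - 0) < \<epsilon>"
    by (simp add: eventually_sequentially)
qed

text \<open>The estimates at level \<open>k\<close> require \<open>k\<close> and the number of
  points to be positive, which holds from some \<open>k0\<close> on; the sequence is shifted by
  \<open>k0\<close> and the shift undone afterwards.\<close>

lemma limits:
  shows "compact K \<Longrightarrow> uniform_limit K (\<lambda>k. phiN \<mu> k (num_points P k) (p k)) \<phi> sequentially"
    and "x \<in> interior X \<Longrightarrow> (\<lambda>k. TN \<mu> k (num_points P k) (p k) x) \<longlonglongrightarrow> T x"
proof -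
  obtain k0 where k0: "\<And>k. k \<ge> k0 \<Longrightarrow> k > 0 \<and> num_points P k > 0"
    using eventually_num_points_pos by (auto simp: eventually_sequentially)
  define f where "f n = phiN \<mu> (n + k0) (num_points P (n + k0)) (p (n + k0))" for n
  define t where "t n = TN \<mu> (n + k0) (num_points P (n + k0)) (p (n + k0))" for n
  have s: "sample P X \<mu> \<phi> a b (n + k0) (num_points P (n + k0)) (p (n + k0))" for n
    using k0[of "n + k0"] by (intro sample) auto
  have 1: "t n x \<in> subdifferential (f n) x" "t n x \<in> P" "t n \<in> borel_measurable borel" "(\<integral>x. f n x \<partial>\<mu>) = 0" for n x
    unfolding f_def t_def
    by (rule sample.TN_subgradient[OF s] sample.TN_in_P[OF s] sample.TN_measurable[OF s] sample.integral_phiN[OF s])+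
  have 2: "(\<lambda>n. \<integral>x. gap x (t n x) \<partial>\<mu>) \<longlonglongrightarrow> 0"
    unfolding t_def using LIMSEQ_ignore_initial_segment[OF gap_tends_to_0, of k0] .
  show "uniform_limit K (\<lambda>k. phiN \<mu> k (num_points P k) (p k)) \<phi> sequentially" if "compact K"
  proof (rule uniform_limitI)
    fix e :: real assume "e > 0"
    then have "eventually (\<lambda>n. \<forall>x\<in>K. dist (f n x) (\<phi> x) < e) sequentially"
      by (rule uniform_limitD[OF convergence(1)[OF 1 2 that]])
    then show "eventually (\<lambda>k. \<forall>x\<in>K. dist (phiN \<mu> k (num_points P k) (p k) x) (\<phi> x) < e) sequentially"
      unfolding f_def by (rule eventually_sequentially_seg[THEN iffD1])
  qed
  show "(\<lambda>k. TN \<mu> k (num_points P k) (p k) x) \<longlonglongrightarrow> T x" if "x \<in> interior X"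
  proof (rule LIMSEQ_offset)
    show "(\<lambda>n. TN \<mu> (n + k0) (num_points P (n + k0)) (p (n + k0)) x) \<longlonglongrightarrow> T x"
      using convergence(2)[OF 1 2 T[OF that]] by (simp add: t_def)
  qed
qed

end

theorem corollary1p3:
  fixes P X D :: "(real ^ 'n) set"
    and \<rho>0 :: "real ^ 'n \<Rightarrow> real"
    and \<mu>0 :: "(real ^ 'n) measure"
    and p :: "nat \<Rightarrow> nat \<Rightarrow> real ^ 'n"
  assumes P_body: "convex P" "compact P" "interior P \<noteq> {}"
    and P_volume: "emeasure lborel P = 1"
    and D_domain: "open D" "connected D" "D \<noteq> {}" "bounded D"
    and X_closure: "X = closure D"
    and X_boundary: "frontier X \<in> null_sets lborel"
    and \<rho>0_meas: "set_borel_measurable borel X \<rho>0"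
    and \<rho>0_bounds: "\<exists>a b. 0 < a \<and> 0 < b \<and> (\<forall>x\<in>X. a \<le> \<rho>0 x \<and> \<rho>0 x \<le> b)"
    and \<mu>0_density: "\<mu>0 = density lborel (\<lambda>x. ennreal (\<rho>0 x * indicator X x))"
    and \<mu>0_prob: "prob_space \<mu>0"
    and p_enum: "\<And>k. k > 0 \<Longrightarrow> bij_betw (p k) {1..num_points P k} (lattice_points P k)"
  shows "(\<exists>\<phi>. solves_second_bvp \<mu>0 P \<phi> \<and> (\<integral>x. \<phi> x \<partial>\<mu>0) = 0 \<and>
            (\<forall>\<psi>. solves_second_bvp \<mu>0 P \<psi> \<and> (\<integral>x. \<psi> x \<partial>\<mu>0) = 0 \<longrightarrow> \<psi> = \<phi>) \<and>
            (\<forall>K. compact K \<longrightarrow>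
               uniform_limit K (\<lambda>k. phiN \<mu>0 k (num_points P k) (p k)) \<phi> sequentially)) \<and>
         (\<forall>k>0. num_points P k > 0 \<longrightarrow>
            (\<forall>x. GDERIV (phiN \<mu>0 k (num_points P k) (p k)) x
                   :> TN \<mu>0 k (num_points P k) (p k) x)) \<and>
         (\<exists>T. optimal_map \<mu>0 (density lborel (indicator P)) T \<and>
            (\<forall>S. optimal_map \<mu>0 (density lborel (indicator P)) S \<longrightarrow> (AE x in \<mu>0. S x = T x)) \<and>
            locally_hoelder_on (interior X) T \<and>
            (\<forall>x\<in>interior X. (\<lambda>k. TN \<mu>0 k (num_points P k) (p k) x) \<longlonglongrightarrow> T x))"
proof -
  obtain a b where ab: "0 < a" "0 < b" and \<rho>_ab: "\<And>x. x \<in> X \<Longrightarrow> a \<le> \<rho>0 x \<and> \<rho>0 x \<le> b"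
    using \<rho>0_bounds by blast
  have X: "compact X" using D_domain by (simp add: X_closure compact_closure)
  then have [measurable]: "X \<in> sets borel" by (simp add: borel_compact)
  have \<rho>_meas [measurable]: "(\<lambda>x. \<rho>0 x * indicator X x) \<in> borel_measurable borel"
    using \<rho>0_meas by (simp add: set_borel_measurable_def mult.commute)
  have AE_\<mu>: "(AE x in \<mu>0. Q x) \<longleftrightarrow> (AE x in lborel. 0 < ennreal (\<rho>0 x * indicator X x) \<longrightarrow> Q x)" for Q
    unfolding \<mu>0_density by (rule AE_density) measurable
  interpret transport_problem P X \<mu>0
  proof (rule transport_problem.intro)
    show "sets \<mu>0 = sets borel" by (simp add: \<mu>0_density)
    show "AE x in \<mu>0. x \<in> X" unfolding AE_\<mu> by (intro AE_I2) (auto simp: indicator_def)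
    show "AE x in \<mu>0. Q x" if "AE x in lborel. Q x" for Q
      unfolding AE_\<mu> using that by eventually_elim simp
  qed (fact P_body P_volume X \<mu>0_prob)+
  obtain \<phi> where \<phi>: "continuous_on UNIV \<phi>" "bi \<phi> = \<phi>" "(\<integral>x. \<phi> x \<partial>\<mu>0) = 0"
    "\<And>f. continuous_on UNIV f \<Longrightarrow> J \<phi> \<le> J f"
    by (rule minimizer_exists) blast
  interpret brenier P X \<mu>0 \<phi> by standard (fact \<phi>)+
  \<comment> \<open>On \<open>X\<close> the density lies between \<open>a\<close> and
    \<open>b\<close>, and off \<open>X\<close> it vanishes.\<close>
  have bounds: "ennreal a * emeasure lborel (E \<inter> X) \<le> emeasure \<mu>0 E" "emeasure \<mu>0 E \<le> ennreal b * emeasure lborel (E \<inter> X)"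
    if "open E" for E
  proof -
    have [measurable]: "E \<in> sets borel" using that by simp
    have e: "emeasure \<mu>0 E = (\<integral>\<^sup>+x. ennreal (\<rho>0 x * indicator X x) * indicator E x \<partial>lborel)"
      unfolding \<mu>0_density by (subst emeasure_density) auto
    have c: "ennreal c * emeasure lborel (E \<inter> X) = (\<integral>\<^sup>+x. ennreal c * indicator (E \<inter> X) x \<partial>lborel)" for c
      by (rule nn_integral_cmult_indicator[symmetric]) measurable
    show "ennreal a * emeasure lborel (E \<inter> X) \<le> emeasure \<mu>0 E" "emeasure \<mu>0 E \<le> ennreal b * emeasure lborel (E \<inter> X)"
      unfolding e c using \<rho>_ab by (auto intro!: nn_integral_mono simp: indicator_def ennreal_leI)
  qed
  interpret brenier_density P X \<mu>0 \<phi> a b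
  proof
    fix E :: "(real ^ 'n) set" assume E: "open E"
    have EX: "E \<inter> X \<in> sets borel" using E by simp
    have "bounded (E \<inter> X)" using X by (simp add: compact_imp_bounded bounded_Int)
    then have fin: "emeasure lborel (E \<inter> X) = ennreal (measure lebesgue (E \<inter> X))"
      using emeasure_bounded_finite[of "E \<inter> X"] EX by (simp add: emeasure_eq_ennreal_measure less_top)
    show "a * measure lebesgue (E \<inter> X) \<le> measure \<mu>0 E" "measure \<mu>0 E \<le> b * measure lebesgue (E \<inter> X)"
      using bounds[OF E] ab by (simp_all add: fin mu.emeasure_eq_measure flip: ennreal_mult)
  next
    have "AE x in lborel. x \<notin> frontier X" using X_boundary by (rule AE_not_in)
    from ac[OF this] AE_X show "AE x in \<mu>0. x \<in> interior X"
      by eventually_elim (use closure_subset[of X] in \<open>auto simp: frontier_def\<close>)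
  qed (fact ab)+
  interpret permanent_problem P X \<mu>0 \<phi> a b p by standard (fact p_enum)
  show ?thesis
  proof (intro conjI)
    show "\<exists>\<phi>. solves_second_bvp \<mu>0 P \<phi> \<and> (\<integral>x. \<phi> x \<partial>\<mu>0) = 0 \<and>
            (\<forall>\<psi>. solves_second_bvp \<mu>0 P \<psi> \<and> (\<integral>x. \<psi> x \<partial>\<mu>0) = 0 \<longrightarrow> \<psi> = \<phi>) \<and>
            (\<forall>K. compact K \<longrightarrow>
               uniform_limit K (\<lambda>k. phiN \<mu>0 k (num_points P k) (p k)) \<phi> sequentially)"
      using \<phi>_solves normalized \<phi>_unique limits(1) by blast
    show "\<forall>k>0. num_points P k > 0 \<longrightarrow>
            (\<forall>x. GDERIV (phiN \<mu>0 k (num_points P k) (p k)) x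
                   :> TN \<mu>0 k (num_points P k) (p k) x)"
      using sample.gderiv_phiN[OF sample] by blast
    show "\<exists>T. optimal_map \<mu>0 (density lborel (indicator P)) T \<and>
            (\<forall>S. optimal_map \<mu>0 (density lborel (indicator P)) S \<longrightarrow> (AE x in \<mu>0. S x = T x)) \<and>
            locally_hoelder_on (interior X) T \<and>
            (\<forall>x\<in>interior X. (\<lambda>k. TN \<mu>0 k (num_points P k) (p k) x) \<longlonglongrightarrow> T x)"
      using optimal_T optimal_unique T_hoelder limits(2) by blast
  qed
qed


end
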